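(* Let $k\in\{-1,0\}$, let $N\ge2$ be an integer, and let $\Lambda<0$ be fixed but arbitrary. There exist non-trivial black hole solutions of the $\mathfrak{su}(N)$ topological Einstein--Yang--Mills field equations with cosmological constant $\Lambda$, regular throughout the range $r_h<r<\infty$. These solutions are analytic in the parameters $r_h$, $\omega_{j,h}=\omega_j(r_h)$ ($j=1,\dots,N-1$) and $m(r_h)$, and are nodeless.
   Context: Fix $k$ and an integer $N$. The $\mathfrak{su}(N)$ topological Einstein--Yang--Mills (EYM) field equations with cosmological constant $\Lambda<0$ are the following ordinary differential equations for real functions $m(r)$, $S(r)>0$, $\omega_1(r),\dots,\omega_{N-1}(r)$ (prime is $d/dr$, and $\omega_0\equiv\omega_N\equiv0$): $$r^2\mu\,\omega_j''+\Big(2m-2r^3p_{\theta,k}-\tfrac{2\Lambda r^3}{3}\Big)\omega_j'+W_{k,j}\,\omega_j=0\quad(j=1,\dots,N-1),$$ $$m'=\mu G+r^2p_{\theta,k},\qquad \frac{S'}{S}=\frac{2G}{r},$$ where $$\mu=k-\frac{2m}{r}-\frac{\Lambda r^2}{3},\qquad G=\sum_{j=1}^{N-1}\omega_j'^2,\qquad W_{k,j}=k-\omega_j^2+\tfrac12(\omega_{j-1}^2+\omega_{j+1}^2),$$ $$p_{\theta,k}=\frac{1}{4r^4}\sum_{j=1}^{N}\big(\omega_j^2-\omega_{j-1}^2-k(N+1-2j)\big)^2 .$$ (They are the equations of static, purely magnetic $\mathfrak{su}(N)$ EYM theory with metric $ds^2=-\mu S^2dt^2+\mu^{-1}dr^2+r^2d\theta^2+r^2f_k^2(\theta)d\phi^2$,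 where $f_0(\theta)=\theta$ and $f_{-1}(\theta)=\sinh\theta$.) The functions $\omega_j$ are called the gauge field functions. A black hole solution with event horizon radius $r_h>0$ is a solution regular on $[r_h,\infty)$ such that: (i) $\mu(r_h)=0$, i.e. $2m(r_h)=kr_h-\Lambda r_h^3/3$, with $\mu'(r_h)>0$ (non-extremal horizon), and $m,S,\omega_j$ have regular Taylor expansions about $r_h$; (ii) $\mu(r)>0$ for all $r>r_h$; (iii) as $r\to\infty$, $m(r)=M+O(r^{-1})$, $S(r)=1+O(r^{-1})$, $\omega_j(r)=\omega_{j,\infty}+O(r^{-1})$ for some real constants $M,\omega_{j,\infty}$. Non-trivial: for $N=2$, a solution is non-trivial if its single gauge field function is not identically zero. For $N\ge3$, a solution is non-trivial if its gauge field functions are not all constant (for $k\in\{-1,0\}$ the constant solutions are those with $\omega_j\equiv0$ for all $j$) and it is not an embedded $\mathfrak{su}(2)$ solution, i.e. there is no function $\omega(r)$ with $\omega_j(r)=\sqrt{j(N-j)}\,\omega(r)$ for all $j=1,\dots,N-1$, up to the symmetries $\omega_j\mapsto-\omega_j$ (separately for each $j$). A solution is nodeless if none of the gauge field functions $\omega_j$ has a zero on $[r_h,\infty)$. *)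

theory Defs
  imports "HOL-Analysis.Analysis" "HOL-Library.Landau_Symbols"
begin

section \<open>The field equations\<close>

text \<open>Gauge fields are families \<open>\<omega> :: nat \<Rightarrow> real \<Rightarrow> real\<close> of which only the members
  \<open>0, \<dots>, N\<close> matter; the boundary convention \<open>\<omega>\<^sub>0 = \<omega>\<^sub>N = 0\<close> is part of the field equations.\<close>

definition eym_mu :: "real \<Rightarrow> real \<Rightarrow> (real \<Rightarrow> real) \<Rightarrow> real \<Rightarrow> real" where
  "eym_mu k \<Lambda> m r = k - 2 * m r / r - \<Lambda> * r\<^sup>2 / 3"

definition eym_G :: "nat \<Rightarrow> (nat \<Rightarrow> real \<Rightarrow> real) \<Rightarrow> real \<Rightarrow> real" where
  "eym_G N \<omega>' r = (\<Sum>j = 1..N - 1. (\<omega>' j r)\<^sup>2)"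

definition eym_W :: "real \<Rightarrow> (nat \<Rightarrow> real \<Rightarrow> real) \<Rightarrow> nat \<Rightarrow> real \<Rightarrow> real" where
  "eym_W k \<omega> j r = k - (\<omega> j r)\<^sup>2 + ((\<omega> (j - 1) r)\<^sup>2 + (\<omega> (j + 1) r)\<^sup>2) / 2"

definition eym_p :: "real \<Rightarrow> nat \<Rightarrow> (nat \<Rightarrow> real \<Rightarrow> real) \<Rightarrow> real \<Rightarrow> real" where
  "eym_p k N \<omega> r =
     1 / (4 * r ^ 4) *
     (\<Sum>j = 1..N. ((\<omega> j r)\<^sup>2 - (\<omega> (j - 1) r)\<^sup>2 - k * (real N + 1 - 2 * real j))\<^sup>2)"

text \<open>Derivatives are taken relative to the interval \<open>A\<close> on which the solution lives, hence are
  one-sided at an end point of \<open>A\<close>.\<close>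

definition eym_solution_on ::
    "real \<Rightarrow> nat \<Rightarrow> real \<Rightarrow> real set \<Rightarrow> (real \<Rightarrow> real) \<Rightarrow> (real \<Rightarrow> real) \<Rightarrow> (nat \<Rightarrow> real \<Rightarrow> real) \<Rightarrow> bool"
  where
  "eym_solution_on k N \<Lambda> A m S \<omega> \<longleftrightarrow>
     (\<exists>m' S' \<omega>' \<omega>''. \<forall>r\<in>A.
        (m has_real_derivative m' r) (at r within A) \<and>
        (S has_real_derivative S' r) (at r within A) \<and>
        (\<forall>j\<in>{1..N - 1}.
           (\<omega> j has_real_derivative \<omega>' j r) (at r within A) \<and>
           (\<omega>' j has_real_derivative \<omega>'' j r) (at r within A)) \<and>
        \<omega> 0 r = 0 \<and> \<omega> N r = 0 \<and> S r > 0 \<and>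
        (\<forall>j\<in>{1..N - 1}.
           r\<^sup>2 * eym_mu k \<Lambda> m r * \<omega>'' j r
           + (2 * m r - 2 * r ^ 3 * eym_p k N \<omega> r - 2 * \<Lambda> * r ^ 3 / 3) * \<omega>' j r
           + eym_W k \<omega> j r * \<omega> j r = 0) \<and>
        m' r = eym_mu k \<Lambda> m r * eym_G N \<omega>' r + r\<^sup>2 * eym_p k N \<omega> r \<and>
        S' r / S r = 2 * eym_G N \<omega>' r / r)"

section \<open>Black hole solutions\<close>

text \<open>A Taylor expansion about \<open>a\<close> that represents \<open>f\<close> to the right of \<open>a\<close>; a power series
  converging on \<open>[a, a + e)\<close> automatically converges for all \<open>\<bar>r - a\<bar> < e\<close>.\<close>

definition taylor_expansion_at_right :: "(real \<Rightarrow> real) \<Rightarrow> real \<Rightarrow> bool" where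
  "taylor_expansion_at_right f a \<longleftrightarrow>
     (\<exists>e>0. \<exists>c :: nat \<Rightarrow> real. \<forall>r\<in>{a..<a + e}. (\<lambda>n. c n * (r - a) ^ n) sums f r)"

definition eym_black_hole ::
    "real \<Rightarrow> nat \<Rightarrow> real \<Rightarrow> real \<Rightarrow> (real \<Rightarrow> real) \<Rightarrow> (real \<Rightarrow> real) \<Rightarrow> (nat \<Rightarrow> real \<Rightarrow> real) \<Rightarrow> bool"
  where
  "eym_black_hole k N \<Lambda> r\<^sub>h m S \<omega> \<longleftrightarrow>
     r\<^sub>h > 0 \<and>
     eym_solution_on k N \<Lambda> {r\<^sub>h..} m S \<omega> \<and>
     eym_mu k \<Lambda> m r\<^sub>h = 0 \<and>
     (\<exists>d>0. (eym_mu k \<Lambda> m has_real_derivative d) (at r\<^sub>h within {r\<^sub>h..})) \<and>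
     taylor_expansion_at_right m r\<^sub>h \<and>
     taylor_expansion_at_right S r\<^sub>h \<and>
     (\<forall>j\<in>{1..N - 1}. taylor_expansion_at_right (\<omega> j) r\<^sub>h) \<and>
     (\<forall>r>r\<^sub>h. eym_mu k \<Lambda> m r > 0) \<and>
     (\<exists>M. (\<lambda>r. m r - M) \<in> O[at_top](\<lambda>r. 1 / r)) \<and>
     (\<lambda>r. S r - 1) \<in> O[at_top](\<lambda>r. 1 / r) \<and>
     (\<forall>j\<in>{1..N - 1}. \<exists>w. (\<lambda>r. \<omega> j r - w) \<in> O[at_top](\<lambda>r. 1 / r))"

definition embedded_su2 :: "nat \<Rightarrow> real \<Rightarrow> (nat \<Rightarrow> real \<Rightarrow> real) \<Rightarrow> bool" where
  "embedded_su2 N r\<^sub>h \<omega> \<longleftrightarrow>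
     (\<exists>(w :: real \<Rightarrow> real) (\<sigma> :: nat \<Rightarrow> real).
        (\<forall>j\<in>{1..N - 1}. \<sigma> j \<in> {-1, 1}) \<and>
        (\<forall>j\<in>{1..N - 1}. \<forall>r\<ge>r\<^sub>h. \<omega> j r = \<sigma> j * sqrt (real j * (real N - real j)) * w r))"

definition nontrivial_gauge_field :: "nat \<Rightarrow> real \<Rightarrow> (nat \<Rightarrow> real \<Rightarrow> real) \<Rightarrow> bool" where
  "nontrivial_gauge_field N r\<^sub>h \<omega> \<longleftrightarrow>
     (if N = 2 then \<not> (\<forall>r\<ge>r\<^sub>h. \<omega> 1 r = 0)
      else \<not> (\<forall>j\<in>{1..N - 1}. \<exists>c. \<forall>r\<ge>r\<^sub>h. \<omega> j r = c) \<and> \<not> embedded_su2 N r\<^sub>h \<omega>)"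

definition nodeless :: "nat \<Rightarrow> real \<Rightarrow> (nat \<Rightarrow> real \<Rightarrow> real) \<Rightarrow> bool" where
  "nodeless N r\<^sub>h \<omega> \<longleftrightarrow> (\<forall>j\<in>{1..N - 1}. \<forall>r\<ge>r\<^sub>h. \<omega> j r \<noteq> 0)"

section \<open>Dependence on the horizon parameters\<close>

text \<open>The horizon parameters are collected in one vector \<open>p\<close> with coordinates \<open>0, \<dots>, N\<close>:
  \<open>p 0 = r\<^sub>h\<close>, \<open>p j = \<omega>\<^sub>j(r\<^sub>h)\<close> for \<open>1 \<le> j \<le> N - 1\<close>, and \<open>p N = m(r\<^sub>h)\<close>.
  The horizon condition \<open>\<mu>(r\<^sub>h) = 0\<close> confines them to a hypersurface.\<close>

definition horizon_parameters :: "real \<Rightarrow> nat \<Rightarrow> real \<Rightarrow> (nat \<Rightarrow> real) set" where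
  "horizon_parameters k N \<Lambda> =
     {p \<in> {0..N} \<rightarrow>\<^sub>E UNIV. p 0 > 0 \<and> 2 * p N = k * p 0 - \<Lambda> * p 0 ^ 3 / 3}"

text \<open>Real analyticity in the variables indexed by the finite set \<open>I\<close>, for a function on an
  arbitrary (not necessarily open) set \<open>D\<close>: near each point of \<open>D\<close> the function is the
  restriction to \<open>D\<close> of a power series, indexed by the multi-indices \<open>I \<rightarrow> nat\<close>, that
  converges on a full neighbourhood of the point.\<close>

definition real_analytic_on :: "'i set \<Rightarrow> ('i \<Rightarrow> real) set \<Rightarrow> (('i \<Rightarrow> real) \<Rightarrow> real) \<Rightarrow> bool" where
  "real_analytic_on I D f \<longleftrightarrow>
     (\<forall>p\<in>D. \<exists>e>0. \<exists>a :: ('i \<Rightarrow> nat) \<Rightarrow> real.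
        \<forall>q\<in>I \<rightarrow>\<^sub>E UNIV. (\<forall>i\<in>I. \<bar>q i - p i\<bar> < e) \<longrightarrow>
          (\<lambda>\<alpha>. a \<alpha> * (\<Prod>i\<in>I. (q i - p i) ^ \<alpha> i)) summable_on (I \<rightarrow>\<^sub>E UNIV) \<and>
          (q \<in> D \<longrightarrow>
            f q = (\<Sum>\<^sub>\<infinity>\<alpha>\<in>I \<rightarrow>\<^sub>E UNIV. a \<alpha> * (\<Prod>i\<in>I. (q i - p i) ^ \<alpha> i))))"

end

theory Submission imports Defs "HOL-Library.Function_Algebras" begin

text \<open>In the variable \<open>t = 1 - r\<^sub>h / r\<close> the exterior region \<open>[r\<^sub>h, \<infinity>)\<close> becomes \<open>[0, 1)\<close>, and after scaling
  by \<open>r\<^sub>h\<close> the field equations become polynomial in the unknowns, in \<open>\<kappa> = k / r\<^sub>h\<^sup>2\<close> and in the horizon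
  values \<open>a\<^sub>j = \<omega>\<^sub>j(r\<^sub>h) / r\<^sub>h\<close>. The only singular point in \<open>[0, 1]\<close> is the horizon \<open>t = 0\<close>, where
  \<open>\<mu> = r\<^sup>2 t H\<close>. For \<open>\<kappa> = a = 0\<close> one has \<open>H = l (3 - 3 t + t\<^sup>2)\<close> with \<open>l = - \<Lambda> / 3\<close>, whose zeros have
  modulus \<open>sqrt 3 > 1\<close>. Hence, for large \<open>r\<^sub>h\<close> and small \<open>a\<^sub>j\<close>, the solution is one power series in \<open>t\<close>
  with absolutely summable coefficients, and the fields \<open>\<omega>\<^sub>j / r\<^sub>h\<close> stay close to \<open>a\<^sub>j\<close>. It is the fixed
  point of a contraction built from products and from \<open>f \<mapsto> (1 / t) \<integral>\<^sub>0\<^sup>t f\<close>, which makes sense in every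
  commutative Banach algebra. Solving it in an algebra of series in \<open>t\<close> and in the displacement of the
  horizon parameters, and evaluating by algebra homomorphisms, gives the analytic dependence on the
  parameters; substituting for \<open>t\<close> its expansion in \<open>r - r\<^sub>h\<close> gives the Taylor series at the horizon.\<close>

text \<open>With \<open>w = u'\<close> the gauge equation takes the form (t H w)' = - F. Regularity
  at the horizon forces the constant of integration to be 0, so w = - (1 / H) av F: the singular
  factor \<open>t\<close> is absorbed by the averaging operator, which has norm at most 1. Division
  by \<open>H\<close> is the only other operation that is not polynomial; making 1 / H an unknown
  removes it, so the fixed point map commutes with every homomorphism that respects the data.
  Absolute summability of the coefficients, rather than convergence in the open disc, is what
  reaches the end point t = 1, that is, r = infinity. The scales are matched: for \<open>a_j\<close>
  of order \<delta> and \<kappa> of order \<delta>^2 (that is, r_h > 1 / \<delta>), the correction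
  to \<open>H\<close> and the source F are of order \<delta>^2, with Lipschitz constants of order
  \<delta>. So for every fixed \<open>l\<close> the map contracts once \<delta> is small. The window
  \<delta> < \<open>a_j\<close> < 2 \<delta> with |w| at most \<delta> keeps the fields positive for
  t < 1, and for N at least 3 the open condition a_1 > a_2 excludes constant and embedded
  solutions.\<close>

no_notation Infinite_Set_Sum.abs_summable_on (infix \<open>abs'_summable'_on\<close> 50)

section \<open>Absolutely summable families as a Banach algebra\<close>

text \<open>The index type is left arbitrary so that one construction yields series in
  \<open>t\<close> (index \<open>nat\<close>), series in the parameters (multi-indices) and series
  in both (pairs).\<close>

typedef 'i l1 = "{f :: 'i \<Rightarrow> real. f abs_summable_on UNIV}"
  morphisms coef Abs_l1
  by (rule exI[of _ "\<lambda>_. 0"]) simp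

setup_lifting type_definition_l1

lemma coef_summable: "coef f abs_summable_on UNIV"
  using coef[of f] by simp

lemma l1_eqI: "(\<And>i. coef f i = coef g i) \<Longrightarrow> f = g"
  by (simp add: coef_inject[symmetric] fun_eq_iff)

instantiation l1 :: (type) real_vector
begin

lift_definition zero_l1 :: "'a l1" is "\<lambda>_. 0" by simp

lift_definition plus_l1 :: "'a l1 \<Rightarrow> 'a l1 \<Rightarrow> 'a l1" is "\<lambda>f g i. f i + g i"
proof -
  fix f g :: "'a \<Rightarrow> real"
  assume "f abs_summable_on UNIV" "g abs_summable_on UNIV"
  hence "(\<lambda>i. norm (f i) + norm (g i)) summable_on UNIV" by (rule summable_on_add)
  hence "(\<lambda>i. norm (f i) + norm (g i)) abs_summable_on UNIV" by simp
  thus "(\<lambda>i. f i + g i) abs_summable_on UNIV"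
    by (rule Infinite_Sum.abs_summable_on_comparison_test) (simp add: abs_triangle_ineq)
qed

lift_definition uminus_l1 :: "'a l1 \<Rightarrow> 'a l1" is "\<lambda>f i. - f i" by simp

lift_definition minus_l1 :: "'a l1 \<Rightarrow> 'a l1 \<Rightarrow> 'a l1" is "\<lambda>f g i. f i - g i"
proof -
  fix f g :: "'a \<Rightarrow> real"
  assume "f abs_summable_on UNIV" "g abs_summable_on UNIV"
  hence "(\<lambda>i. norm (f i) + norm (g i)) summable_on UNIV" by (rule summable_on_add)
  hence "(\<lambda>i. norm (f i) + norm (g i)) abs_summable_on UNIV" by simp
  thus "(\<lambda>i. f i - g i) abs_summable_on UNIV"
    by (rule Infinite_Sum.abs_summable_on_comparison_test) (simp add: abs_triangle_ineq4)
qed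

lift_definition scaleR_l1 :: "real \<Rightarrow> 'a l1 \<Rightarrow> 'a l1" is "\<lambda>c f i. c * f i"
  by (simp add: abs_mult summable_on_cmult_right)

instance
proof
  fix f g h :: "'a l1" and c d :: real
  note cs = zero_l1.rep_eq plus_l1.rep_eq uminus_l1.rep_eq minus_l1.rep_eq scaleR_l1.rep_eq
  show "f + g + h = f + (g + h)" "f + g = g + f" "0 + f = f" "- f + f = 0" "f - g = f + - g"
    "c *\<^sub>R (f + g) = c *\<^sub>R f + c *\<^sub>R g" "(c + d) *\<^sub>R f = c *\<^sub>R f + d *\<^sub>R f"
    "c *\<^sub>R d *\<^sub>R f = (c * d) *\<^sub>R f" "1 *\<^sub>R f = f"
    by (auto intro!: l1_eqI simp: cs algebra_simps)
qed

end

lemmas coef_simps =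
  zero_l1.rep_eq plus_l1.rep_eq uminus_l1.rep_eq minus_l1.rep_eq scaleR_l1.rep_eq

instantiation l1 :: (type) real_normed_vector
begin

definition norm_l1 :: "'a l1 \<Rightarrow> real" where
  "norm_l1 f = (\<Sum>\<^sub>\<infinity>i. norm (coef f i))"

definition dist_l1 :: "'a l1 \<Rightarrow> 'a l1 \<Rightarrow> real" where
  "dist_l1 f g = norm (f - g)"

definition uniformity_l1 :: "('a l1 \<times> 'a l1) filter" where
  "uniformity_l1 = (INF e\<in>{0<..}. principal {(f, g). dist f g < e})"

definition open_l1 :: "'a l1 set \<Rightarrow> bool" where
  "open_l1 U = (\<forall>f\<in>U. eventually (\<lambda>(f', g). f' = f \<longrightarrow> g \<in> U) uniformity)"

definition sgn_l1 :: "'a l1 \<Rightarrow> 'a l1" where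
  "sgn_l1 f = f /\<^sub>R norm f"

instance
proof
  fix f g :: "'a l1" and c :: real
  note cs = coef_simps
  show "norm f = 0 \<longleftrightarrow> f = 0"
  proof
    assume *: "norm f = 0"
    have "norm (coef f i) = 0" for i
      by (rule nonneg_infsum_le_0D[where A = UNIV and f = "\<lambda>i. norm (coef f i)"])
         (use * coef_summable[of f] in \<open>auto simp: norm_l1_def\<close>)
    thus "f = 0" by (intro l1_eqI) (simp add: cs)
  qed (simp add: norm_l1_def cs)
  show "norm (f + g) \<le> norm f + norm g"
  proof -
    have "norm (f + g) \<le> (\<Sum>\<^sub>\<infinity>i. norm (coef f i) + norm (coef g i))"
      unfolding norm_l1_def
    proof (rule infsum_mono)
      show "(\<lambda>i. norm (coef f i) + norm (coef g i)) summable_on UNIV"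
        by (intro summable_on_add coef_summable)
    qed (use coef_summable[of "f + g"] in \<open>auto simp: cs abs_triangle_ineq\<close>)
    also have "\<dots> = norm f + norm g"
      unfolding norm_l1_def by (intro infsum_add coef_summable)
    finally show ?thesis .
  qed
  show "norm (c *\<^sub>R f) = \<bar>c\<bar> * norm f"
    unfolding norm_l1_def cs by (simp add: abs_mult infsum_cmult_right')
qed (rule dist_l1_def sgn_l1_def uniformity_l1_def open_l1_def)+

end

lemma sum_coef_le_norm: "finite F \<Longrightarrow> (\<Sum>i\<in>F. \<bar>coef f i\<bar>) \<le> norm f"
  unfolding norm_l1_def
  using finite_sum_le_infsum[OF coef_summable[of f], of F] by simp

lemma bounded_linear_coef: "bounded_linear (\<lambda>f. coef f i)"
  by (rule bounded_linear_intro[where K = 1])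
     (use sum_coef_le_norm[of "{i}"] in \<open>auto simp: coef_simps\<close>)

instance l1 :: (type) banach
proof
  fix X :: "nat \<Rightarrow> 'a l1"
  assume X: "Cauchy X"
  define c where "c i = lim (\<lambda>n. coef (X n) i)" for i
  have c: "(\<lambda>n. coef (X n) i) \<longlonglongrightarrow> c i" for i
    unfolding c_def
    using bounded_linear.Cauchy[OF bounded_linear_coef X] Cauchy_convergent_iff convergent_LIMSEQ_iff
    by blast
  \<comment> \<open>The bound is uniform over all finite index sets, which upgrades coefficientwise
    convergence to convergence in norm.\<close>
  have bound: "\<exists>n0. \<forall>n\<ge>n0. \<forall>F. finite F \<longrightarrow> (\<Sum>i\<in>F. \<bar>coef (X n) i - c i\<bar>) \<le> e" if "e > 0" for e
  proof -
    obtain n0 where n0: "\<And>m n. m \<ge> n0 \<Longrightarrow> n \<ge> n0 \<Longrightarrow> norm (X m - X n) < e"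
      using X \<open>e > 0\<close> unfolding Cauchy_iff by meson
    have "(\<Sum>i\<in>F. \<bar>coef (X n) i - c i\<bar>) \<le> e" if "n \<ge> n0" "finite F" for n F
    proof (rule tendsto_upperbound)
      show "(\<lambda>m. \<Sum>i\<in>F. \<bar>coef (X n) i - coef (X m) i\<bar>) \<longlonglongrightarrow> (\<Sum>i\<in>F. \<bar>coef (X n) i - c i\<bar>)"
        by (intro tendsto_intros c)
      have "(\<Sum>i\<in>F. \<bar>coef (X n) i - coef (X m) i\<bar>) \<le> e" if "m \<ge> n0" for m
        using sum_coef_le_norm[OF \<open>finite F\<close>, of "X n - X m"] n0[OF \<open>n \<ge> n0\<close> that]
        by (simp add: coef_simps)
      thus "\<forall>\<^sub>F m in sequentially. (\<Sum>i\<in>F. \<bar>coef (X n) i - coef (X m) i\<bar>) \<le> e"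
        by (auto simp: eventually_sequentially)
    qed auto
    thus ?thesis by blast
  qed
  have summ: "(\<lambda>i. coef (X n) i - c i) abs_summable_on UNIV"
    if "\<forall>F. finite F \<longrightarrow> (\<Sum>i\<in>F. \<bar>coef (X n) i - c i\<bar>) \<le> e" for n e
    using that by (intro nonneg_bdd_above_summable_on) (auto intro!: bdd_aboveI)
  obtain n1 where "\<forall>F. finite F \<longrightarrow> (\<Sum>i\<in>F. \<bar>coef (X n1) i - c i\<bar>) \<le> 1"
    using bound[of 1] by auto
  \<comment> \<open>The limit \<open>c\<close> is summable as the difference of the summable
    families \<open>X n1\<close> and \<open>X n1 - c\<close>.\<close>
  from summ[OF this]
  have "(\<lambda>i. coef (X n1 - Abs_l1 (\<lambda>i. coef (X n1) i - c i)) i) abs_summable_on UNIV"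
    using coef_summable by blast
  hence csum: "c abs_summable_on UNIV"
    using summ[OF \<open>\<forall>F. finite F \<longrightarrow> (\<Sum>i\<in>F. \<bar>coef (X n1) i - c i\<bar>) \<le> 1\<close>]
    by (simp add: coef_simps Abs_l1_inverse)
  define L where "L = Abs_l1 c"
  have L: "coef L = c" using csum by (simp add: L_def Abs_l1_inverse)
  have "X \<longlonglongrightarrow> L"
  proof (rule LIMSEQ_I)
    fix e :: real assume "e > 0"
    then obtain n0 where n0: "\<forall>n\<ge>n0. \<forall>F. finite F \<longrightarrow> (\<Sum>i\<in>F. \<bar>coef (X n) i - c i\<bar>) \<le> e / 2"
      using bound[of "e / 2"] by auto
    have "norm (X n - L) \<le> e / 2" if "n \<ge> n0" for n
      unfolding norm_l1_def
      by (rule infsum_le_finite_sums)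
         (use n0 that coef_summable[of "X n - L"] in \<open>auto simp: coef_simps L\<close>)
    thus "\<exists>n0. \<forall>n\<ge>n0. norm (X n - L) < e" using \<open>e > 0\<close> by (intro exI[of _ n0]) fastforce
  qed
  thus "convergent X" by (rule convergentI)
qed

section \<open>Unit vectors and linear extension\<close>

lift_definition basis :: "'i \<Rightarrow> 'i l1" is "\<lambda>i j. if j = i then 1 else 0"
proof -
  fix i :: 'i
  have "(\<lambda>j. if j = i then 1 else 0 :: real) abs_summable_on UNIV
        \<longleftrightarrow> (\<lambda>j. if j = i then 1 else 0 :: real) abs_summable_on {i}"
    by (rule summable_on_cong_neutral) auto
  thus "(\<lambda>j. if j = i then 1 else 0 :: real) abs_summable_on UNIV" by simp
qed

lemma norm_basis [simp]: "norm (basis i) = 1"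
proof -
  have "norm (basis i) = (\<Sum>\<^sub>\<infinity>j\<in>{i}. norm (coef (basis i) j))"
    unfolding norm_l1_def by (rule infsum_cong_neutral) (auto simp: basis.rep_eq)
  thus ?thesis by (simp add: basis.rep_eq)
qed

text \<open>The universal property of the space: a bounded family of vectors extends to a bounded
  operator. Product, averaging, substitution and evaluation are all instances.\<close>

definition lext :: "('i \<Rightarrow> 'b::banach) \<Rightarrow> 'i l1 \<Rightarrow> 'b" where
  "lext F f = (\<Sum>\<^sub>\<infinity>i. coef f i *\<^sub>R F i)"

lemma lext_summable:
  fixes F :: "'i \<Rightarrow> 'b::banach"
  assumes "\<And>i. norm (F i) \<le> K"
  shows "(\<lambda>i. coef f i *\<^sub>R F i) abs_summable_on UNIV"
proof (rule Infinite_Sum.abs_summable_on_comparison_test[where g = "\<lambda>i. K * coef f i"])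
  have "(\<lambda>i. \<bar>K\<bar> * norm (coef f i)) summable_on UNIV"
    by (intro summable_on_cmult_right coef_summable)
  thus "(\<lambda>i. K * coef f i) abs_summable_on UNIV" by (simp add: abs_mult)
  have "K \<ge> 0" using assms norm_ge_zero order_trans by blast
  thus "norm (coef f i *\<^sub>R F i) \<le> norm (K * coef f i)" for i
    using assms[of i] by (simp add: abs_mult mult.commute mult_right_mono)
qed

lemma lext_has_sum:
  assumes "\<And>i. norm (F i) \<le> K"
  shows "((\<lambda>i. coef f i *\<^sub>R F i) has_sum lext F f) UNIV"
  unfolding lext_def
  by (rule has_sum_infsum[OF abs_summable_summable[OF lext_summable[OF assms]]])

lemma norm_lext:
  assumes "\<And>i. norm (F i) \<le> K"
  shows "norm (lext F f) \<le> K * norm f"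
proof -
  have "norm (lext F f) \<le> (\<Sum>\<^sub>\<infinity>i. norm (coef f i *\<^sub>R F i))"
    unfolding lext_def by (rule norm_infsum_bound) (rule lext_summable[OF assms])
  also have "\<dots> \<le> (\<Sum>\<^sub>\<infinity>i. K * norm (coef f i))"
  proof (rule infsum_mono)
    show "(\<lambda>i. K * norm (coef f i)) summable_on UNIV"
      by (intro summable_on_cmult_right coef_summable)
    show "norm (coef f i *\<^sub>R F i) \<le> K * norm (coef f i)" for i
      using mult_right_mono[OF assms[of i], of "\<bar>coef f i\<bar>"] by (simp add: mult.commute)
  qed (rule lext_summable[OF assms])
  also have "\<dots> = K * norm f" by (simp add: norm_l1_def infsum_cmult_right')
  finally show ?thesis .
qed

lemma bounded_linear_lext:
  assumes "\<And>i. norm (F i) \<le> K"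
  shows "bounded_linear (lext F)"
proof (rule bounded_linear_intro)
  fix f g
  show "lext F (f + g) = lext F f + lext F g"
    using has_sum_add[OF lext_has_sum[OF assms, of f] lext_has_sum[OF assms, of g]]
    by (simp add: lext_def infsumI coef_simps algebra_simps)
  show "lext F (c *\<^sub>R f) = c *\<^sub>R lext F f" for c
    by (simp add: lext_def coef_simps infsum_scaleR_right flip: scaleR_scaleR)
  show "norm (lext F f) \<le> norm f * K"
    using norm_lext[OF assms] by (simp add: mult.commute)
qed

lemma basis_expansion: "((\<lambda>i. coef f i *\<^sub>R basis i) has_sum f) UNIV"
proof -
  have 1: "((\<lambda>i. coef f i *\<^sub>R basis i) has_sum lext basis f) UNIV"
    by (rule lext_has_sum[where K = 1]) simp
  have "coef (lext basis f) j = coef f j" for j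
  proof -
    have "((\<lambda>i. coef (coef f i *\<^sub>R basis i) j) has_sum coef (lext basis f) j) UNIV"
      using has_sum_bounded_linear[OF bounded_linear_coef 1] by (simp add: o_def)
    moreover have "((\<lambda>i. coef (coef f i *\<^sub>R basis i) j) has_sum coef f j) UNIV \<longleftrightarrow>
                   ((\<lambda>i. coef f i) has_sum coef f j) {j}"
      by (rule has_sum_cong_neutral) (auto simp: coef_simps basis.rep_eq)
    ultimately show ?thesis using has_sum_unique has_sum_finiteI[of "{j}"] by fastforce
  qed
  with 1 show ?thesis by (metis l1_eqI)
qed

lemma bounded_linear_eq_lext:
  fixes F :: "'i l1 \<Rightarrow> 'b::banach"
  assumes "bounded_linear F"
  shows "F f = lext (\<lambda>i. F (basis i)) f"
  using has_sum_bounded_linear[OF assms basis_expansion[of f]]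
  by (simp add: lext_def infsumI o_def linear_simps[OF assms])

text \<open>Every element is a convergent combination of unit vectors. Identities between operators
  on series thereby reduce to computations with monomials.\<close>

lemma bounded_linear_eqI:
  fixes F G :: "'i l1 \<Rightarrow> 'b::banach"
  assumes "bounded_linear F" "bounded_linear G" "\<And>i. F (basis i) = G (basis i)"
  shows "F f = G f"
  using assms bounded_linear_eq_lext[of F f] bounded_linear_eq_lext[of G f] by simp

lemma lext_basis [simp]: "lext F (basis i) = F i"
proof -
  have "((\<lambda>j. coef (basis i) j *\<^sub>R F j) has_sum F i) UNIV \<longleftrightarrow>
        ((\<lambda>j. coef (basis i) j *\<^sub>R F j) has_sum F i) {i}"
    by (rule has_sum_cong_neutral) (auto simp: basis.rep_eq)
  thus ?thesis unfolding lext_def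
    by (intro infsumI) (auto intro!: has_sum_finiteI simp: basis.rep_eq)
qed

section \<open>The convolution algebra of a commutative monoid\<close>

instantiation l1 :: (comm_monoid_add) "{comm_ring_1, real_normed_algebra_1}"
begin

definition one_l1 :: "'a l1" where "one_l1 = basis 0"

text \<open>Convolution, as the bilinear extension of addition of indices. This form avoids a
  formula for the coefficients, which over a general monoid would be sums over possibly infinitely
  many decompositions of an index.\<close>

definition times_l1 :: "'a l1 \<Rightarrow> 'a l1 \<Rightarrow> 'a l1" where
  "times_l1 f g = lext (\<lambda>i. lext (\<lambda>j. basis (i + j)) g) f"

instance
proof
  have shift: "norm (lext (\<lambda>j. basis (i + j)) g) \<le> norm g" for i :: 'a and g
    using norm_lext[of "\<lambda>j. basis (i + j)" 1 g] by simp
  have blf: "bounded_linear (\<lambda>f. f * g)" for g :: "'a l1"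
    unfolding times_l1_def by (rule bounded_linear_lext[OF shift])
  have bb: "basis i * basis j = basis (i + j)" for i j :: 'a
    by (simp add: times_l1_def)
  have comm: "f * g = g * f" for f g :: "'a l1"
  proof -
    have lin: "bounded_linear (\<lambda>g. basis i * g)" for i :: 'a
      unfolding times_l1_def lext_basis by (rule bounded_linear_lext[where K = 1]) simp
    have "basis i * g = g * basis i" for i :: 'a and g
      by (rule bounded_linear_eqI[OF lin blf]) (simp add: bb add.commute)
    note * = this
    have nm: "norm (f * g) \<le> norm g * norm f" for f g :: "'a l1"
      unfolding times_l1_def by (rule norm_lext[OF shift])
    have lin2: "bounded_linear (\<lambda>g. f * g)" for f :: "'a l1"
    proof (rule bounded_linear_intro)
      have lx: "bounded_linear (lext (\<lambda>j. basis (i + j)))" for i :: 'a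
        by (rule bounded_linear_lext[where K = 1]) simp
      fix g h :: "'a l1" and c
      show "f * (g + h) = f * g + f * h"
        unfolding times_l1_def linear_simps[OF lx]
        using has_sum_add[OF lext_has_sum[OF shift[of _ g], of f] lext_has_sum[OF shift[of _ h], of f]]
        by (simp add: lext_def[of _ f] infsumI scaleR_add_right)
      show "f * (c *\<^sub>R g) = c *\<^sub>R (f * g)"
        unfolding times_l1_def linear_simps[OF lx] lext_def[of _ f]
        by (subst infsum_scaleR_right[symmetric]) (simp add: mult.commute)
      show "norm (f * g) \<le> norm g * norm f" by (rule nm)
    qed
    show ?thesis
      by (rule bounded_linear_eqI[where F = "\<lambda>f. f * g" and G = "\<lambda>f. g * f", OF blf lin2]) (rule *)
  qed
  have blg: "bounded_linear (\<lambda>g. f * g)" for f :: "'a l1"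
    using blf[of f] by (simp add: comm)
  fix f g h :: "'a l1" and c :: real
  show "f * g = g * f" by (rule comm)
  show "(f + g) * h = f * h + g * h" by (rule linear_simps(1)[OF blf])
  show "c *\<^sub>R f * g = c *\<^sub>R (f * g)" by (rule linear_simps(5)[OF blf])
  show "f * (g + h) = f * g + f * h" by (rule linear_simps(1)[OF blg])
  show "f * c *\<^sub>R g = c *\<^sub>R (f * g)" by (rule linear_simps(5)[OF blg])
  \<comment> \<open>Associativity is extended from monomials one factor at a time: first
    \<open>h\<close>, then \<open>g\<close>, then \<open>f\<close>.\<close>
  have "basis i * basis j * h = basis i * (basis j * h)" for i j
    by (rule bounded_linear_eqI[OF blg bounded_linear_compose[OF blg blg]]) (simp add: bb add.assoc)
  hence "basis i * g * h = basis i * (g * h)" for i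
    by (rule bounded_linear_eqI[where F = "\<lambda>g. basis i * g * h" and G = "\<lambda>g. basis i * (g * h)",
          OF bounded_linear_compose[OF blf blg] bounded_linear_compose[OF blg blf]])
  thus "f * g * h = f * (g * h)"
    by (rule bounded_linear_eqI[where F = "\<lambda>f. f * g * h" and G = "\<lambda>f. f * (g * h)",
          OF bounded_linear_compose[OF blf blf] blf])
  show "1 * f = f" 
    by (rule bounded_linear_eqI[OF blg bounded_linear_ident]) (simp add: one_l1_def bb)
  thus "f * 1 = f" by (simp add: comm)
  show "norm (f * g) \<le> norm f * norm g"
    using norm_lext[OF shift[of _ g], where f = f] by (simp add: times_l1_def mult.commute)
  show "norm (1 :: 'a l1) = 1" by (simp add: one_l1_def)
  thus "0 \<noteq> (1 :: 'a l1)" by (metis norm_zero zero_neq_one)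
qed

end

lemma basis_mult: "basis i * basis j = basis (i + j)"
  by (simp add: times_l1_def)

lemma basis_0: "basis 0 = 1"
  by (simp add: one_l1_def)

section \<open>Algebra homomorphisms\<close>

text \<open>The condition \<open>contractive\<close> keeps the unit ball inside the unit ball, so an
  element that may be substituted for a variable remains admissible after a homomorphism is
  applied.\<close>

locale banach_hom = bounded_linear \<phi> for \<phi> :: "'a::real_normed_algebra_1 \<Rightarrow> 'b::real_normed_algebra_1" +
  assumes mult: "\<phi> (x * y) = \<phi> x * \<phi> y"
    and one: "\<phi> 1 = 1"
    and contractive: "norm (\<phi> x) \<le> norm x"
begin

lemma power: "\<phi> (x ^ n) = \<phi> x ^ n"
  by (induction n) (simp_all add: mult one)

lemma of_real: "\<phi> (of_real c) = of_real c"
  by (simp add: of_real_def scaleR one)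

end

lemma banach_hom_exp:
  fixes \<phi> :: "'a::{real_normed_algebra_1,banach} \<Rightarrow> 'b::{real_normed_algebra_1,banach}"
  assumes "banach_hom \<phi>"
  shows "\<phi> (exp x) = exp (\<phi> x)"
proof -
  interpret banach_hom \<phi> by fact
  have "(\<lambda>n. \<phi> (x ^ n /\<^sub>R fact n)) sums \<phi> (exp x)"
    by (intro sums) (rule exp_converges)
  thus ?thesis by (simp add: scaleR power exp_def sums_iff)
qed

text \<open>Multiplicativity on indices becomes multiplicativity on the algebra by density in each
  factor. Thus a homomorphism is specified by the images of the monomials alone.\<close>

lemma banach_hom_lext:
  fixes E :: "'i::comm_monoid_add \<Rightarrow> 'b::{real_normed_algebra_1,banach}"
  assumes E_add: "\<And>i j. E (i + j) = E i * E j" and E_zero: "E 0 = 1" and le: "\<And>i. norm (E i) \<le> 1"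
  shows "banach_hom (lext E)"
proof -
  interpret bounded_linear "lext E" by (rule bounded_linear_lext[OF le])
  have L: "bounded_linear (lext E)" ..
  show ?thesis
  proof
    fix f g
    have "lext E (basis i * g) = lext E (basis i) * lext E g" for i
      by (rule bounded_linear_eqI[where F = "\<lambda>g. lext E (basis i * g)" and G = "\<lambda>g. lext E (basis i) * lext E g",
            OF bounded_linear_compose[OF L bounded_linear_mult_right]
            bounded_linear_compose[OF bounded_linear_mult_right L]]) (simp add: basis_mult E_add)
    thus "lext E (f * g) = lext E f * lext E g"
      by (rule bounded_linear_eqI[where F = "\<lambda>f. lext E (f * g)" and G = "\<lambda>f. lext E f * lext E g",
            OF bounded_linear_compose[OF L bounded_linear_mult_left]
            bounded_linear_compose[OF bounded_linear_mult_left L]])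
    show "lext E 1 = 1" by (simp add: one_l1_def E_zero)
    show "norm (lext E f) \<le> norm f" using norm_lext[OF le, where f = f] by simp
  qed
qed

lemma neumann_inverse:
  fixes x :: "'a::{real_normed_algebra_1,banach}"
  assumes "norm x < 1"
  obtains v where "(1 - x) * v = 1" "norm v \<le> 1 / (1 - norm x)"
proof
  have sn: "summable (\<lambda>n. norm x ^ n)" using assms by (simp add: summable_geometric)
  have sm: "summable (\<lambda>n. norm (x ^ n))"
    by (rule summable_comparison_test'[OF sn]) (simp add: norm_power_ineq)
  have s: "summable (\<lambda>n. x ^ n)" by (rule summable_norm_cancel[OF sm])
  have "(1 - x) * suminf (\<lambda>n. x ^ n) = suminf (\<lambda>n. (1 - x) * x ^ n)"
    by (rule suminf_mult[OF s, symmetric])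
  also have "(\<lambda>n. (1 - x) * x ^ n) sums (x ^ 0 - 0)"
    using telescope_sums'[OF summable_LIMSEQ_zero[OF s]] by (simp add: algebra_simps)
  hence "suminf (\<lambda>n. (1 - x) * x ^ n) = 1" by (simp add: sums_iff)
  finally show "(1 - x) * suminf (\<lambda>n. x ^ n) = 1" .
  have "norm (suminf (\<lambda>n. x ^ n)) \<le> suminf (\<lambda>n. norm (x ^ n))" by (rule summable_norm[OF sm])
  also have "\<dots> \<le> suminf (\<lambda>n. norm x ^ n)" by (rule suminf_le[OF norm_power_ineq sm sn])
  also have "\<dots> = 1 / (1 - norm x)" using assms by (simp add: suminf_geometric)
  finally show "norm (suminf (\<lambda>n. x ^ n)) \<le> 1 / (1 - norm x)" .
qed

section \<open>A contraction for the boundary value problem\<close>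

text \<open>Banach's theorem for the sup distance over coordinates. The function type carries the
  topology of pointwise convergence, so the distance enters only through bounds \<open>e\<close>
  valid for all \<open>i\<close>. The convergence of the iterates is part of the conclusion because
  the solution is later transported along homomorphisms as a limit.\<close>

lemma coordinatewise_fixed_point:
  fixes T :: "('i \<Rightarrow> 'b::banach) \<Rightarrow> 'i \<Rightarrow> 'b"
  assumes X0: "X0 \<in> B" and maps: "\<And>X. X \<in> B \<Longrightarrow> T X \<in> B"
    and closed: "\<And>X Y. (\<And>n. X n \<in> B) \<Longrightarrow> (\<And>i. (\<lambda>n. X n i) \<longlonglongrightarrow> Y i) \<Longrightarrow> Y \<in> B"
    and lip: "\<And>X Y e i. X \<in> B \<Longrightarrow> Y \<in> B \<Longrightarrow> (\<And>i. norm (X i - Y i) \<le> e) \<Longrightarrow>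
                norm (T X i - T Y i) \<le> e / 2"
    and start: "\<And>i. norm (T X0 i - X0 i) \<le> e0"
  obtains X where "X \<in> B" "T X = X" "\<And>i. (\<lambda>n. (T ^^ n) X0 i) \<longlonglongrightarrow> X i"
proof -
  define S where "S n = (T ^^ n) X0" for n
  have S: "S 0 = X0" "S (Suc n) = T (S n)" for n by (simp_all add: S_def)
  have SB: "S n \<in> B" for n by (induction n) (simp_all add: S X0 maps)
  have step: "norm (S (Suc n) i - S n i) \<le> e0 / 2 ^ n" for n i
  proof (induction n arbitrary: i)
    case (Suc n)
    thus ?case using lip[OF SB SB, of "Suc n" n "e0 / 2 ^ n" i] by (simp add: S)
  qed (use start in \<open>simp add: S\<close>)
  \<comment> \<open>Keeping the subtracted term of the geometric sum lets the induction on
    \<open>k\<close> close exactly; it is dropped in \<open>tail\<close>.\<close>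
  have far: "norm (S (n + k) i - S n i) \<le> 2 * e0 / 2 ^ n - 2 * e0 / 2 ^ (n + k)" for n k i
  proof (induction k)
    case (Suc k)
    have "norm (S (n + Suc k) i - S n i) \<le>
          norm (S (Suc (n + k)) i - S (n + k) i) + norm (S (n + k) i - S n i)"
      using norm_triangle_ineq[of "S (Suc (n + k)) i - S (n + k) i" "S (n + k) i - S n i"] by simp
    also have "\<dots> \<le> e0 / 2 ^ (n + k) + (2 * e0 / 2 ^ n - 2 * e0 / 2 ^ (n + k))"
      by (intro add_mono step Suc.IH)
    finally show ?case by (simp add: field_simps)
  qed simp
  have e0: "e0 \<ge> 0" by (rule order_trans[OF norm_ge_zero start])
  have tail: "norm (S (n + k) i - S n i) \<le> 2 * e0 / 2 ^ n" for n k i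
    proof -
    have "0 \<le> 2 * e0 / 2 ^ (n + k)" using e0 by simp
    thus ?thesis using far[of n k i] by linarith
  qed
  have lim0: "(\<lambda>n. 2 * e0 / 2 ^ n) \<longlonglongrightarrow> 0"
    by (rule LIMSEQ_divide_realpow_zero) simp
  have "Cauchy (\<lambda>n. S n i)" for i
  proof (rule CauchyI')
    fix e :: real assume "e > 0"
    then obtain M where M: "\<And>n. n \<ge> M \<Longrightarrow> 2 * e0 / 2 ^ n < e"
      using order_tendstoD(2)[OF lim0, of e] by (auto simp: eventually_sequentially)
    have "dist (S m i) (S n i) < e" if "m \<ge> M" "n > m" for m n
      using tail[where n = m and k = "n - m" and i = i] M[OF that(1)] that by (simp add: dist_norm norm_minus_commute)
    thus "\<exists>M. \<forall>m\<ge>M. \<forall>n>m. dist (S m i) (S n i) < e" by blast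
  qed
  hence conv: "convergent (\<lambda>n. S n i)" for i by (simp add: Cauchy_convergent_iff)
  define X where "X i = lim (\<lambda>n. S n i)" for i
  have X: "(\<lambda>n. S n i) \<longlonglongrightarrow> X i" for i
    using conv[of i] by (simp add: X_def convergent_LIMSEQ_iff)
  have XB: "X \<in> B" by (rule closed[OF SB X])
  have rate: "norm (S n i - X i) \<le> 2 * e0 / 2 ^ n" for n i
  proof (rule tendsto_upperbound)
    show "(\<lambda>k. norm (S n i - S (k + n) i)) \<longlonglongrightarrow> norm (S n i - X i)"
      by (intro tendsto_intros LIMSEQ_ignore_initial_segment X)
    show "\<forall>\<^sub>F k in sequentially. norm (S n i - S (k + n) i) \<le> 2 * e0 / 2 ^ n"
      using tail[where n = n and i = i] by (simp add: add.commute norm_minus_commute)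
  qed auto
  have "T X i = X i" for i
  proof -
    have "(\<lambda>n. S (Suc n) i - T X i) \<longlonglongrightarrow> 0"
    proof (rule Lim_null_comparison)
      show "\<forall>\<^sub>F n in sequentially. norm (S (Suc n) i - T X i) \<le> 2 * e0 / 2 ^ n / 2"
        using lip[OF SB XB rate] by (simp add: S)
      show "(\<lambda>n. 2 * e0 / 2 ^ n / 2) \<longlonglongrightarrow> 0"
        using tendsto_divide[OF lim0 tendsto_const, of 2] by simp
    qed
    hence "(\<lambda>n. S (Suc n) i) \<longlonglongrightarrow> T X i" by (simp add: LIM_zero_iff)
    moreover have "(\<lambda>n. S (Suc n) i) \<longlonglongrightarrow> X i" using X by (rule LIMSEQ_Suc)
    ultimately show ?thesis by (rule LIMSEQ_unique)
  qed
  thus thesis using that[of X] XB X by (auto simp: S_def)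
qed

text \<open>Bound and Lipschitz constant are carried together because the product rule for Lipschitz
  constants needs both; the distance is again the sup over coordinates.\<close>

definition lipb :: "('i \<Rightarrow> 'b::real_normed_vector) set \<Rightarrow>
    (('i \<Rightarrow> 'b) \<Rightarrow> 'c::real_normed_vector) \<Rightarrow> real \<Rightarrow> real \<Rightarrow> bool" where
  "lipb B F K L \<longleftrightarrow> (\<forall>X\<in>B. norm (F X) \<le> K) \<and>
     (\<forall>X\<in>B. \<forall>Y\<in>B. \<forall>e. (\<forall>i. norm (X i - Y i) \<le> e) \<longrightarrow> norm (F X - F Y) \<le> L * e)"

lemma lipbD:
  assumes "lipb B F K L"
  shows "X \<in> B \<Longrightarrow> norm (F X) \<le> K"
    and "X \<in> B \<Longrightarrow> Y \<in> B \<Longrightarrow> (\<And>i. norm (X i - Y i) \<le> e) \<Longrightarrow> norm (F X - F Y) \<le> L * e"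
  using assms unfolding lipb_def by blast+

lemma lipbI:
  assumes "\<And>X. X \<in> B \<Longrightarrow> norm (F X) \<le> K"
    and "\<And>X Y e. X \<in> B \<Longrightarrow> Y \<in> B \<Longrightarrow> e \<ge> 0 \<Longrightarrow> (\<And>i. norm (X i - Y i) \<le> e) \<Longrightarrow>
           norm (F X - F Y) \<le> L * e"
  shows "lipb B F K L"
  unfolding lipb_def
proof (intro conjI ballI allI impI)
  fix X Y e
  assume "X \<in> B" "Y \<in> B" and *: "\<forall>i. norm (X i - Y i) \<le> e"
  thus "norm (F X - F Y) \<le> L * e"
    using assms(2)[of X Y e] order_trans[OF norm_ge_zero spec[OF *]] by blast
qed (rule assms(1))

lemma lipb_weaken:
  assumes "lipb B F K L" "K \<le> K'" "L \<le> L'"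
  shows "lipb B F K' L'"
proof (rule lipbI)
  show "norm (F X) \<le> K'" if "X \<in> B" for X
    using lipbD(1)[OF assms(1) that] assms(2) by simp
  show "norm (F X - F Y) \<le> L' * e"
    if "X \<in> B" "Y \<in> B" "e \<ge> 0" "\<And>i. norm (X i - Y i) \<le> e" for X Y e
    using lipbD(2)[OF assms(1) that(1,2,4)] mult_right_mono[OF assms(3) that(3)] by simp
qed

lemma lipb_const: "norm c \<le> K \<Longrightarrow> lipb B (\<lambda>_. c) K 0"
  by (rule lipbI) auto

lemma lipb_add:
  assumes F: "lipb B F K L" and G: "lipb B G K' L'"
  shows "lipb B (\<lambda>X. F X + G X) (K + K') (L + L')"
proof (rule lipbI)
  show "norm (F X + G X) \<le> K + K'" if "X \<in> B" for X
    by (intro norm_triangle_mono lipbD(1)[OF F that] lipbD(1)[OF G that])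
  show "norm (F X + G X - (F Y + G Y)) \<le> (L + L') * e"
    if *: "X \<in> B" "Y \<in> B" "\<And>i. norm (X i - Y i) \<le> e" for X Y e
    unfolding add_diff_add distrib_right
    by (intro norm_triangle_mono lipbD(2)[OF F *] lipbD(2)[OF G *])
qed

lemma lipb_linear:
  assumes "bounded_linear \<phi>" "\<And>x. norm (\<phi> x) \<le> c * norm x" "c \<ge> 0" "lipb B F K L"
  shows "lipb B (\<lambda>X. \<phi> (F X)) (c * K) (c * L)"
proof (rule lipbI)
  show "norm (\<phi> (F X)) \<le> c * K" if "X \<in> B" for X
    using assms(2)[of "F X"] lipbD(1)[OF assms(4) that] assms(3) by (meson mult_left_mono order_trans)
  show "norm (\<phi> (F X) - \<phi> (F Y)) \<le> c * L * e"
    if "X \<in> B" "Y \<in> B" "\<And>i. norm (X i - Y i) \<le> e" for X Y e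
    using assms(2)[of "F X - F Y"] lipbD(2)[OF assms(4) that] assms(3)
    by (smt (verit) linear_simps(2)[OF assms(1)] mult.assoc mult_left_mono)
qed

lemma lipb_minus: "lipb B F K L \<Longrightarrow> lipb B (\<lambda>X. - F X) K L"
  using lipb_linear[of uminus 1 B F K L] by (simp add: bounded_linear_minus bounded_linear_ident)

lemma lipb_diff: "lipb B F K L \<Longrightarrow> lipb B G K' L' \<Longrightarrow> lipb B (\<lambda>X. F X - G X) (K + K') (L + L')"
  using lipb_add[OF _ lipb_minus, of B F K L G K' L'] by simp

lemma lipb_mult:
  fixes F G :: "('i \<Rightarrow> 'b::real_normed_vector) \<Rightarrow> 'c::real_normed_algebra"
  assumes F: "lipb B F K L" and G: "lipb B G K' L'"
  shows "lipb B (\<lambda>X. F X * G X) (K * K') (L * K' + K * L')"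
proof (rule lipbI)
  show "norm (F X * G X) \<le> K * K'" if "X \<in> B" for X
    using lipbD(1)[OF F that] lipbD(1)[OF G that]
    by (intro order_trans[OF norm_mult_ineq] mult_mono) (auto intro: order_trans[OF norm_ge_zero])
  fix X Y e
  assume *: "X \<in> B" "Y \<in> B" "\<And>i. norm (X i - Y i) \<le> e"
  have "F X * G X - F Y * G Y = (F X - F Y) * G X + F Y * (G X - G Y)" by (simp add: algebra_simps)
  also have "norm \<dots> \<le> norm (F X - F Y) * norm (G X) + norm (F Y) * norm (G X - G Y)"
    by (intro norm_triangle_mono norm_mult_ineq)
  also have "\<dots> \<le> (L * e) * K' + K * (L' * e)"
    using lipbD(2)[OF F *] lipbD(2)[OF G *] lipbD(1)[OF G *(1)] lipbD(1)[OF F *(2)]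
    by (intro add_mono mult_mono) (auto intro: order_trans[OF norm_ge_zero])
  finally show "norm (F X * G X - F Y * G Y) \<le> (L * K' + K * L') * e" by (simp add: algebra_simps)
qed

lemma lipb_power2:
  fixes F :: "('i \<Rightarrow> 'b::real_normed_vector) \<Rightarrow> 'c::real_normed_algebra_1"
  assumes "lipb B F K L"
  shows "lipb B (\<lambda>X. (F X)\<^sup>2) (K\<^sup>2) (2 * K * L)"
  using lipb_mult[OF assms assms] by (simp add: power2_eq_square algebra_simps)

lemma lipb_sum:
  "finite I \<Longrightarrow> (\<And>i. i \<in> I \<Longrightarrow> lipb B (F i) K L) \<Longrightarrow>
    lipb B (\<lambda>X. \<Sum>i\<in>I. F i X) (real (card I) * K) (real (card I) * L)"
proof (induction I rule: finite_induct)
  case (insert i I)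
  hence "lipb B (F i) K L" "lipb B (\<lambda>X. \<Sum>i\<in>I. F i X) (real (card I) * K) (real (card I) * L)"
    by simp_all
  from lipb_add[OF this] insert.hyps show ?case by (simp add: algebra_simps)
qed (simp add: lipb_const)

lemma lipb_cmult:
  fixes F :: "('i \<Rightarrow> 'b::real_normed_vector) \<Rightarrow> 'c::real_normed_algebra"
  assumes "norm a \<le> c" "lipb B F K L"
  shows "lipb B (\<lambda>X. a * F X) (c * K) (c * L)"
  using lipb_linear[OF bounded_linear_mult_right[of a] _ _ assms(2), of c] assms(1)
  by (metis mult_right_mono norm_ge_zero norm_mult_ineq order_trans)

text \<open>With \<open>\<omega>\<^sub>j = r\<^sub>h u\<^sub>j\<close>, the unknown \<open>X\<close> collects \<open>X 0 = H - l (3 - 3 t + t\<^sup>2)\<close>, the derivatives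
  \<open>X j = u\<^sub>j'\<close> for \<open>1 \<le> j < N\<close>, and \<open>X N = 1 / H\<close>; \<open>y\<close> stands for the variable \<open>t\<close> and \<open>av\<close> for
  \<open>f \<mapsto> (1 / t) \<integral>\<^sub>0\<^sup>t f\<close>.\<close>

definition pu where
  "pu av y N a X j = (if 1 \<le> j \<and> j < N then a j + y * av (X j) else 0)"

definition pG :: "nat \<Rightarrow> (nat \<Rightarrow> 'b) \<Rightarrow> 'b::{real_normed_algebra_1,comm_ring_1}" where
  "pG N X = (\<Sum>j=1..N-1. (X j)\<^sup>2)"

definition pP where
  "pP av y N \<kappa> a X = (\<Sum>j=1..N.
     ((pu av y N a X j)\<^sup>2 - (pu av y N a X (j - 1))\<^sup>2 - (real N + 1 - 2 * real j) *\<^sub>R \<kappa>)\<^sup>2)"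

text \<open>The quadratic is (1 - (1 - t)^3) / t: it comes from \<open>\<Lambda>\<close> together
  with the part \<open>l / 2\<close> of the scaled horizon mass, in \<open>\<mu> / r\<^sup>2\<close>
  divided by \<open>t\<close>.\<close>

definition pH where
  "pH y l X = l *\<^sub>R (3 - 3 * y + y\<^sup>2) + X (0::nat)"

text \<open>The right-hand side of the mass equation: the \<open>t\<close>-derivative of
  \<open>m / r\<^sub>h ^ 3\<close>.\<close>

definition pE where
  "pE av y l N \<kappa> a X = y * pH y l X * pG N X + (1/4) *\<^sub>R pP av y N \<kappa> a X"

text \<open>Insert the scaled mass (\<kappa> + l) / 2 + t av E into \<kappa> (1 - t)^2 + l - 2 m (1
  - t)^3 and divide by \<open>t\<close>: this is what remains beside the quadratic in
  \<open>pH\<close>.\<close>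

definition pD where
  "pD av y l N \<kappa> a X = (1 - y)\<^sup>2 * \<kappa> - 2 * (1 - y) ^ 3 * av (pE av y l N \<kappa> a X)"

definition pW where
  "pW av y N \<kappa> a X j = \<kappa> - (pu av y N a X j)\<^sup>2
     + (1/2) *\<^sub>R ((pu av y N a X (j - 1))\<^sup>2 + (pu av y N a X (j + 1))\<^sup>2)"

text \<open>Minus the derivative of t H w. The second summand arises when H is moved under the
  derivative: it is the part of (t H)' that contains \<open>pG\<close>.\<close>

definition pF where
  "pF av y l N \<kappa> a X j = pW av y N \<kappa> a X j * pu av y N a X j
     + 2 * (1 - y) ^ 3 * y * (pH y l X * pG N X * X j)"

text \<open>For 1 / H the equation g (q + D) = 1, with \<open>g0\<close> the inverse of the
  quadratic part q, is written g = g0 - g0 D g. Here D is recomputed as \<open>pD\<close> instead of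
  being read off from \<open>X 0\<close>: \<open>pD\<close> is small and has a small Lipschitz
  constant, whereas \<open>X 0\<close> is only bounded by \<open>l\<close>. Coordinates above
  \<open>N\<close> are set to 0 so that bounds hold for all indices.\<close>

definition pT where
  "pT av y g0 l N \<kappa> a X i =
     (if i = 0 then pD av y l N \<kappa> a X
      else if i = N then g0 - g0 * (pD av y l N \<kappa> a X * X N)
      else if i < N then - (X N * av (pF av y l N \<kappa> a X i)) else 0)"

text \<open>Crude constants: on the ball, \<open>pE\<close>, \<open>pD\<close> and \<open>pF\<close>
  have norms at most \<open>cA\<close>, \<open>cB\<close>, \<open>cC\<close> times \<delta>^2, and
  Lipschitz constants at most twice \<open>cA\<close>, twice \<open>cB\<close> and once
  \<open>cC\<close> times \<delta>.\<close>

definition cA :: "real \<Rightarrow> nat \<Rightarrow> real" where "cA l N = real N * (18 + real N)\<^sup>2 * (1 + 8 * l)"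
definition cB :: "real \<Rightarrow> nat \<Rightarrow> real" where "cB l N = 4 + 16 * cA l N"
definition cC :: "real \<Rightarrow> nat \<Rightarrow> real" where "cC l N = 57 + 16 * real N + 400 * l * real N"

text \<open>The two comparisons with \<open>l\<close> make the map preserve the ball; the last three
  conditions give Lipschitz constant 1/2 for \<open>pD\<close>, for the equation of 1 / H and for
  the equations of the fields, in this order.\<close>

definition small :: "real \<Rightarrow> nat \<Rightarrow> real \<Rightarrow> bool" where
  "small l N \<delta> \<longleftrightarrow> 0 < \<delta> \<and> \<delta> \<le> 1 \<and> 4 * cB l N * \<delta> \<le> l \<and> 4 * cC l N * \<delta> \<le> l \<and> 4 * cB l N * \<delta> \<le> 1 \<and>
     (16 / l\<^sup>2 + 2 / l) * cB l N * \<delta> \<le> 1/2 \<and> (1 + 4 / l) * cC l N * \<delta> \<le> 1/2"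

lemma small_exists:
  assumes "l > 0"
  obtains \<delta> where "small l N \<delta>"
proof -
  have ev: "\<forall>\<^sub>F \<delta> in at_right (0::real). c * \<delta> \<le> d" if "d > 0" for c d :: real
  proof -
    have "((\<lambda>\<delta>. c * \<delta>) \<longlongrightarrow> c * 0) (at_right 0)" by (intro tendsto_intros)
    hence "\<forall>\<^sub>F \<delta> in at_right 0. c * \<delta> < d" using that by (intro order_tendstoD(2)) auto
    thus ?thesis by (rule eventually_mono) simp
  qed
  have "\<forall>\<^sub>F \<delta> in at_right 0. small l N \<delta>"
    unfolding small_def
    using ev[of 1 1] ev[of l "4 * cB l N"] ev[of l "4 * cC l N"] ev[of 1 "4 * cB l N"]
      ev[of "1/2" "(16 / l\<^sup>2 + 2 / l) * cB l N"] ev[of "1/2" "(1 + 4 / l) * cC l N"] assms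
    by (intro eventually_conj) (auto simp: eventually_at_right_less)
  thus thesis using that eventually_happens'[of "at_right (0::real)"] by force
qed

text \<open>The radius \<open>l\<close> keeps H positive on [0, 1), \<delta> keeps the fields from
  reaching 0, and 4 / l is twice the bound on \<open>g0\<close>, which leaves room for the
  correction g0 D g.\<close>

definition pball :: "real \<Rightarrow> nat \<Rightarrow> real \<Rightarrow> (nat \<Rightarrow> 'b::real_normed_vector) set" where
  "pball l N \<delta> = {X. norm (X 0) \<le> l \<and> norm (X N) \<le> 4 / l \<and> (\<forall>j. 1 \<le> j \<and> j < N \<longrightarrow> norm (X j) \<le> \<delta>)}"

lemma norm_mult_le_mult:
  fixes a b c :: "'a::real_normed_algebra"
  assumes "norm a \<le> A" "norm b \<le> B"
  shows "norm (a * b) \<le> A * B"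
  using assms by (intro order_trans[OF norm_mult_ineq] mult_mono) (auto intro: order_trans[OF norm_ge_zero])

section \<open>Estimates for the fixed point map\<close>

context
  fixes av :: "'b::{real_normed_algebra_1,comm_ring_1,banach} \<Rightarrow> 'b" and y g0 \<kappa> :: 'b
    and l \<delta> :: real and N :: nat and a :: "nat \<Rightarrow> 'b"
  assumes av: "bounded_linear av" and av_le: "\<And>f. norm (av f) \<le> norm f" and y: "norm y \<le> 1"
    and l: "l > 0" and N: "N \<ge> 2" and small: "small l N \<delta>" and g0: "norm g0 \<le> 2 / l"
    and \<kappa>: "norm \<kappa> \<le> \<delta>\<^sup>2" and a: "\<And>j. 1 \<le> j \<Longrightarrow> j < N \<Longrightarrow> norm (a j) \<le> 2 * \<delta>"
begin

private abbreviation (input) "B \<equiv> pball l N \<delta> :: (nat \<Rightarrow> 'b) set"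

private lemma \<delta>: "0 < \<delta>" "\<delta> \<le> 1" using small by (auto simp: small_def)

private lemma pow: "\<delta> ^ n \<le> \<delta> ^ m" if "m \<le> n" for m n
  using \<delta> that by (simp add: power_decreasing)

private lemma lipb_av: "lipb B F K L \<Longrightarrow> lipb B (\<lambda>X. av (F X)) K L" for F :: "(nat \<Rightarrow> 'b) \<Rightarrow> 'b"
  using lipb_linear[OF av, of 1] av_le by simp

private lemma lipb_coord: "lipb B (\<lambda>X. X j) \<delta> 1" if "1 \<le> j" "j < N"
  by (rule lipbI) (use that in \<open>auto simp: pball_def\<close>)

private lemma lipb_u: "lipb B (\<lambda>X. pu av y N a X j) (3 * \<delta>) 1"
proof (cases "1 \<le> j \<and> j < N")
  case True
  have "lipb B (\<lambda>X. a j + y * av (X j)) (2 * \<delta> + 1 * \<delta>) (0 + 1 * 1)"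
    using True by (intro lipb_add lipb_const lipb_cmult lipb_av lipb_coord y a) auto
  thus ?thesis using True by (simp add: pu_def)
next
  case False
  thus ?thesis using lipb_weaken[OF lipb_const[of "0::'b" 0 B], of "3 * \<delta>" 1] \<delta> by (auto simp: pu_def)
qed

private lemma lipb_u2: "lipb B (\<lambda>X. (pu av y N a X j)\<^sup>2) (9 * \<delta>\<^sup>2) (6 * \<delta>)"
  using lipb_power2[OF lipb_u[of j]] by (simp add: power_mult_distrib)

private lemma lipb_G: "lipb B (\<lambda>X. pG N X) (real N * \<delta>\<^sup>2) (2 * real N * \<delta>)"
proof -
  have "lipb B (\<lambda>X. pG N X) (real (card {1..N-1}) * \<delta>\<^sup>2) (real (card {1..N-1}) * (2 * \<delta> * 1))"
    unfolding pG_def by (intro lipb_sum lipb_power2 lipb_coord) (use N in auto)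
  thus ?thesis
    by (rule lipb_weaken) (use \<delta> in \<open>auto intro!: mult_right_mono simp: mult.assoc\<close>)
qed

private lemma lipb_P:
  "lipb B (\<lambda>X. pP av y N \<kappa> a X) (real N * ((18 + real N) * \<delta>\<^sup>2)\<^sup>2)
     (real N * (2 * ((18 + real N) * \<delta>\<^sup>2) * (12 * \<delta>)))"
proof -
  have *: "norm ((real N + 1 - 2 * real j) *\<^sub>R \<kappa>) \<le> real N * \<delta>\<^sup>2" if "j \<in> {1..N}" for j
    using that \<kappa> by (auto intro!: mult_mono)
  have "lipb B (\<lambda>X. pP av y N \<kappa> a X) (real (card {1..N}) * (9 * \<delta>\<^sup>2 + 9 * \<delta>\<^sup>2 + real N * \<delta>\<^sup>2)\<^sup>2)
     (real (card {1..N}) * (2 * (9 * \<delta>\<^sup>2 + 9 * \<delta>\<^sup>2 + real N * \<delta>\<^sup>2) * (6 * \<delta> + 6 * \<delta> + 0)))"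
    unfolding pP_def by (intro lipb_sum lipb_power2 lipb_diff lipb_u2 lipb_const *) auto
  thus ?thesis by (simp add: algebra_simps)
qed

private lemma lipb_H: "lipb B (\<lambda>X. pH y l X) (8 * l) 1"
proof -
  have "norm (3 - 3 * y + y\<^sup>2) \<le> norm (3::'b) + norm (3 * y) + norm (y\<^sup>2)"
    by (meson add_mono norm_triangle_ineq norm_triangle_ineq4 order_trans order_refl)
  also have "\<dots> \<le> 3 + 3 * 1 + 1\<^sup>2"
    by (intro add_mono norm_mult_le_mult order_trans[OF norm_power_ineq] power_mono y) auto
  finally have "norm (l *\<^sub>R (3 - 3 * y + y\<^sup>2)) \<le> l * 7" using l by simp
  moreover have "lipb B (\<lambda>X. X 0) l 1" by (rule lipbI) (auto simp: pball_def)
  ultimately have "lipb B (\<lambda>X. pH y l X) (l * 7 + l) (0 + 1)"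
    unfolding pH_def by (intro lipb_add lipb_const)
  thus ?thesis by (simp add: algebra_simps)
qed

private lemma lipb_HG: "lipb B (\<lambda>X. pH y l X * pG N X) (8 * l * real N * \<delta>\<^sup>2) ((1 + 16 * l) * real N * \<delta>)"
proof -
  have "real N * \<delta>\<^sup>2 \<le> real N * \<delta>" using pow[of 1 2] by (simp add: mult_left_mono)
  thus ?thesis by (intro lipb_weaken[OF lipb_mult[OF lipb_H lipb_G]]) (auto simp: algebra_simps)
qed

private lemma lipb_E: "lipb B (\<lambda>X. pE av y l N \<kappa> a X) (cA l N * \<delta>\<^sup>2) (2 * cA l N * \<delta>)"
proof (rule lipb_weaken)
  let ?n = "real N"
  have *: "lipb B (\<lambda>X. (1/4) *\<^sub>R F X) (1/4 * K) (1/4 * L)" if "lipb B F K L"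
    for F :: "(nat \<Rightarrow> 'b) \<Rightarrow> 'b" and K L
    by (rule lipb_linear[OF bounded_linear_scaleR_right _ _ that]) auto
  show "lipb B (\<lambda>X. pE av y l N \<kappa> a X)
     (1 * (8 * l * ?n * \<delta>\<^sup>2) + 1/4 * (?n * ((18 + ?n) * \<delta>\<^sup>2)\<^sup>2))
     (1 * ((1 + 16 * l) * ?n * \<delta>) + 1/4 * (?n * (2 * ((18 + ?n) * \<delta>\<^sup>2) * (12 * \<delta>))))"
    unfolding pE_def mult.assoc[of y] by (intro lipb_add lipb_cmult * lipb_HG lipb_P y)
  have n1: "1 \<le> (18 + ?n)\<^sup>2" by (simp add: one_le_power)
  have "1 * (8 * l * ?n * \<delta>\<^sup>2) + 1/4 * (?n * ((18 + ?n) * \<delta>\<^sup>2)\<^sup>2)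
      = ?n * (8 * l * 1) * \<delta>\<^sup>2 + 1/4 * ?n * (18 + ?n)\<^sup>2 * \<delta> ^ 4"
    by (simp add: power_mult_distrib flip: power_mult)
  also have "\<dots> \<le> ?n * (8 * l * (18 + ?n)\<^sup>2) * \<delta>\<^sup>2 + 1 * ?n * (18 + ?n)\<^sup>2 * \<delta>\<^sup>2"
    using l n1 pow[of 2 4] by (intro add_mono mult_mono mult_nonneg_nonneg) auto
  also have "\<dots> = cA l N * \<delta>\<^sup>2" by (simp add: cA_def algebra_simps)
  finally show "1 * (8 * l * ?n * \<delta>\<^sup>2) + 1/4 * (?n * ((18 + ?n) * \<delta>\<^sup>2)\<^sup>2) \<le> cA l N * \<delta>\<^sup>2" .
  have "1 * ((1 + 16 * l) * ?n * \<delta>) + 1/4 * (?n * (2 * ((18 + ?n) * \<delta>\<^sup>2) * (12 * \<delta>)))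
      = (1 + 16 * l) * ?n * \<delta> + ?n * (6 * (18 + ?n)) * \<delta> ^ 3"
    by (simp add: power3_eq_cube power2_eq_square)
  also have "\<dots> \<le> (1 + 16 * l) * ?n * \<delta> + ?n * (6 * (18 + ?n)) * \<delta> ^ 1"
    using pow[of 1 3] by (intro add_mono order_refl mult_left_mono) auto
  also have "\<dots> = ?n * (1 + 16 * l + 6 * (18 + ?n)) * \<delta>" by (simp add: algebra_simps)
  also have "\<dots> \<le> ?n * (2 * (18 + ?n)\<^sup>2 * (1 + 8 * l)) * \<delta>"
  proof (intro mult_right_mono mult_left_mono)
    have "l * 1 \<le> l * (18 + ?n)\<^sup>2" by (intro mult_left_mono) (use l n1 in auto)
    moreover have "1 + 6 * (18 + ?n) \<le> 2 * (18 + ?n)\<^sup>2"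
      using mult_left_mono[of 7 "18 + ?n" "18 + ?n"] by (simp add: power2_eq_square)
    ultimately have "(1 + 6 * (18 + ?n)) + 16 * (l * 1) \<le> 2 * (18 + ?n)\<^sup>2 + 16 * (l * (18 + ?n)\<^sup>2)"
      using l by (intro add_mono mult_left_mono) auto
    thus "1 + 16 * l + 6 * (18 + ?n) \<le> 2 * (18 + ?n)\<^sup>2 * (1 + 8 * l)" by (simp add: algebra_simps)
  qed (use \<delta> in auto)
  also have "\<dots> = 2 * cA l N * \<delta>" by (simp add: cA_def)
  finally show "1 * ((1 + 16 * l) * ?n * \<delta>) + 1/4 * (?n * (2 * ((18 + ?n) * \<delta>\<^sup>2) * (12 * \<delta>)))
      \<le> 2 * cA l N * \<delta>" .
qed

private lemma norm_1y: "norm ((1 - y) ^ n) \<le> 2 ^ n"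
proof -
  have "norm (1 - y) \<le> 1 + 1" using norm_triangle_ineq4[of 1 y] y by simp
  thus ?thesis by (intro order_trans[OF norm_power_ineq] power_mono) auto
qed

private lemma pos: "cA l N > 0" "cB l N > 0" "cC l N > 0"
  using l N by (auto simp: cA_def cB_def cC_def intro!: add_pos_nonneg mult_pos_pos)

private lemma lipb_D: "lipb B (\<lambda>X. pD av y l N \<kappa> a X) (cB l N * \<delta>\<^sup>2) (2 * cB l N * \<delta>)"
proof (rule lipb_weaken)
  show "lipb B (\<lambda>X. pD av y l N \<kappa> a X) (2\<^sup>2 * \<delta>\<^sup>2 + 2 * 2 ^ 3 * (cA l N * \<delta>\<^sup>2))
      (0 + 2 * 2 ^ 3 * (2 * cA l N * \<delta>))"
    unfolding pD_def
    by (intro lipb_diff lipb_const lipb_cmult lipb_av lipb_E norm_mult_le_mult norm_1y \<kappa>) auto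
qed (use \<delta> in \<open>auto simp: cB_def algebra_simps\<close>)

private lemma lipb_g: "lipb B (\<lambda>X. X N) (4 / l) 1"
  by (rule lipbI) (auto simp: pball_def)

private lemma lipb_gDg: "lipb B (\<lambda>X. g0 * (pD av y l N \<kappa> a X * X N)) (2 / l) (1/2)"
proof (rule lipb_weaken)
  show "lipb B (\<lambda>X. g0 * (pD av y l N \<kappa> a X * X N))
    (2 / l * (cB l N * \<delta>\<^sup>2 * (4 / l))) (2 / l * (2 * cB l N * \<delta> * (4 / l) + cB l N * \<delta>\<^sup>2 * 1))"
    by (intro lipb_cmult lipb_mult lipb_D lipb_g g0)
  \<comment> \<open>One power of \<delta> is given away so that the conditions in
    \<open>small\<close> are linear in \<delta>.\<close>
  have *: "cB l N * \<delta>\<^sup>2 \<le> cB l N * \<delta>" using pow[of 1 2] pos by (intro mult_left_mono) auto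
  have "cB l N * \<delta>\<^sup>2 * (4 / l) \<le> (cB l N * \<delta>) * (4 / l)"
    using * l by (intro mult_right_mono) auto
  also have "\<dots> \<le> 1" using small l by (simp add: small_def field_simps)
  finally have "cB l N * \<delta>\<^sup>2 * (4 / l) \<le> 1" .
  from mult_left_mono[OF this, of "2 / l"] l
  show "2 / l * (cB l N * \<delta>\<^sup>2 * (4 / l)) \<le> 2 / l" by simp
  have "2 / l * (2 * cB l N * \<delta> * (4 / l) + cB l N * \<delta>\<^sup>2 * 1)
      \<le> 2 / l * (2 * cB l N * \<delta> * (4 / l) + cB l N * \<delta> * 1)"
    using * l by (intro mult_left_mono add_left_mono) auto
  also have "\<dots> = (16 / l\<^sup>2 + 2 / l) * cB l N * \<delta>" by (simp add: algebra_simps power2_eq_square)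
  also have "\<dots> \<le> 1/2" using small by (simp add: small_def)
  finally show "2 / l * (2 * cB l N * \<delta> * (4 / l) + cB l N * \<delta>\<^sup>2 * 1) \<le> 1/2" .
qed

private lemma lipb_F: "lipb B (\<lambda>X. pF av y l N \<kappa> a X j) (cC l N * \<delta>\<^sup>2) (cC l N * \<delta>)"
  if j: "1 \<le> j" "j < N"
proof (rule lipb_weaken)
  let ?n = "real N"
  have half: "lipb B (\<lambda>X. (1/2) *\<^sub>R F X) (1/2 * K) (1/2 * L)" if "lipb B F K L"
    for F :: "(nat \<Rightarrow> 'b) \<Rightarrow> 'b" and K L
    by (rule lipb_linear[OF bounded_linear_scaleR_right _ _ that]) auto
  show "lipb B (\<lambda>X. pF av y l N \<kappa> a X j)
      ((\<delta>\<^sup>2 + 9 * \<delta>\<^sup>2 + 1/2 * (9 * \<delta>\<^sup>2 + 9 * \<delta>\<^sup>2)) * (3 * \<delta>)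
        + 2 * 2 ^ 3 * 1 * (8 * l * ?n * \<delta>\<^sup>2 * \<delta>))
      ((0 + 6 * \<delta> + 1/2 * (6 * \<delta> + 6 * \<delta>)) * (3 * \<delta>)
        + (\<delta>\<^sup>2 + 9 * \<delta>\<^sup>2 + 1/2 * (9 * \<delta>\<^sup>2 + 9 * \<delta>\<^sup>2)) * 1
        + 2 * 2 ^ 3 * 1 * ((1 + 16 * l) * ?n * \<delta> * \<delta> + 8 * l * ?n * \<delta>\<^sup>2 * 1))"
    unfolding pF_def pW_def
    by (intro lipb_add lipb_diff lipb_mult lipb_cmult half lipb_u lipb_u2 lipb_HG lipb_coord
          lipb_const norm_mult_le_mult norm_1y \<kappa> y j) auto
  have "(\<delta>\<^sup>2 + 9 * \<delta>\<^sup>2 + 1/2 * (9 * \<delta>\<^sup>2 + 9 * \<delta>\<^sup>2)) * (3 * \<delta>) + 2 * 2 ^ 3 * 1 * (8 * l * ?n * \<delta>\<^sup>2 * \<delta>)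
      = (57 + 128 * l * ?n) * \<delta> ^ 3" by (simp add: algebra_simps power2_eq_square power3_eq_cube)
  \<comment> \<open>The size is really of order \<delta>^3; even \<delta>^2 leaves one factor
    \<delta> to absorb the bound 4 / l on 1 / H and return to radius \<delta>.\<close>
  also have "\<dots> \<le> cC l N * \<delta>\<^sup>2"
    using pow[of 2 3] l \<delta> by (intro mult_mono) (auto simp: cC_def add_nonneg_nonneg)
  finally show "(\<delta>\<^sup>2 + 9 * \<delta>\<^sup>2 + 1/2 * (9 * \<delta>\<^sup>2 + 9 * \<delta>\<^sup>2)) * (3 * \<delta>)
        + 2 * 2 ^ 3 * 1 * (8 * l * ?n * \<delta>\<^sup>2 * \<delta>) \<le> cC l N * \<delta>\<^sup>2" .
  have "(0 + 6 * \<delta> + 1/2 * (6 * \<delta> + 6 * \<delta>)) * (3 * \<delta>)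
        + (\<delta>\<^sup>2 + 9 * \<delta>\<^sup>2 + 1/2 * (9 * \<delta>\<^sup>2 + 9 * \<delta>\<^sup>2)) * 1
        + 2 * 2 ^ 3 * 1 * ((1 + 16 * l) * ?n * \<delta> * \<delta> + 8 * l * ?n * \<delta>\<^sup>2 * 1)
      = (55 + 16 * ?n + 384 * l * ?n) * \<delta>\<^sup>2" by (simp add: algebra_simps power2_eq_square)
  also have "\<dots> \<le> cC l N * \<delta> ^ 1"
    using pow[of 1 2] l by (intro mult_mono) (auto simp: cC_def add_nonneg_nonneg)
  finally show "(0 + 6 * \<delta> + 1/2 * (6 * \<delta> + 6 * \<delta>)) * (3 * \<delta>)
        + (\<delta>\<^sup>2 + 9 * \<delta>\<^sup>2 + 1/2 * (9 * \<delta>\<^sup>2 + 9 * \<delta>\<^sup>2)) * 1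
        + 2 * 2 ^ 3 * 1 * ((1 + 16 * l) * ?n * \<delta> * \<delta> + 8 * l * ?n * \<delta>\<^sup>2 * 1) \<le> cC l N * \<delta>"
    by simp
qed

private lemma lipb_w: "lipb B (\<lambda>X. - (X N * av (pF av y l N \<kappa> a X j))) \<delta> (1/2)" if j: "1 \<le> j" "j < N"
proof (rule lipb_weaken)
  show "lipb B (\<lambda>X. - (X N * av (pF av y l N \<kappa> a X j))) (4 / l * (cC l N * \<delta>\<^sup>2))
      (1 * (cC l N * \<delta>\<^sup>2) + 4 / l * (cC l N * \<delta>))"
    by (intro lipb_minus lipb_mult lipb_g lipb_av lipb_F j)
  have "4 / l * (cC l N * \<delta>\<^sup>2) = (4 * cC l N * \<delta> / l) * \<delta>" by (simp add: power2_eq_square)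
  also have "\<dots> \<le> 1 * \<delta>" using small l by (intro mult_right_mono) (auto simp: small_def)
  finally show "4 / l * (cC l N * \<delta>\<^sup>2) \<le> \<delta>" by simp
  have "1 * (cC l N * \<delta>\<^sup>2) + 4 / l * (cC l N * \<delta>) \<le> 1 * (cC l N * \<delta> ^ 1) + 4 / l * (cC l N * \<delta>)"
    using pow[of 1 2] pos l by (intro add_mono mult_left_mono) auto
  also have "\<dots> = (1 + 4 / l) * cC l N * \<delta>" by (simp add: algebra_simps)
  also have "\<dots> \<le> 1/2" using small by (simp add: small_def)
  finally show "1 * (cC l N * \<delta>\<^sup>2) + 4 / l * (cC l N * \<delta>) \<le> 1/2" .
qed

text \<open>When \<open>g0\<close> inverts the quadratic, the iteration starts at the exact solution
  for \<open>\<kappa> = 0\<close> and \<open>a = 0\<close>: vanishing fields, \<open>X 0 = 0\<close>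
  and \<open>1 / H = g0\<close>.\<close>

lemma pT_fixed_point:
  obtains X where "X \<in> pball l N \<delta>" "pT av y g0 l N \<kappa> a X = X"
    "\<And>i. (\<lambda>n. (pT av y g0 l N \<kappa> a ^^ n) (\<lambda>i. if i = N then g0 else 0) i) \<longlonglongrightarrow> X i"
proof (rule coordinatewise_fixed_point[where T = "pT av y g0 l N \<kappa> a" and B = "pball l N \<delta>"
      and ?X0.0 = "\<lambda>i. if i = N then g0 else 0"])
  let ?T = "pT av y g0 l N \<kappa> a" and ?X0 = "\<lambda>i. if i = N then g0 else 0"
  show X0: "?X0 \<in> pball l N \<delta>"
    using g0 l N \<delta> by (auto simp: pball_def field_simps)
  show maps: "?T X \<in> pball l N \<delta>" if X: "X \<in> pball l N \<delta>" for X
  proof -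
    have "norm (pD av y l N \<kappa> a X) \<le> cB l N * \<delta>\<^sup>2" by (rule lipbD[OF lipb_D X])
    also have "\<dots> \<le> cB l N * \<delta> ^ 1" using pow[of 1 2] pos by (intro mult_left_mono) auto
    also have "\<dots> \<le> 4 * cB l N * \<delta>" using pos \<delta> by simp
    also have "\<dots> \<le> l" using small by (simp add: small_def)
    finally have D: "norm (pD av y l N \<kappa> a X) \<le> l" .
    have "norm (g0 - g0 * (pD av y l N \<kappa> a X * X N)) \<le> 2 / l + 2 / l"
      by (intro order_trans[OF norm_triangle_ineq4] add_mono g0 lipbD[OF lipb_gDg X])
    thus ?thesis using D N lipbD(1)[OF lipb_w X] by (auto simp: pball_def pT_def)
  qed
  show "Y \<in> pball l N \<delta>"
    if X: "\<And>n. X n \<in> pball l N \<delta>" and Y: "\<And>i. (\<lambda>n. X n i) \<longlonglongrightarrow> Y i" for X and Y :: "nat \<Rightarrow> 'b"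
    unfolding pball_def mem_Collect_eq
    by (intro conjI allI impI tendsto_upperbound[OF tendsto_norm[OF Y]])
       (use X in \<open>auto simp: pball_def\<close>)
  show "norm (?T X i - ?T Y i) \<le> e / 2"
    if "X \<in> pball l N \<delta>" "Y \<in> pball l N \<delta>" "\<And>i. norm (X i - Y i) \<le> e" for X Y e i
  proof -
    have e: "e \<ge> 0" by (rule order_trans[OF norm_ge_zero that(3)])
    have "norm (pD av y l N \<kappa> a X - pD av y l N \<kappa> a Y) \<le> 2 * cB l N * \<delta> * e"
      by (rule lipbD(2)[OF lipb_D that])
    also have "\<dots> \<le> 1/2 * e" using small e by (intro mult_right_mono) (auto simp: small_def)
    finally show ?thesis
      using lipbD(2)[OF lipb_gDg that] lipbD(2)[OF lipb_w that, of i] e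
      by (auto simp: pT_def norm_minus_commute)
  qed
  \<comment> \<open>Only some bound uniform in \<open>i\<close> is required of the first step;
    membership of both points in the ball supplies one.\<close>
  show "norm (?T ?X0 i - ?X0 i) \<le> 2 * l + 2 * (4 / l) + 2 * \<delta>" for i
  proof -
    have *: "norm (X i) \<le> l + 4 / l + \<delta>" if "X \<in> pball l N \<delta>" "i \<le> N" for X :: "nat \<Rightarrow> 'b"
    proof -
      have "i = 0 \<or> i = N \<or> 1 \<le> i \<and> i < N" using that by auto
      thus ?thesis using that l \<delta> by (auto simp: pball_def add_increasing add_increasing2)
    qed
    have *: "norm (X i) \<le> l + 4 / l + \<delta>" if "X \<in> {?T ?X0, ?X0}" for X
    proof (cases "i \<le> N")
      case True thus ?thesis using * X0 maps[OF X0] that by auto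
    next
      case False thus ?thesis using that N l \<delta> by (auto simp: pT_def)
    qed
    show ?thesis using *[of "?T ?X0"] *[of ?X0] norm_triangle_ineq4[of "?T ?X0 i" "?X0 i"] by auto
  qed
qed (rule that)

end

text \<open>The map is assembled from ring operations, real scalars and \<open>av\<close>, so it is
  natural under homomorphisms that intertwine the averaging operators.\<close>

lemma pT_hom:
  fixes \<phi> :: "'a::{real_normed_algebra_1,comm_ring_1} \<Rightarrow> 'b::{real_normed_algebra_1,comm_ring_1}"
  assumes "banach_hom \<phi>" and av: "\<And>f. \<phi> (av f) = av' (\<phi> f)"
  shows "\<phi> (pu av y N a X j) = pu av' (\<phi> y) N (\<phi> \<circ> a) (\<phi> \<circ> X) j"
    and "\<phi> (pG N X) = pG N (\<phi> \<circ> X)"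
    and "\<phi> (pE av y l N \<kappa> a X) = pE av' (\<phi> y) l N (\<phi> \<kappa>) (\<phi> \<circ> a) (\<phi> \<circ> X)"
    and "\<phi> \<circ> pT av y g0 l N \<kappa> a X = pT av' (\<phi> y) (\<phi> g0) l N (\<phi> \<kappa>) (\<phi> \<circ> a) (\<phi> \<circ> X)"
proof -
  interpret banach_hom \<phi> by fact
  have num: "\<phi> (numeral n) = numeral n" for n using of_real[of "numeral n"] by simp
  note hom = add diff neg scaleR mult power one zero sum num av
  show u: "\<phi> (pu av y N a X j) = pu av' (\<phi> y) N (\<phi> \<circ> a) (\<phi> \<circ> X) j" for j
    by (simp add: pu_def hom)
  show G: "\<phi> (pG N X) = pG N (\<phi> \<circ> X)" by (simp add: pG_def hom)
  have H: "\<phi> (pH y l X) = pH (\<phi> y) l (\<phi> \<circ> X)" by (simp add: pH_def hom)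
  have P: "\<phi> (pP av y N \<kappa> a X) = pP av' (\<phi> y) N (\<phi> \<kappa>) (\<phi> \<circ> a) (\<phi> \<circ> X)"
    by (simp add: pP_def hom u)
  show E: "\<phi> (pE av y l N \<kappa> a X) = pE av' (\<phi> y) l N (\<phi> \<kappa>) (\<phi> \<circ> a) (\<phi> \<circ> X)"
    by (simp add: pE_def hom G H P)
  have D: "\<phi> (pD av y l N \<kappa> a X) = pD av' (\<phi> y) l N (\<phi> \<kappa>) (\<phi> \<circ> a) (\<phi> \<circ> X)"
    by (simp add: pD_def hom E)
  have W: "\<phi> (pW av y N \<kappa> a X j) = pW av' (\<phi> y) N (\<phi> \<kappa>) (\<phi> \<circ> a) (\<phi> \<circ> X) j" for j
    by (simp add: pW_def hom u)
  have F: "\<phi> (pF av y l N \<kappa> a X j) = pF av' (\<phi> y) l N (\<phi> \<kappa>) (\<phi> \<circ> a) (\<phi> \<circ> X) j" for j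
    by (simp add: pF_def hom u W G H)
  show "\<phi> \<circ> pT av y g0 l N \<kappa> a X = pT av' (\<phi> y) (\<phi> g0) l N (\<phi> \<kappa>) (\<phi> \<circ> a) (\<phi> \<circ> X)"
    by (simp add: fun_eq_iff pT_def hom D F)
qed

lemma pT_iterate_hom:
  fixes \<phi> :: "'a::{real_normed_algebra_1,comm_ring_1} \<Rightarrow> 'b::{real_normed_algebra_1,comm_ring_1}"
  assumes "banach_hom \<phi>" and "\<And>f. \<phi> (av f) = av' (\<phi> f)"
  shows "\<phi> \<circ> (pT av y g0 l N \<kappa> a ^^ n) X = (pT av' (\<phi> y) (\<phi> g0) l N (\<phi> \<kappa>) (\<phi> \<circ> a) ^^ n) (\<phi> \<circ> X)"
  proof (induction n)
  case (Suc n)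
  thus ?case
    using pT_hom(4)[where av = av and av' = av', OF assms] by (metis comp_def funpow.simps(2))
qed simp

section \<open>Power series with absolutely summable coefficients\<close>

text \<open>The function \<open>d\<close> gives the degree in \<open>t\<close> of a monomial:
  \<open>id\<close> for series in \<open>t\<close> alone, \<open>fst\<close> when parameters are
  present. Multiplying the result by \<open>t\<close> gives the primitive that vanishes at
  0.\<close>

definition avg :: "('i \<Rightarrow> nat) \<Rightarrow> 'i l1 \<Rightarrow> 'i l1" where
  "avg d = lext (\<lambda>i. basis i /\<^sub>R (real (d i) + 1))"

lemma norm_avg_basis: "norm (basis i /\<^sub>R (real n + 1)) \<le> 1"
  by (simp add: divide_simps)

lemma avg_basis [simp]: "avg d (basis i) = basis i /\<^sub>R (real (d i) + 1)"
  by (simp add: avg_def)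

lemma bounded_linear_avg: "bounded_linear (avg d)"
  unfolding avg_def by (rule bounded_linear_lext[OF norm_avg_basis])

lemma norm_avg_le: "norm (avg d f) \<le> norm f"
  unfolding avg_def using norm_lext[OF norm_avg_basis, where f = f] by simp

definition subs :: "'b::{real_normed_algebra_1,banach} \<Rightarrow> nat l1 \<Rightarrow> 'b" where
  "subs Y = lext (\<lambda>n. Y ^ n)"

definition tt :: "nat l1" where "tt = basis 1"

lemma norm_power_le_1: "norm Y \<le> 1 \<Longrightarrow> norm (Y ^ n) \<le> 1"
  for Y :: "'b::real_normed_algebra_1"
  by (rule order_trans[OF norm_power_ineq]) (simp add: power_le_one)

lemma banach_hom_subs: "norm Y \<le> 1 \<Longrightarrow> banach_hom (subs Y)"
  unfolding subs_def by (rule banach_hom_lext) (simp_all add: power_add norm_power_le_1)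

lemma subs_tt [simp]: "subs Y tt = Y"
  by (simp add: subs_def tt_def)

lemma subs_sums: "\<bar>t\<bar> \<le> 1 \<Longrightarrow> (\<lambda>n. coef f n * t ^ n) sums subs t f" for t :: real
  using has_sum_imp_sums[OF lext_has_sum[of "\<lambda>n. t ^ n" 1 f]] norm_power_le_1[of t]
  by (simp add: subs_def)

lemma subs_has_derivative_diffs:
  fixes t :: real
  assumes "\<bar>t\<bar> < 1"
  shows "((\<lambda>t. subs t f) has_real_derivative (\<Sum>n. diffs (coef f) n * t ^ n)) (at t)"
proof (rule has_field_derivative_transform_within_open)
  show "((\<lambda>t. \<Sum>n. coef f n * t ^ n) has_real_derivative (\<Sum>n. diffs (coef f) n * t ^ n)) (at t)"
    by (rule termdiffs_strong[where K = 1]) (use sums_summable[OF subs_sums[of 1 f]] assms in auto)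
  show "open {-1<..<1::real}" "t \<in> {-1<..<1}" using assms by auto
  show "(\<Sum>n. coef f n * x ^ n) = subs x f" if "x \<in> {-1<..<1}" for x
    using subs_sums[of x f] that by (intro sums_unique[symmetric]) auto
qed

lemma subs_differentiable:
  fixes t :: real
  assumes "\<bar>t\<bar> < 1"
  obtains D where "((\<lambda>t. subs t f) has_real_derivative D) (at t)"
  using subs_has_derivative_diffs[OF assms] by blast

lemma coef_mult_tt_avg: "coef (tt * avg id f) (Suc n) = coef f n / (real n + 1)"
proof (rule bounded_linear_eqI[where F = "\<lambda>f. coef (tt * avg id f) (Suc n)"])
  show "bounded_linear (\<lambda>f. coef (tt * avg id f) (Suc n))"
    by (rule bounded_linear_compose[OF bounded_linear_coef
          bounded_linear_compose[OF bounded_linear_mult_right bounded_linear_avg]])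
  show "bounded_linear (\<lambda>f. coef f n / (real n + 1))"
    by (rule bounded_linear_compose[OF bounded_linear_divide bounded_linear_coef])
qed (simp add: tt_def basis_mult coef_simps basis.rep_eq divide_inverse)

lemma subs_primitive:
  fixes t :: real
  assumes "\<bar>t\<bar> < 1"
  shows "((\<lambda>t. subs t (tt * avg id f)) has_real_derivative subs t f) (at t)"
proof -
  have "diffs (coef (tt * avg id f)) = coef f"
    by (simp add: diffs_def coef_mult_tt_avg fun_eq_iff field_simps)
  moreover have "(\<Sum>n. coef f n * t ^ n) = subs t f"
    using subs_sums[of t f] assms by (intro sums_unique[symmetric]) auto
  ultimately show ?thesis using subs_has_derivative_diffs[OF assms, of "tt * avg id f"] by simp
qed

text \<open>The source of the decay O(1/r), since 1 - t = r_h / r. The end point t = 1 lies on the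
  circle of convergence, so the estimate is made on monomials, where Bernoulli's inequality bounds 1
  - t^(n+1) by (n+1)(1 - t), and then summed.\<close>

lemma subs_primitive_at_1:
  fixes t :: real
  assumes "0 \<le> t" "t \<le> 1"
  shows "\<bar>subs 1 (tt * avg id f) - subs t (tt * avg id f)\<bar> \<le> (1 - t) * norm f"
proof -
  interpret A: banach_hom "subs (1::real)" by (rule banach_hom_subs) simp
  interpret B: banach_hom "subs t" by (rule banach_hom_subs) (use assms in simp)
  let ?G = "\<lambda>f. subs 1 (tt * avg id f) - subs t (tt * avg id f)"
  have *: "bounded_linear ?G"
    by (intro bounded_linear_sub bounded_linear_compose[OF A.bounded_linear_axioms]
        bounded_linear_compose[OF B.bounded_linear_axioms]
        bounded_linear_compose[OF bounded_linear_mult_right bounded_linear_avg])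
  have "norm (?G (basis n)) \<le> 1 - t" for n
  proof -
    have "?G (basis n) = (1 - t ^ Suc n) / (real n + 1)"
      by (simp add: A.scaleR B.scaleR basis_mult tt_def) (simp add: subs_def field_simps)
    moreover have "1 - t ^ Suc n \<le> (1 - t) * (real n + 1)"
      using Bernoulli_inequality[of "t - 1" "Suc n"] assms by (simp add: algebra_simps)
    moreover have "t ^ Suc n \<le> 1" using assms by (intro power_le_one)
    ultimately show ?thesis by (simp only:) (simp add: divide_simps)
  qed
  from norm_lext[of "\<lambda>n. ?G (basis n)", OF this, where f = f] show ?thesis
    using bounded_linear_eq_lext[OF *, of f] by simp
qed

text \<open>A Neumann series in \<open>y - y\<^sup>2 / 3\<close> could fail, as its norm may reach
  4/3. Instead (3 - 3y + y^2)(3 + 3y + y^2)(3 + y^2) = 27 + y^6, whose inverse is a Neumann series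
  with ratio at most 1/27. The cofactors have norms at most 7 and 4, giving 28/26 < 2.\<close>

lemma quadratic_inverse:
  fixes y :: "'b::{real_normed_algebra_1,comm_ring_1,banach}"
  assumes "norm y \<le> 1" "l > 0"
  obtains g where "g * (l *\<^sub>R (3 - 3 * y + y\<^sup>2)) = 1" "norm g \<le> 2 / l"
proof -
  define x where "x = - ((1/27) *\<^sub>R y ^ 6)"
  have nx: "norm x \<le> 1/27" using norm_power_le_1[OF assms(1), of 6] by (simp add: x_def)
  then obtain v where v: "(1 - x) * v = 1" "norm v \<le> 1 / (1 - norm x)"
    using neumann_inverse[of x] by force
  have "1 / (1 - norm x) \<le> 1 / (1 - 1/27)" using nx by (intro divide_left_mono) auto
  hence "norm v \<le> 27/26" using v(2) by simp
  define z where "z = y\<^sup>2 + 3 * y + 3"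
  define z' where "z' = y\<^sup>2 + 3"
  have y2: "norm (y\<^sup>2) \<le> 1" by (rule norm_power_le_1[OF assms(1)])
  have nz: "norm z \<le> 7"
  proof -
    have "norm z \<le> norm (y\<^sup>2) + norm (3 * y) + norm (3::'b)"
      unfolding z_def by (meson norm_triangle_ineq norm_triangle_mono order_refl)
    also have "norm (3 * y) \<le> 3 * 1" by (rule norm_mult_le_mult) (use assms in auto)
    finally show ?thesis using y2 by simp
  qed
  have nz': "norm z' \<le> 4"
    using norm_triangle_ineq[of "y\<^sup>2" 3] y2 by (simp add: z'_def)
  have key: "(3 - 3 * y + y\<^sup>2) * (z * z') = 27 + y ^ 6"
    by (simp add: z_def z'_def algebra_simps power2_eq_square eval_nat_numeral)
  have x27: "27 + y ^ 6 = 27 *\<^sub>R (1 - x)"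
    by (simp add: x_def scaleR_add_right) (simp add: scaleR_conv_of_real)
  define g where "g = (1 / (27 * l)) *\<^sub>R (v * (z * z'))"
  show thesis
  proof
    have "g * (l *\<^sub>R (3 - 3 * y + y\<^sup>2)) = (1 / 27) *\<^sub>R (v * ((3 - 3 * y + y\<^sup>2) * (z * z')))"
      using assms by (simp add: g_def algebra_simps)
    also have "\<dots> = v * (1 - x)" unfolding key x27 by simp
    finally show "g * (l *\<^sub>R (3 - 3 * y + y\<^sup>2)) = 1" using v(1) by (simp add: mult.commute)
    have "norm (v * (z * z')) \<le> 27/26 * (7 * 4)"
      by (intro norm_mult_le_mult nz nz' \<open>norm v \<le> 27/26\<close>)
    hence "norm g \<le> 1 / (27 * l) * (27/26 * (7 * 4))"
      using assms unfolding g_def norm_scaleR by (intro mult_mono) auto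
    also have "\<dots> \<le> 2 / l" using assms by (simp add: field_simps)
    finally show "norm g \<le> 2 / l" .
  qed
qed

section \<open>Black holes from fixed points\<close>

locale profile =
  fixes l \<kappa> \<delta> :: real and N :: nat and a :: "nat \<Rightarrow> real" and g0 :: "nat l1" and X :: "nat \<Rightarrow> nat l1"
  assumes l: "l > 0" and N: "N \<ge> 2" and g0: "g0 * (l *\<^sub>R (3 - 3 * tt + tt\<^sup>2)) = 1"
    and ball: "X \<in> pball l N \<delta>"
    and fixpt: "pT (avg id) tt g0 l N (of_real \<kappa>) (of_real \<circ> a) X = X"
begin

definition u where "u j (t::real) = subs t (pu (avg id) tt N (of_real \<circ> a) X j)"
definition w where "w j (t::real) = subs t (X j)"
definition H where "H (t::real) = subs t (pH tt l X)"
definition \<Gamma> where "\<Gamma> (t::real) = (\<Sum>j=1..N-1. (w j t)\<^sup>2)"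
definition P where
  "P (t::real) = (\<Sum>j=1..N. ((u j t)\<^sup>2 - (u (j - 1) t)\<^sup>2 - (real N + 1 - 2 * real j) * \<kappa>)\<^sup>2)"
definition W where "W j (t::real) = \<kappa> - (u j t)\<^sup>2 + ((u (j - 1) t)\<^sup>2 + (u (j + 1) t)\<^sup>2) / 2"
definition eE where "eE = pE (avg id) tt l N (of_real \<kappa>) (of_real \<circ> a) X"
text \<open>The scaled mass; its value (\<kappa> + l) / 2 at t = 0 is the horizon condition.\<close>

definition M where "M (t::real) = (\<kappa> + l) / 2 + subs t (tt * avg id eE)"
definition eQ where "eQ = 2 * (1 - tt) ^ 3 * pG N X"
text \<open>The logarithm of \<open>S\<close> up to an additive constant.\<close>

definition q where "q (t::real) = subs t (tt * avg id eQ)"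
definition eF where "eF j = pF (avg id) tt l N (of_real \<kappa>) (of_real \<circ> a) X j"

lemma hom_subs: "\<bar>t\<bar> \<le> 1 \<Longrightarrow> banach_hom (subs t)" for t :: real
  by (rule banach_hom_subs) simp

lemma subs_simps:
  fixes t :: real
  assumes "\<bar>t\<bar> \<le> 1"
  shows "subs t (x + y) = subs t x + subs t y" "subs t (x - y) = subs t x - subs t y"
    "subs t (- x) = - subs t x" "subs t (c *\<^sub>R x) = c * subs t x"
    "subs t (x * y) = subs t x * subs t y" "subs t (x ^ n) = subs t x ^ n" "subs t 1 = 1"
    "subs t 0 = 0" "subs t (sum f A) = (\<Sum>i\<in>A. subs t (f i))" "subs t (of_real c) = c"
    "subs t (numeral m) = numeral m"
proof -
  interpret banach_hom "subs t" by (rule hom_subs[OF assms])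
  show "subs t (x + y) = subs t x + subs t y" "subs t (x - y) = subs t x - subs t y"
    "subs t (- x) = - subs t x" "subs t (c *\<^sub>R x) = c * subs t x"
    "subs t (x * y) = subs t x * subs t y" "subs t (x ^ n) = subs t x ^ n" "subs t 1 = 1"
    "subs t 0 = 0" "subs t (sum f A) = (\<Sum>i\<in>A. subs t (f i))" "subs t (of_real c) = c"
    "subs t (numeral m) = numeral m"
    using of_real[of "numeral m"] by (simp_all add: add diff neg scaleR mult power one sum of_real)
qed

lemma G_eq: "\<bar>t\<bar> \<le> 1 \<Longrightarrow> subs t (pG N X) = \<Gamma> t"
  by (simp add: pG_def \<Gamma>_def w_def subs_simps)

lemma P_eq: "\<bar>t\<bar> \<le> 1 \<Longrightarrow> subs t (pP (avg id) tt N (of_real \<kappa>) (of_real \<circ> a) X) = P t"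
  by (simp add: pP_def P_def u_def subs_simps)

lemma W_eq: "\<bar>t\<bar> \<le> 1 \<Longrightarrow> subs t (pW (avg id) tt N (of_real \<kappa>) (of_real \<circ> a) X j) = W j t"
  by (simp add: pW_def W_def u_def subs_simps)

lemma E_eq: "\<bar>t\<bar> \<le> 1 \<Longrightarrow> subs t eE = t * H t * \<Gamma> t + P t / 4"
  by (simp add: pE_def eE_def H_def subs_simps G_eq P_eq)

lemma F_eq: "\<bar>t\<bar> \<le> 1 \<Longrightarrow> subs t (eF j) = W j t * u j t + 2 * (1 - t) ^ 3 * (t * H t) * \<Gamma> t * w j t"
  by (simp add: pF_def eF_def H_def u_def w_def subs_simps G_eq W_eq)

lemma Q_eq: "\<bar>t\<bar> \<le> 1 \<Longrightarrow> subs t eQ = 2 * (1 - t) ^ 3 * \<Gamma> t"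
  by (simp add: eQ_def subs_simps G_eq)

lemma u_outside: "\<bar>t\<bar> \<le> 1 \<Longrightarrow> \<not> (1 \<le> j \<and> j < N) \<Longrightarrow> u j t = 0"
  by (auto simp: u_def pu_def subs_simps)

lemma u_inside: "\<bar>t\<bar> \<le> 1 \<Longrightarrow> 1 \<le> j \<Longrightarrow> j < N \<Longrightarrow> u j t = a j + subs t (tt * avg id (X j))"
  by (simp add: u_def pu_def subs_simps)

lemma X_0: "X 0 = (1 - tt)\<^sup>2 * of_real \<kappa> - 2 * (1 - tt) ^ 3 * avg id eE"
proof -
  have "X 0 = pT (avg id) tt g0 l N (of_real \<kappa>) (of_real \<circ> a) X 0" by (simp add: fixpt)
  thus ?thesis by (simp add: pT_def pD_def eE_def)
qed

lemma H_poly: "\<bar>t\<bar> \<le> 1 \<Longrightarrow> H t = l * (3 - 3 * t + t\<^sup>2) + subs t (X 0)"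
  by (simp add: H_def pH_def subs_simps)

text \<open>On the right stands \<open>\<mu> / r\<^sup>2\<close> as a function of 1 - t = r_h / r.
  It vanishes at t = 0 by the choice of \<open>M 0\<close>, and the fixed point equation for
  \<open>X 0\<close> identifies the quotient by \<open>t\<close> with H.\<close>

lemma tH: "t * H t = l + \<kappa> * (1 - t)\<^sup>2 - 2 * M t * (1 - t) ^ 3" if t: "\<bar>t\<bar> \<le> 1"
proof -
  have "M t = (\<kappa> + l) / 2 + t * subs t (avg id eE)" using t by (simp add: M_def subs_simps)
  thus ?thesis using t
    by (simp add: H_poly X_0 subs_simps) (simp add: field_simps power2_eq_square power3_eq_cube)
qed

text \<open>Since \<open>pD\<close> equals \<open>X 0\<close> at the fixed point, the last
  coordinate satisfies g = g0 (1 - X 0 g); multiplying by the inverse of \<open>g0\<close> gives the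
  claim.\<close>

lemma X_N: "X N * pH tt l X = 1"
proof -
  have "X N = pT (avg id) tt g0 l N (of_real \<kappa>) (of_real \<circ> a) X N" by (simp add: fixpt)
  also have "\<dots> = g0 - g0 * (X 0 * X N)"
    using N fun_cong[OF fixpt, of 0] by (simp add: pT_def)
  finally have "X N * (l *\<^sub>R (3 - 3 * tt + tt\<^sup>2)) = (g0 - g0 * (X 0 * X N)) * (l *\<^sub>R (3 - 3 * tt + tt\<^sup>2))"
    by simp
  also have "\<dots> = g0 * (l *\<^sub>R (3 - 3 * tt + tt\<^sup>2)) * (1 - X 0 * X N)" by (simp only: left_diff_distrib right_diff_distrib mult_1_right mult_1_left mult.assoc mult.commute mult.left_commute)
  also have "\<dots> = 1 - X 0 * X N" by (simp only: g0 mult_1_left)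
  finally show ?thesis unfolding pH_def distrib_left by (simp add: mult.commute)
qed

lemma X_j: "pH tt l X * X j = - avg id (eF j)" if "1 \<le> j" "j < N"
proof -
  have "X j = pT (avg id) tt g0 l N (of_real \<kappa>) (of_real \<circ> a) X j" by (simp add: fixpt)
  also have "\<dots> = - (X N * avg id (eF j))" using that by (simp add: pT_def eF_def)
  finally have "pH tt l X * X j = - ((X N * pH tt l X) * avg id (eF j))" by (simp add: mult.left_commute mult.assoc)
  thus ?thesis by (simp add: X_N)
qed

lemma Hw: "\<bar>t\<bar> \<le> 1 \<Longrightarrow> 1 \<le> j \<Longrightarrow> j < N \<Longrightarrow> t * H t * w j t = - subs t (tt * avg id (eF j))"
  using arg_cong[OF X_j[of j], of "\<lambda>z. t * subs t z"] by (simp add: subs_simps H_def w_def mult.assoc)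

text \<open>The quadratic is 1 + (1 - t)(2 - t) > 1 for t < 1, while the perturbation is at most
  \<open>l\<close> in absolute value.\<close>

lemma H_pos: "H t > 0" if "0 \<le> t" "t < 1"
proof -
  have t: "\<bar>t\<bar> \<le> 1" using that by simp
  interpret banach_hom "subs t" by (rule hom_subs[OF t])
  have "norm (X 0) \<le> l" using ball by (simp add: pball_def)
  hence "\<bar>subs t (X 0)\<bar> \<le> l" using contractive[of "X 0"] by simp
  moreover have "3 - 3 * t + t\<^sup>2 = 1 + (1 - t) * (2 - t)" by (simp add: power2_eq_square algebra_simps)
  hence "3 - 3 * t + t\<^sup>2 > 1" using that by (simp add: mult_pos_pos)
  hence "l * (3 - 3 * t + t\<^sup>2) > l * 1" using l by (intro mult_strict_left_mono)
  ultimately show ?thesis by (simp add: H_poly[OF t])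
qed

lemma u_deriv: "(u j has_real_derivative w j t) (at t)" if "\<bar>t\<bar> < 1" "1 \<le> j" "j < N"
proof (rule has_field_derivative_transform_within_open)
  show "((\<lambda>t. a j + subs t (tt * avg id (X j))) has_real_derivative w j t) (at t)"
    unfolding w_def by (auto intro!: derivative_eq_intros subs_primitive that)
  show "open {-1<..<1::real}" "t \<in> {-1<..<1}" using that by auto
qed (use that u_inside in auto)

lemma M_deriv: "(M has_real_derivative t * H t * \<Gamma> t + P t / 4) (at t)" if "\<bar>t\<bar> < 1"
  unfolding M_def[abs_def] using that
  by (auto intro!: derivative_eq_intros subs_primitive simp: E_eq)

lemma q_deriv: "(q has_real_derivative 2 * (1 - t) ^ 3 * \<Gamma> t) (at t)" if "\<bar>t\<bar> < 1"
  unfolding q_def[abs_def] using that subs_primitive[of t eQ] by (simp add: Q_eq)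

text \<open>Differentiate t H w = - (primitive of F), with t H replaced by its expression in
  \<open>M\<close>, whose derivative is known. The \<Gamma>-term of \<open>M'\<close> then cancels
  the second summand of F, leaving the second order equation.\<close>

lemma w_deriv:
  assumes t: "\<bar>t\<bar> < 1" and j: "1 \<le> j" "j < N"
  obtains D where "(w j has_real_derivative D) (at t)"
    "t * H t * D + (6 * M t * (1 - t)\<^sup>2 - 2 * \<kappa> * (1 - t) - (1 - t) ^ 3 * P t / 2) * w j t
       + W j t * u j t = 0"
proof -
  obtain D where D: "(w j has_real_derivative D) (at t)"
    using subs_differentiable[OF t, of "X j"] unfolding w_def[abs_def] by blast
  let ?h = "\<lambda>t. l + \<kappa> * (1 - t)\<^sup>2 - 2 * M t * (1 - t) ^ 3"
  have "((\<lambda>t. ?h t * w j t) has_real_derivative - subs t (eF j)) (at t)"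
  proof (rule has_field_derivative_transform_within_open)
    show "((\<lambda>t. - subs t (tt * avg id (eF j))) has_real_derivative - subs t (eF j)) (at t)"
      by (intro derivative_intros subs_primitive t)
    show "open {-1<..<1::real}" "t \<in> {-1<..<1}" using t by auto
    show "- subs t (tt * avg id (eF j)) = ?h t * w j t" if "t \<in> {-1<..<1}" for t
      using that j Hw[of t j] tH[of t] by (simp add: abs_le_iff)
  qed
  moreover have "((\<lambda>t. ?h t * w j t) has_real_derivative
      (- (2 * \<kappa> * (1 - t)) - 2 * (t * H t * \<Gamma> t + P t / 4) * (1 - t) ^ 3
        + 6 * M t * (1 - t)\<^sup>2) * w j t + ?h t * D) (at t)"
    by (auto intro!: derivative_eq_intros D M_deriv t simp: algebra_simps)
  ultimately have "- subs t (eF j) = (- (2 * \<kappa> * (1 - t)) - 2 * (t * H t * \<Gamma> t + P t / 4) * (1 - t) ^ 3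
        + 6 * M t * (1 - t)\<^sup>2) * w j t + ?h t * D"
    by (rule DERIV_unique)
  moreover have "?h t * D = t * H t * D" using tH[of t] t by simp
  moreover have "subs t (eF j) = W j t * u j t + 2 * (1 - t) ^ 3 * (t * H t) * \<Gamma> t * w j t"
    using t by (simp add: F_eq)
  ultimately show thesis by (intro that[OF D]) (simp only:, simp only: algebra_simps, simp add: algebra_simps)
qed

end

section \<open>Return to the radial variable\<close>

lemma subs_subs:
  fixes \<tau> :: real and Y :: "'i::comm_monoid_add l1"
  assumes \<phi>: "banach_hom \<phi>" and Y: "norm Y \<le> 1"
  shows "\<phi> (subs Y f) = subs (\<phi> Y :: 'b::{real_normed_algebra_1,banach}) f"
proof -
  interpret \<phi>: banach_hom \<phi> by fact
  interpret A: banach_hom "subs Y" by (rule banach_hom_subs[OF Y])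
  have "norm (\<phi> Y) \<le> 1" using \<phi>.contractive[of Y] Y by simp
  then interpret B: banach_hom "subs (\<phi> Y)" by (rule banach_hom_subs)
  show ?thesis
    by (rule bounded_linear_eqI[where F = "\<lambda>f. \<phi> (subs Y f)", OF bounded_linear_compose[OF
          \<phi>.bounded_linear_axioms A.bounded_linear_axioms] B.bounded_linear_axioms])
       (simp add: subs_def \<phi>.power)
qed

lemma taylor_expansion_at_rightI:
  assumes "e > 0" and f: "\<And>r. s \<le> r \<Longrightarrow> r < s + e \<Longrightarrow> f r = subs ((r - s) / e) F"
  shows "taylor_expansion_at_right f s"
  unfolding taylor_expansion_at_right_def
proof (intro exI conjI ballI)
  fix r assume r: "r \<in> {s..<s + e}"
  hence "(\<lambda>n. coef F n * ((r - s) / e) ^ n) sums subs ((r - s) / e) F"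
    using assms(1) by (intro subs_sums) (auto simp: field_simps)
  thus "(\<lambda>n. (coef F n / e ^ n) * (r - s) ^ n) sums f r"
    using r by (simp add: f power_divide)
qed fact

lemma abs_exp_minus_1_le: "\<bar>exp z - 1\<bar> \<le> \<bar>z\<bar> * exp c" if "\<bar>z\<bar> \<le> c" for z :: real
proof -
  have "exp z * (1 - z) \<le> exp z * exp (- z)"
    using exp_ge_add_one_self[of "- z"] by (intro mult_left_mono) auto
  hence "exp z - 1 \<le> z * exp z" by (simp add: algebra_simps flip: exp_add)
  also have "\<dots> \<le> \<bar>z\<bar> * exp c" using that by (intro mult_mono) auto
  finally have "exp z - 1 \<le> \<bar>z\<bar> * exp c" .
  moreover have "\<bar>z\<bar> * 1 \<le> \<bar>z\<bar> * exp c" using that by (intro mult_left_mono) auto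
  moreover have "exp z \<ge> 1 + z" by (rule exp_ge_add_one_self)
  moreover have "- \<bar>z\<bar> \<le> z" by simp
  ultimately show ?thesis by linarith
qed

text \<open>Here \<open>s\<close> is the horizon radius. The signs of \<open>k\<close> and of a_1 -
  a_2 serve nontriviality; the lower bound \<delta> on \<open>a\<close> makes the fields
  positive.\<close>

locale black_hole_profile = profile +
  fixes s k \<Lambda> :: real
  assumes s: "s > 0" and \<kappa>: "\<kappa> = k / s\<^sup>2" and l_eq: "l = - \<Lambda> / 3" and k: "k \<le> 0"
    and \<delta>: "\<delta> > 0" and a: "\<And>j. 1 \<le> j \<Longrightarrow> j < N \<Longrightarrow> a j > \<delta>"
    and a12: "N \<ge> 3 \<Longrightarrow> a 1 > a 2"
begin

lemma k_eq: "k = \<kappa> * s\<^sup>2" and \<Lambda>_eq: "\<Lambda> = - 3 * l"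
  using s by (simp_all add: \<kappa> l_eq)

definition mB where "mB r = s ^ 3 * M (1 - s / r)"
text \<open>Subtracting \<open>q 1\<close> normalises the lapse function to 1 at infinity.\<close>

definition SB where "SB r = exp (q (1 - s / r) - q 1)"
definition \<omega>B where "\<omega>B j r = s * u j (1 - s / r)"

lemma t_range: "r \<ge> s \<Longrightarrow> 0 \<le> 1 - s / r" "r \<ge> s \<Longrightarrow> 1 - s / r < 1" "r \<ge> s \<Longrightarrow> \<bar>1 - s / r\<bar> < 1"
  "r \<ge> s \<Longrightarrow> \<bar>1 - s / r\<bar> \<le> 1"
  using s by (auto simp: field_simps abs_if)

lemma chain: "((\<lambda>r. f (1 - s / r)) has_real_derivative D * (s / r\<^sup>2)) (at r)"
  if "(f has_real_derivative D) (at (1 - s / r))" "r \<ge> s"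
proof (rule DERIV_chain2[where f = f and g = "\<lambda>r. 1 - s / r", OF that(1)])
  show "((\<lambda>r. 1 - s / r) has_real_derivative s / r\<^sup>2) (at r)"
    using s that(2) by (auto intro!: derivative_eq_intros simp: power2_eq_square)
qed

lemma \<mu>_eq: "eym_mu k \<Lambda> mB r = r\<^sup>2 * ((1 - s / r) * H (1 - s / r))" if r: "r \<ge> s"
proof -
  define x where "x = s / r"
  have sx: "s = x * r" "x \<noteq> 0" "r \<noteq> 0" using s r by (auto simp: x_def)
  have "(1 - x) * H (1 - x) = l + \<kappa> * x\<^sup>2 - 2 * M (1 - x) * x ^ 3"
    using tH[of "1 - x"] t_range(4)[OF r] by (simp add: x_def)
  moreover have "eym_mu k \<Lambda> mB r = r\<^sup>2 * (l + \<kappa> * x\<^sup>2 - 2 * M (1 - x) * x ^ 3)"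
    unfolding eym_mu_def mB_def x_def[symmetric] k_eq \<Lambda>_eq
    using sx by (simp add: field_simps power2_eq_square power3_eq_cube)
  ultimately show ?thesis by (simp add: x_def)
qed

lemma \<omega>B_eq: "eym_p k N \<omega>B r = (s / r) ^ 4 * P (1 - s / r) / 4" if r: "r \<ge> s"
proof -
  have "((\<omega>B j r)\<^sup>2 - (\<omega>B (j - 1) r)\<^sup>2 - k * (real N + 1 - 2 * real j))\<^sup>2 =
      s ^ 4 * ((u j (1 - s / r))\<^sup>2 - (u (j - 1) (1 - s / r))\<^sup>2 - (real N + 1 - 2 * real j) * \<kappa>)\<^sup>2" for j
  proof -
    have "(\<omega>B j r)\<^sup>2 - (\<omega>B (j - 1) r)\<^sup>2 - k * (real N + 1 - 2 * real j) =
      s\<^sup>2 * ((u j (1 - s / r))\<^sup>2 - (u (j - 1) (1 - s / r))\<^sup>2 - (real N + 1 - 2 * real j) * \<kappa>)"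
      by (simp add: \<omega>B_def k_eq algebra_simps)
    thus ?thesis by (simp add: power_mult_distrib flip: power_mult)
  qed
  thus ?thesis
    by (simp add: eym_p_def P_def sum_distrib_left[symmetric] power_divide)
qed

lemma W_eym: "eym_W k \<omega>B j r = s\<^sup>2 * W j (1 - s / r)"
  by (simp add: eym_W_def W_def \<omega>B_def k_eq field_simps)

definition \<omega>B' where "\<omega>B' j r = s * (w j (1 - s / r) * (s / r\<^sup>2))"

lemma G_eym: "eym_G N \<omega>B' r = (s / r) ^ 4 * \<Gamma> (1 - s / r)"
proof -
  have "(\<omega>B' j r)\<^sup>2 = (s / r) ^ 4 * (w j (1 - s / r))\<^sup>2" for j
    by (simp add: \<omega>B'_def power_mult_distrib power_divide eval_nat_numeral mult_ac)
  thus ?thesis by (simp add: eym_G_def \<Gamma>_def sum_distrib_left)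
qed

lemma \<omega>B_deriv: "(\<omega>B j has_real_derivative \<omega>B' j r) (at r)" if "r \<ge> s" "1 \<le> j" "j < N"
  unfolding \<omega>B_def[abs_def] \<omega>B'_def
  by (intro DERIV_cmult chain u_deriv t_range that)

lemma mB_deriv:
  assumes r: "r \<ge> s"
  shows "(mB has_real_derivative eym_mu k \<Lambda> mB r * eym_G N \<omega>B' r + r\<^sup>2 * eym_p k N \<omega>B r) (at r)"
proof -
  define t where "t = 1 - s / r"
  have "(mB has_real_derivative s ^ 3 * ((t * H t * \<Gamma> t + P t / 4) * (s / r\<^sup>2))) (at r)"
    unfolding mB_def[abs_def] t_def by (intro DERIV_cmult chain M_deriv t_range r)
  also have "s ^ 3 * ((t * H t * \<Gamma> t + P t / 4) * (s / r\<^sup>2)) =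
      (s ^ 3 * (s / r\<^sup>2)) * (t * H t * \<Gamma> t + P t / 4)" by simp
  also have "s ^ 3 * (s / r\<^sup>2) = r\<^sup>2 * (s / r) ^ 4"
    using s r by (simp add: power_divide eval_nat_numeral)
  also have "r\<^sup>2 * (s / r) ^ 4 * (t * H t * \<Gamma> t + P t / 4) =
      r\<^sup>2 * (t * H t) * ((s / r) ^ 4 * \<Gamma> t) + r\<^sup>2 * ((s / r) ^ 4 * P t / 4)"
    by (simp add: algebra_simps)
  finally show ?thesis by (simp add: \<mu>_eq[OF r] \<omega>B_eq[OF r] G_eym t_def)
qed

lemma SB_deriv:
  assumes r: "r \<ge> s"
  shows "(SB has_real_derivative SB r * (2 * eym_G N \<omega>B' r / r)) (at r)"
proof -
  define t where "t = 1 - s / r"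
  have "(SB has_real_derivative SB r * (2 * (1 - t) ^ 3 * \<Gamma> t * (s / r\<^sup>2))) (at r)"
    unfolding SB_def[abs_def] t_def
    by (rule DERIV_fun_exp)
       (use chain[OF q_deriv[OF t_range(3)[OF r]] r] in \<open>auto intro!: derivative_eq_intros\<close>)
  also have "2 * (1 - t) ^ 3 * \<Gamma> t * (s / r\<^sup>2) = 2 * eym_G N \<omega>B' r / r"
    using s r unfolding G_eym t_def by (simp add: field_simps eval_nat_numeral)
  finally show ?thesis .
qed

lemma \<omega>B'_deriv:
  assumes r: "r \<ge> s" and j: "1 \<le> j" "j < N"
  obtains D where "(\<omega>B' j has_real_derivative D) (at r)"
    "r\<^sup>2 * eym_mu k \<Lambda> mB r * D
       + (2 * mB r - 2 * r ^ 3 * eym_p k N \<omega>B r - 2 * \<Lambda> * r ^ 3 / 3) * \<omega>B' j r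
       + eym_W k \<omega>B j r * \<omega>B j r = 0"
proof -
  define x where "x = s / r"
  have r0: "r > 0" using s r by simp
  have sx: "s = x * r" using r0 by (simp add: x_def)
  define t where "t = 1 - x"
  have tx: "1 - t = x" by (simp add: t_def)
  obtain D where D: "(w j has_real_derivative D) (at t)"
    and ode: "t * H t * D + (6 * M t * x\<^sup>2 - 2 * \<kappa> * x - x ^ 3 * P t / 2) * w j t + W j t * u j t = 0"
    using w_deriv[OF t_range(3)[OF r] j] unfolding t_def x_def by auto
  have h: "t * H t = l + \<kappa> * x\<^sup>2 - 2 * M t * x ^ 3"
    using tH[of t] t_range(4)[OF r] by (simp add: t_def x_def)
  have 1: "(\<omega>B' j has_real_derivative s * (D * (s / r\<^sup>2) * (s / r\<^sup>2) - w j t * (2 * s / r ^ 3))) (at r)"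
  proof -
    have "((\<lambda>r. s / r\<^sup>2) has_real_derivative - (2 * s / r ^ 3)) (at r)"
      using r0 by (auto intro!: derivative_eq_intros simp: field_simps eval_nat_numeral)
    from DERIV_cmult[OF DERIV_mult[OF chain[OF D[unfolded t_def x_def] r] this], of s]
    show ?thesis unfolding \<omega>B'_def[abs_def] by (simp add: t_def x_def algebra_simps)
  qed
  have d: "s * (D * (s / r\<^sup>2) * (s / r\<^sup>2) - w j t * (2 * s / r ^ 3)) = (x ^ 3 * D - 2 * x\<^sup>2 * w j t) / r"
    using r0 by (simp add: sx field_simps eval_nat_numeral)
  have w': "\<omega>B' j r = x\<^sup>2 * w j t"
    using r0 by (simp add: \<omega>B'_def t_def x_def power2_eq_square)
  define h where "h = t * H t"
  define p where "p = P t / 4"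
  have P: "x ^ 3 * P t / 2 = 2 * x ^ 3 * p" "x ^ 4 * P t / 4 = x ^ 4 * p" by (simp_all add: p_def)
  have "r\<^sup>2 * (r\<^sup>2 * h) * ((x ^ 3 * D - 2 * x\<^sup>2 * w j t) / r) = r ^ 3 * h * (x ^ 3 * D - 2 * x\<^sup>2 * w j t)"
    using r0 by (simp add: power2_eq_square power3_eq_cube)
  \<comment> \<open>The radial equation is the equation in \<open>t\<close> plus a multiple of the
    relation defining t H; that multiple, - 2 w, stems from differentiating
    \<open>s / r\<^sup>2\<close>.\<close>
  moreover have "r ^ 3 * h * (x ^ 3 * D - 2 * x\<^sup>2 * w j t)
      + (2 * ((x * r) ^ 3 * M t) - 2 * r ^ 3 * (x ^ 4 * p) + 2 * l * r ^ 3) * (x\<^sup>2 * w j t)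
      + (x * r)\<^sup>2 * W j t * (x * r * u j t)
     = r ^ 3 * x\<^sup>2 * (x * (h * D + (6 * M t * x\<^sup>2 - 2 * \<kappa> * x - 2 * x ^ 3 * p) * w j t + W j t * u j t)
         - 2 * w j t * (h - (l + \<kappa> * x\<^sup>2 - 2 * M t * x ^ 3)))"
    by algebra
  ultimately have "r\<^sup>2 * (r\<^sup>2 * h) * ((x ^ 3 * D - 2 * x\<^sup>2 * w j t) / r)
      + (2 * (s ^ 3 * M t) - 2 * r ^ 3 * (x ^ 4 * P t / 4) + 2 * l * r ^ 3) * (x\<^sup>2 * w j t)
      + s\<^sup>2 * W j t * (s * u j t)
     = r ^ 3 * x\<^sup>2 * (x * (h * D + (6 * M t * x\<^sup>2 - 2 * \<kappa> * x - x ^ 3 * P t / 2) * w j t + W j t * u j t)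
         - 2 * w j t * (h - (l + \<kappa> * x\<^sup>2 - 2 * M t * x ^ 3)))"
    unfolding P sx by (simp only:)
  also have "\<dots> = 0" unfolding h_def ode by (simp add: h)
  finally have "r\<^sup>2 * eym_mu k \<Lambda> mB r * (s * (D * (s / r\<^sup>2) * (s / r\<^sup>2) - w j t * (2 * s / r ^ 3)))
       + (2 * mB r - 2 * r ^ 3 * eym_p k N \<omega>B r - 2 * \<Lambda> * r ^ 3 / 3) * \<omega>B' j r
       + eym_W k \<omega>B j r * \<omega>B j r = 0"
    unfolding d w' \<mu>_eq[OF r] \<omega>B_eq[OF r] W_eym mB_def \<omega>B_def
    unfolding x_def[symmetric] t_def[symmetric] h_def l_eq by simp
  with 1 show thesis by (rule that)
qed

lemma solution: "eym_solution_on k N \<Lambda> {s..} mB SB \<omega>B"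
  unfolding eym_solution_on_def
proof (intro exI ballI conjI)
  fix r assume "r \<in> {s..}"
  hence r: "r \<ge> s" by simp
  show "(mB has_real_derivative eym_mu k \<Lambda> mB r * eym_G N \<omega>B' r + r\<^sup>2 * eym_p k N \<omega>B r) (at r within {s..})"
    using mB_deriv[OF r] by (rule has_field_derivative_at_within)
  show "(SB has_real_derivative SB r * (2 * eym_G N \<omega>B' r / r)) (at r within {s..})"
    using SB_deriv[OF r] by (rule has_field_derivative_at_within)
  show "SB r * (2 * eym_G N \<omega>B' r / r) / SB r = 2 * eym_G N \<omega>B' r / r" by (simp add: SB_def)
  show "\<omega>B 0 r = 0" "\<omega>B N r = 0" "SB r > 0"
    using t_range(4)[OF r] by (simp_all add: \<omega>B_def u_outside SB_def)
  show "(\<omega>B j has_real_derivative \<omega>B' j r) (at r within {s..})" if "j \<in> {1..N-1}" for j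
    by (rule has_field_derivative_at_within[OF \<omega>B_deriv[OF r]]) (use that N in auto)
  fix j assume "j \<in> {1..N-1}"
  hence "1 \<le> j" "j < N" using N by auto
  from \<omega>B'_deriv[OF r this] obtain D where D: "(\<omega>B' j has_real_derivative D) (at r)"
    "r\<^sup>2 * eym_mu k \<Lambda> mB r * D
       + (2 * mB r - 2 * r ^ 3 * eym_p k N \<omega>B r - 2 * \<Lambda> * r ^ 3 / 3) * \<omega>B' j r
       + eym_W k \<omega>B j r * \<omega>B j r = 0" by blast
  \<comment> \<open>The second derivative was obtained separately at each \<open>j\<close> and
    \<open>r\<close>; \<open>deriv\<close> collects the values into a single witness.\<close>
  have "deriv (\<omega>B' j) r = D" by (rule DERIV_imp_deriv[OF D(1)])
  with D show "(\<omega>B' j has_real_derivative (\<lambda>j. deriv (\<omega>B' j)) j r) (at r within {s..})"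
    "r\<^sup>2 * eym_mu k \<Lambda> mB r * (\<lambda>j. deriv (\<omega>B' j)) j r
       + (2 * mB r - 2 * r ^ 3 * eym_p k N \<omega>B r - 2 * \<Lambda> * r ^ 3 / 3) * \<omega>B' j r
       + eym_W k \<omega>B j r * \<omega>B j r = 0"
    by (simp_all add: has_field_derivative_at_within)
qed (rule refl)

text \<open>With r = s (1 + \<tau>/2) one has 1 - s/r = (\<tau>/2) / (1 + \<tau>/2). As a series in
  \<tau> this has norm at most (1/2) / (1 - 1/2) = 1, so it may be substituted for \<open>t\<close>;
  this dictates the radius s/2.\<close>

lemma substitution:
  obtains Y :: "nat l1" where "norm Y \<le> 1"
    "\<And>r. s \<le> r \<Longrightarrow> r < s + s / 2 \<Longrightarrow> subs ((r - s) / (s / 2)) Y = 1 - s / r"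
proof -
  have n: "norm (- ((1/2) *\<^sub>R tt)) = 1/2" by (simp add: tt_def)
  obtain v where v: "(1 - (- ((1/2) *\<^sub>R tt))) * v = 1" "norm v \<le> 1 / (1 - norm (- ((1/2) *\<^sub>R tt)))"
    using neumann_inverse[of "- ((1/2) *\<^sub>R tt)"] n by auto
  show thesis
  proof
    have "norm ((1/2) *\<^sub>R tt * v) \<le> (1/2) * 2"
      by (rule norm_mult_le_mult) (use v(2) n in \<open>auto simp: tt_def\<close>)
    thus "norm ((1/2) *\<^sub>R tt * v) \<le> 1" by simp
    fix r assume r: "s \<le> r" "r < s + s / 2"
    define \<tau> where "\<tau> = (r - s) / (s / 2)"
    have \<tau>: "0 \<le> \<tau>" "\<tau> < 1" using r s by (auto simp: \<tau>_def field_simps)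
    have rs: "r = s * (1 + \<tau> / 2)" using s by (simp add: \<tau>_def field_simps)
    interpret banach_hom "subs \<tau>" by (rule banach_hom_subs) (use \<tau> in simp)
    have "subs \<tau> ((1 - (- ((1/2) *\<^sub>R tt))) * v) = 1" by (simp only: v one)
    hence "(1 + \<tau> / 2) * subs \<tau> v = 1" by (simp add: mult add scaleR one)
    moreover from this have "subs \<tau> v = 1 / (1 + \<tau> / 2)"
      using \<tau> by (subst nonzero_eq_divide_eq) (auto simp: mult.commute)
    hence "s / r = subs \<tau> v" using s by (simp add: rs)
    ultimately show "subs ((r - s) / (s / 2)) ((1/2) *\<^sub>R tt * v) = 1 - s / r"
      unfolding \<tau>_def[symmetric] using \<tau> by (simp add: mult scaleR algebra_simps)
  qed
qed

lemma taylor: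
  "taylor_expansion_at_right mB s" "taylor_expansion_at_right SB s" "taylor_expansion_at_right (\<omega>B j) s"
proof -
  obtain Y :: "nat l1" where Y: "norm Y \<le> 1"
    and Yr: "\<And>r. s \<le> r \<Longrightarrow> r < s + s / 2 \<Longrightarrow> subs ((r - s) / (s / 2)) Y = 1 - s / r"
    using substitution by blast
  have s2: "s / 2 > 0" using s by simp
  have hom: "banach_hom (subs ((r - s) / (s / 2)))" if "s \<le> r" "r < s + s / 2" for r
    by (rule banach_hom_subs) (use that s in \<open>simp add: field_simps\<close>)
  have ss: "subs ((r - s) / (s / 2)) (subs Y f) = subs (1 - s / r) f"
    if r: "s \<le> r" "r < s + s / 2" for r f
    by (simp only: subs_subs[OF hom[OF r] Y] Yr[OF r])
  show "taylor_expansion_at_right mB s"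
  proof (rule taylor_expansion_at_rightI[OF s2])
    fix r assume r: "s \<le> r" "r < s + s / 2"
    interpret banach_hom "subs ((r - s) / (s / 2))" by (rule hom[OF r])
    show "mB r = subs ((r - s) / (s / 2)) (s ^ 3 *\<^sub>R (of_real ((\<kappa> + l) / 2) + subs Y (tt * avg id eE)))"
      unfolding scaleR add ss[OF r] of_real by (simp add: mB_def M_def)
  qed
  show "taylor_expansion_at_right SB s"
  proof (rule taylor_expansion_at_rightI[OF s2])
    fix r assume r: "s \<le> r" "r < s + s / 2"
    interpret banach_hom "subs ((r - s) / (s / 2))" by (rule hom[OF r])
    show "SB r = subs ((r - s) / (s / 2)) (exp (subs Y (tt * avg id eQ) - of_real (q 1)))"
      unfolding banach_hom_exp[OF hom[OF r]] diff ss[OF r] of_real by (simp add: SB_def q_def)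
  qed
  show "taylor_expansion_at_right (\<omega>B j) s"
  proof (rule taylor_expansion_at_rightI[OF s2])
    fix r assume r: "s \<le> r" "r < s + s / 2"
    interpret banach_hom "subs ((r - s) / (s / 2))" by (rule hom[OF r])
    show "\<omega>B j r = subs ((r - s) / (s / 2)) (s *\<^sub>R subs Y (pu (avg id) tt N (of_real \<circ> a) X j))"
      unfolding scaleR add ss[OF r] by (simp add: \<omega>B_def u_def)
  qed
qed

lemma bigo_1_over:
  assumes "\<And>r. r \<ge> s \<Longrightarrow> \<bar>f r\<bar> \<le> c * (s / r)"
  shows "f \<in> O[at_top](\<lambda>r. 1 / r)"
proof (rule landau_o.bigI[where c = "\<bar>c\<bar> * s + 1"])
  show "\<forall>\<^sub>F r in at_top. norm (f r) \<le> (\<bar>c\<bar> * s + 1) * norm (1 / r)"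
    using eventually_ge_at_top[of s]
  proof eventually_elim
    case (elim r)
    have "norm (f r) \<le> c * (s / r)" using assms[OF elim] by simp
    also have "\<dots> \<le> (\<bar>c\<bar> * s + 1) * (1 / r)"
      using elim s by (auto intro!: divide_right_mono mult_right_mono add_increasing2)
    finally show ?case using elim s by simp
  qed
qed (use s in \<open>auto intro!: add_nonneg_pos\<close>)

lemma \<omega>B_pos: "\<omega>B j r > 0" if r: "r \<ge> s" and j: "1 \<le> j" "j < N"
proof -
  define t where "t = 1 - s / r"
  have t: "0 \<le> t" "t < 1" using t_range[OF r] by (auto simp: t_def)
  interpret banach_hom "subs t" by (rule hom_subs) (use t in simp)
  have "\<bar>subs t (tt * avg id (X j))\<bar> = t * \<bar>subs t (avg id (X j))\<bar>"
    using t by (simp add: mult abs_mult)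
  also have "\<dots> \<le> 1 * \<delta>"
  proof (rule mult_mono)
    have "\<bar>subs t (avg id (X j))\<bar> \<le> norm (X j)"
      using contractive[of "avg id (X j)"] norm_avg_le[of id "X j"] by simp
    also have "\<dots> \<le> \<delta>" using ball j by (simp add: pball_def)
    finally show "\<bar>subs t (avg id (X j))\<bar> \<le> \<delta>" .
  qed (use t in auto)
  finally have "u j t > 0" using u_inside[of t j] a[OF j] j t by simp
  thus ?thesis using s by (simp add: \<omega>B_def t_def)
qed

lemma \<omega>B_horizon: "\<omega>B j s = s * a j" if j: "1 \<le> j" "j < N"
  using s j by (simp add: \<omega>B_def u_inside subs_simps)

lemma mB_horizon: "2 * mB s = k * s - \<Lambda> * s ^ 3 / 3"
  using s by (simp add: mB_def M_def subs_simps k_eq \<Lambda>_eq field_simps power2_eq_square power3_eq_cube)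

lemma black_hole: "eym_black_hole k N \<Lambda> s mB SB \<omega>B"
  unfolding eym_black_hole_def
proof (intro conjI)
  show "s > 0" by (rule s)
  show "eym_solution_on k N \<Lambda> {s..} mB SB \<omega>B" by (rule solution)
  show "eym_mu k \<Lambda> mB s = 0" using s by (simp add: \<mu>_eq)
  show "\<exists>d>0. (eym_mu k \<Lambda> mB has_real_derivative d) (at s within {s..})"
  proof (intro exI conjI)
    show "s * H 0 > 0" using s H_pos[of 0] by simp
    obtain D where "(H has_real_derivative D) (at 0)"
      using subs_differentiable[of 0 "pH tt l X"] unfolding H_def[abs_def] by auto
    hence "((\<lambda>t. t * H t) has_real_derivative H 0) (at (1 - s / s))"
      using s by (auto intro!: derivative_eq_intros)
    from chain[OF this]
    have *: "((\<lambda>r. (1 - s / r) * H (1 - s / r)) has_real_derivative H 0 * (s / s\<^sup>2)) (at s)" by simp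
    have "((\<lambda>r. r\<^sup>2 * ((1 - s / r) * H (1 - s / r))) has_real_derivative s * H 0) (at s)"
      using DERIV_mult[OF DERIV_power[OF DERIV_ident, of 2] *] s by (simp add: power2_eq_square mult.commute)
    \<comment> \<open>The formula for \<mu> is available only for r at least \<open>s\<close>, so
      the derivative is made one-sided before the functions are exchanged.\<close>
    hence "((\<lambda>r. r\<^sup>2 * ((1 - s / r) * H (1 - s / r))) has_real_derivative s * H 0) (at s within {s..})"
      by (rule has_field_derivative_at_within)
    thus "(eym_mu k \<Lambda> mB has_real_derivative s * H 0) (at s within {s..})"
      by (rule has_field_derivative_transform_within[where d = 1]) (auto simp: \<mu>_eq)
  qed
  show "\<forall>r>s. eym_mu k \<Lambda> mB r > 0"
  proof (intro allI impI)
    fix r assume r: "r > s"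
    hence "1 - s / r > 0" using s by (simp add: field_simps)
    thus "eym_mu k \<Lambda> mB r > 0" using H_pos[of "1 - s / r"] t_range[of r] r s by (simp add: \<mu>_eq)
  qed
  have near: "\<bar>subs (1 - s / r) (tt * avg id f) - subs 1 (tt * avg id f)\<bar> \<le> norm f * (s / r)"
    if "r \<ge> s" for f r
    using subs_primitive_at_1[of "1 - s / r" f] t_range[OF that] by (simp add: abs_minus_commute mult.commute)
  show "\<exists>m. (\<lambda>r. mB r - m) \<in> O[at_top](\<lambda>r. 1 / r)"
  proof (intro exI bigo_1_over)
    fix r assume r: "r \<ge> s"
    have "mB r - s ^ 3 * M 1 = s ^ 3 * (subs (1 - s / r) (tt * avg id eE) - subs 1 (tt * avg id eE))"
      by (simp add: mB_def M_def algebra_simps)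
    also have "\<bar>\<dots>\<bar> \<le> s ^ 3 * (norm eE * (s / r))"
      unfolding abs_mult using s near[OF r] by (intro mult_mono) auto
    finally show "\<bar>mB r - s ^ 3 * M 1\<bar> \<le> (s ^ 3 * norm eE) * (s / r)" by (simp add: mult.assoc)
  qed
  show "(\<lambda>r. SB r - 1) \<in> O[at_top](\<lambda>r. 1 / r)"
  proof (rule bigo_1_over)
    fix r assume r: "r \<ge> s"
    have *: "\<bar>q (1 - s / r) - q 1\<bar> \<le> norm eQ * (s / r)" unfolding q_def by (rule near[OF r])
    also have "\<dots> \<le> norm eQ * 1" using r s by (intro mult_left_mono) auto
    finally have "\<bar>SB r - 1\<bar> \<le> \<bar>q (1 - s / r) - q 1\<bar> * exp (norm eQ)"
      unfolding SB_def by (intro abs_exp_minus_1_le) simp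
    also have "\<dots> \<le> (norm eQ * (s / r)) * exp (norm eQ)" by (intro mult_right_mono *) simp
    finally show "\<bar>SB r - 1\<bar> \<le> (norm eQ * exp (norm eQ)) * (s / r)" by (simp add: mult_ac)
  qed
  show "\<forall>j\<in>{1..N-1}. \<exists>w. (\<lambda>r. \<omega>B j r - w) \<in> O[at_top](\<lambda>r. 1 / r)"
  proof (intro ballI exI bigo_1_over)
    fix j r assume "j \<in> {1..N-1}" and r: "r \<ge> s"
    hence j: "1 \<le> j" "j < N" using N by auto
    have "\<omega>B j r - s * u j 1 = s * (subs (1 - s / r) (tt * avg id (X j)) - subs 1 (tt * avg id (X j)))"
      using j t_range[OF r] by (simp add: \<omega>B_def u_inside algebra_simps)
    also have "\<bar>\<dots>\<bar> \<le> s * (norm (X j) * (s / r))"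
      unfolding abs_mult using s near[OF r] by (intro mult_mono) auto
    finally show "\<bar>\<omega>B j r - s * u j 1\<bar> \<le> (s * norm (X j)) * (s / r)" by (simp add: mult.assoc)
  qed
qed (auto intro: taylor)

lemma nodeless: "nodeless N s \<omega>B"
  using \<omega>B_pos N unfolding nodeless_def by force

text \<open>At t = 0 the factor t H kills the second derivative. If \<open>w 1 0\<close> vanished,
  the equation would leave W_1 a_1 = 0; but W_1 = \<kappa> - a_1^2 + a_2^2 / 2 is negative because
  \<kappa> is at most 0 and a_1 > a_2 > 0.\<close>

lemma w_horizon: "w 1 0 \<noteq> 0" if "N \<ge> 3"
proof
  assume w0: "w 1 0 = 0"
  obtain D where "0 * H 0 * D + (6 * M 0 * (1 - 0)\<^sup>2 - 2 * \<kappa> * (1 - 0) - (1 - 0) ^ 3 * P 0 / 2) * w 1 0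
       + W 1 0 * u 1 0 = 0"
    using w_deriv[of 0 1] N by auto
  moreover have u: "u 1 0 = a 1" "u 2 0 = a 2" "u 0 0 = 0"
    using that by (simp_all add: u_inside u_outside subs_simps)
  ultimately have "W 1 0 = 0" using w0 a[of 1] \<delta> that by simp
  moreover have "W 1 0 = \<kappa> - (u 1 0)\<^sup>2 + ((u 0 0)\<^sup>2 + (u 2 0)\<^sup>2) / 2" by (simp add: W_def numeral_2_eq_2)
  ultimately have "\<kappa> - (a 1)\<^sup>2 + (a 2)\<^sup>2 / 2 = 0" unfolding u by simp
  moreover have "\<kappa> \<le> 0" using k s by (simp add: \<kappa> divide_nonpos_pos)
  moreover have "(a 2)\<^sup>2 < (a 1)\<^sup>2" using a12[OF that] a[of 2] \<delta> that by (intro power_strict_mono) auto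
  ultimately show False using zero_le_power2[of "a 2"] by linarith
qed

lemma nontrivial: "nontrivial_gauge_field N s \<omega>B"
proof (cases "N = 2")
  case True
  thus ?thesis using \<omega>B_pos[of s 1] by (auto simp: nontrivial_gauge_field_def)
next
  case False
  hence N3: "N \<ge> 3" using N by simp
  have "\<not> (\<exists>c. \<forall>r\<ge>s. \<omega>B 1 r = c)"
  proof
    assume "\<exists>c. \<forall>r\<ge>s. \<omega>B 1 r = c"
    then obtain c where c: "\<And>r. r \<ge> s \<Longrightarrow> \<omega>B 1 r = c" by blast
    have "(\<omega>B 1 has_real_derivative \<omega>B' 1 s) (at s within {s..})"
      by (rule has_field_derivative_at_within[OF \<omega>B_deriv]) (use N3 in auto)
    moreover have "(\<omega>B 1 has_real_derivative 0) (at s within {s..})"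
      by (rule has_field_derivative_transform_within[where d = 1 and f = "\<lambda>_. c"]) (use c in auto)
    moreover have "at s within {s..} \<noteq> bot" by (simp add: at_within_Ici_at_right)
    ultimately have "\<omega>B' 1 s = 0"
      using vector_derivative_unique_within
      unfolding has_real_derivative_iff_has_vector_derivative by blast
    thus False using w_horizon[OF N3] s by (simp add: \<omega>B'_def)
  qed
  \<comment> \<open>On the horizon an embedded field has a_1^2 : a_2^2 = (N - 1) : 2 (N - 2), up to
    a common factor that may be 0. For N at least 3 this gives a_1^2 at most a_2^2, against a_1 >
    a_2 > 0.\<close>
  moreover have "\<not> embedded_su2 N s \<omega>B"
  proof
    assume "embedded_su2 N s \<omega>B"
    then obtain v \<sigma> where \<sigma>: "\<And>j. j \<in> {1..N-1} \<Longrightarrow> \<sigma> j \<in> {-1, 1::real}"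
      and eq: "\<And>j. j \<in> {1..N-1} \<Longrightarrow> \<omega>B j s = \<sigma> j * sqrt (real j * (real N - real j)) * v s"
      unfolding embedded_su2_def by blast
    have sq: "(s * a j)\<^sup>2 = real j * (real N - real j) * (v s)\<^sup>2" if "j \<in> {1, 2}" for j
    proof -
      have j: "j \<in> {1..N-1}" "1 \<le> j" "j < N" using that N3 by auto
      have "(\<sigma> j)\<^sup>2 = 1" using \<sigma>[OF j(1)] by auto
      thus ?thesis using eq[OF j(1)] \<omega>B_horizon[OF j(2,3)] j(3) by (simp add: power_mult_distrib)
    qed
    have "s * a 2 < s * a 1" using a12[OF N3] s by simp
    hence "(s * a 2)\<^sup>2 < (s * a 1)\<^sup>2"
      using a[of 2] \<delta> N3 s by (intro power_strict_mono) auto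
    hence "2 * (real N - 2) * (v s)\<^sup>2 < (real N - 1) * (v s)\<^sup>2" using sq[of 1] sq[of 2] by simp
    moreover have "(real N - 1) * (v s)\<^sup>2 \<le> 2 * (real N - 2) * (v s)\<^sup>2"
      using N3 by (intro mult_right_mono) auto
    ultimately show False by simp
  qed
  ultimately show ?thesis using False N3 by (force simp: nontrivial_gauge_field_def)
qed

end

section \<open>Analytic dependence on the horizon parameters\<close>

text \<open>The monomial with exponent \<open>\<alpha>\<close> evaluated at \<open>z\<close>. Only
  the variables in \<open>I\<close> count, although multi-indices here are functions on the whole
  type.\<close>

definition chr :: "'i set \<Rightarrow> ('i \<Rightarrow> real) \<Rightarrow> ('i \<Rightarrow> nat) \<Rightarrow> real" where
  "chr I z \<alpha> = (\<Prod>i\<in>I. z i ^ \<alpha> i)"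

lemma chr_add: "chr I z (\<alpha> + \<beta>) = chr I z \<alpha> * chr I z \<beta>"
  by (simp add: chr_def power_add prod.distrib)

lemma chr_0 [simp]: "chr I z 0 = 1"
  by (simp add: chr_def)

lemma abs_chr_le: "(\<And>i. i \<in> I \<Longrightarrow> \<bar>z i\<bar> \<le> 1) \<Longrightarrow> \<bar>chr I z \<alpha>\<bar> \<le> 1"
  by (auto simp: chr_def abs_prod power_abs intro!: prod_le_1 power_le_one)

definition unit_index :: "'i \<Rightarrow> 'i \<Rightarrow> nat" where
  "unit_index i = (\<lambda>j. if j = i then 1 else 0)"

lemma chr_unit_index: "finite I \<Longrightarrow> i \<in> I \<Longrightarrow> chr I z (unit_index i) = z i"
  by (simp add: chr_def unit_index_def if_distrib[of "power _"] prod.delta cong: if_cong)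

definition evm :: "'i set \<Rightarrow> ('i \<Rightarrow> real) \<Rightarrow> ('i \<Rightarrow> nat) l1 \<Rightarrow> real" where
  "evm I z = lext (chr I z)"

lemma banach_hom_evm: "(\<And>i. i \<in> I \<Longrightarrow> \<bar>z i\<bar> \<le> 1) \<Longrightarrow> banach_hom (evm I z)"
  unfolding evm_def by (rule banach_hom_lext) (simp_all add: chr_add abs_chr_le)

text \<open>Evaluation of an absolutely summable series at displacements rescaled by
  \<open>e\<close> is a power series converging on the whole cube of half-width \<open>e\<close>,
  including points outside \<open>D\<close>.\<close>

lemma real_analytic_onI:
  assumes I: "finite I"
    and D: "\<And>p. p \<in> D \<Longrightarrow> \<exists>e>0. \<exists>F. \<forall>q\<in>D. (\<forall>i\<in>I. \<bar>q i - p i\<bar> < e) \<longrightarrow>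
              f q = evm I (\<lambda>i. (q i - p i) / e) F"
  shows "real_analytic_on I D f"
  unfolding real_analytic_on_def
proof
  fix p assume "p \<in> D"
  then obtain e F where e: "e > 0" and F: "\<And>q. q \<in> D \<Longrightarrow> (\<forall>i\<in>I. \<bar>q i - p i\<bar> < e) \<Longrightarrow>
      f q = evm I (\<lambda>i. (q i - p i) / e) F"
    using D by blast
  \<comment> \<open>Monomials that agree on \<open>I\<close> are merged, so that the coefficients
    live on the extensional multi-indices required by \<open>real_analytic_on\<close>.\<close>
  define G where "G = lext (\<lambda>\<alpha>. basis (restrict \<alpha> I)) F"
  define b where "b \<alpha> = coef G \<alpha> / e ^ (\<Sum>i\<in>I. \<alpha> i)" for \<alpha>
  have bl: "bounded_linear (lext (\<lambda>\<alpha>. basis (restrict \<alpha> I) :: ('a \<Rightarrow> nat) l1))"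
    by (rule bounded_linear_lext[where K = 1]) simp
  have outside: "coef G \<beta> = 0" if "\<beta> \<notin> I \<rightarrow>\<^sub>E UNIV" for \<beta>
    unfolding G_def
  proof (rule bounded_linear_eqI[where F = "\<lambda>F. coef (lext (\<lambda>\<alpha>. basis (restrict \<alpha> I)) F) \<beta>" and G = "\<lambda>_. 0"])
    show "bounded_linear (\<lambda>F. coef (lext (\<lambda>\<alpha>. basis (restrict \<alpha> I)) F) \<beta>)"
      by (rule bounded_linear_compose[OF bounded_linear_coef bl])
  qed (use that in \<open>auto simp: basis.rep_eq bounded_linear_zero\<close>)
  have sum: "((\<lambda>\<alpha>. b \<alpha> * (\<Prod>i\<in>I. (q i - p i) ^ \<alpha> i)) has_sum evm I (\<lambda>i. (q i - p i) / e) F) (I \<rightarrow>\<^sub>E UNIV)"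
    if q: "\<forall>i\<in>I. \<bar>q i - p i\<bar> < e" for q
  proof -
    define z where "z i = (q i - p i) / e" for i
    have z: "\<bar>z i\<bar> \<le> 1" if "i \<in> I" for i using q e that by (auto simp: z_def field_simps)
    have chr: "norm (chr I z \<alpha>) \<le> 1" for \<alpha> using abs_chr_le[of I z] z by simp
    have "lext (chr I z) G = lext (chr I z) F"
      unfolding G_def
    proof (rule bounded_linear_eqI[where F = "\<lambda>F. lext (chr I z) (lext (\<lambda>\<alpha>. basis (restrict \<alpha> I)) F)"])
      show "bounded_linear (lext (chr I z))" by (rule bounded_linear_lext[OF chr])
      from bounded_linear_compose[OF this bl]
      show "bounded_linear (\<lambda>F. lext (chr I z) (lext (\<lambda>\<alpha>. basis (restrict \<alpha> I)) F))" .
    qed (simp add: chr_def)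
    hence "((\<lambda>\<alpha>. coef G \<alpha> *\<^sub>R chr I z \<alpha>) has_sum evm I z F) UNIV"
      using lext_has_sum[where F = "chr I z" and K = 1 and f = G, OF chr] by (simp add: evm_def)
    also have "?this \<longleftrightarrow> ((\<lambda>\<alpha>. b \<alpha> * (\<Prod>i\<in>I. (q i - p i) ^ \<alpha> i)) has_sum evm I z F) (I \<rightarrow>\<^sub>E UNIV)"
    proof (rule has_sum_cong_neutral)
      show "coef G \<alpha> *\<^sub>R chr I z \<alpha> = b \<alpha> * (\<Prod>i\<in>I. (q i - p i) ^ \<alpha> i)" for \<alpha>
        by (simp add: chr_def z_def b_def power_divide prod_dividef power_sum)
    qed (use outside in auto)
    finally show ?thesis by (simp add: z_def[abs_def])
  qed
  show "\<exists>e>0. \<exists>a. \<forall>q\<in>I \<rightarrow>\<^sub>E UNIV. (\<forall>i\<in>I. \<bar>q i - p i\<bar> < e) \<longrightarrow>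
          (\<lambda>\<alpha>. a \<alpha> * (\<Prod>i\<in>I. (q i - p i) ^ \<alpha> i)) summable_on (I \<rightarrow>\<^sub>E UNIV) \<and>
          (q \<in> D \<longrightarrow> f q = (\<Sum>\<^sub>\<infinity>\<alpha>\<in>I \<rightarrow>\<^sub>E UNIV. a \<alpha> * (\<Prod>i\<in>I. (q i - p i) ^ \<alpha> i)))"
  proof (intro exI[of _ e] exI[of _ b] conjI ballI impI e)
    fix q assume q: "\<forall>i\<in>I. \<bar>q i - p i\<bar> < e"
    show "(\<lambda>\<alpha>. b \<alpha> * (\<Prod>i\<in>I. (q i - p i) ^ \<alpha> i)) summable_on (I \<rightarrow>\<^sub>E UNIV)"
      by (rule has_sum_imp_summable[OF sum[OF q]])
    show "f q = (\<Sum>\<^sub>\<infinity>\<alpha>\<in>I \<rightarrow>\<^sub>E UNIV. b \<alpha> * (\<Prod>i\<in>I. (q i - p i) ^ \<alpha> i))" if "q \<in> D"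
      using F[OF that q] infsumI[OF sum[OF q]] by simp
  qed
qed

section \<open>Series in \<open>t\<close> and the parameters jointly\<close>

type_synonym 'i series2 = "(nat \<times> ('i \<Rightarrow> nat)) l1"

text \<open>Replaces \<open>t\<close> by a series \<open>Y\<close> in the parameters. Since
  \<open>t = 1 - r\<^sub>h / r\<close> and \<open>r\<^sub>h\<close> is a parameter, a fixed radius
  corresponds to such a \<open>Y\<close>.\<close>

definition psi :: "('i \<Rightarrow> nat) l1 \<Rightarrow> 'i series2 \<Rightarrow> ('i \<Rightarrow> nat) l1" where
  "psi Y = lext (\<lambda>(n, \<alpha>). Y ^ n * basis \<alpha>)"

text \<open>Gives the parameters numerical values and keeps \<open>t\<close> as a variable.\<close>

definition phi :: "'i set \<Rightarrow> ('i \<Rightarrow> real) \<Rightarrow> 'i series2 \<Rightarrow> nat l1" where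
  "phi I z = lext (\<lambda>(n, \<alpha>). chr I z \<alpha> *\<^sub>R basis n)"

definition iota :: "('i \<Rightarrow> nat) l1 \<Rightarrow> 'i series2" where
  "iota = lext (\<lambda>\<alpha>. basis (0, \<alpha>))"

lemma banach_hom_psi: "norm Y \<le> 1 \<Longrightarrow> banach_hom (psi Y)"
  unfolding psi_def
proof (rule banach_hom_lext)
  fix i j :: "nat \<times> ('a \<Rightarrow> nat)"
  show "(case i + j of (n, \<alpha>) \<Rightarrow> Y ^ n * basis \<alpha>) =
      (case i of (n, \<alpha>) \<Rightarrow> Y ^ n * basis \<alpha>) * (case j of (n, \<alpha>) \<Rightarrow> Y ^ n * basis \<alpha>)"
    by (cases i; cases j) (simp add: power_add basis_mult[symmetric] mult_ac)
  show "norm (case i of (n, \<alpha>) \<Rightarrow> Y ^ n * basis \<alpha>) \<le> 1" if "norm Y \<le> 1"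
    using norm_mult_le_mult[OF norm_power_le_1[OF that], of "basis _" 1] by (cases i) simp
qed (simp add: zero_prod_def basis_0)

lemma banach_hom_phi: "(\<And>i. i \<in> I \<Longrightarrow> \<bar>z i\<bar> \<le> 1) \<Longrightarrow> banach_hom (phi I z)"
  unfolding phi_def
proof (rule banach_hom_lext)
  fix i j :: "nat \<times> ('a \<Rightarrow> nat)"
  show "(case i + j of (n, \<alpha>) \<Rightarrow> chr I z \<alpha> *\<^sub>R basis n) =
      (case i of (n, \<alpha>) \<Rightarrow> chr I z \<alpha> *\<^sub>R basis n) * (case j of (n, \<alpha>) \<Rightarrow> chr I z \<alpha> *\<^sub>R basis n)"
    by (cases i; cases j) (simp add: chr_add basis_mult mult.commute)
  show "norm (case i of (n, \<alpha>) \<Rightarrow> chr I z \<alpha> *\<^sub>R (basis n :: nat l1)) \<le> 1" if "\<And>i. i \<in> I \<Longrightarrow> \<bar>z i\<bar> \<le> 1"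
    using abs_chr_le[OF that] by (cases i) simp
qed (simp add: zero_prod_def basis_0)

lemma banach_hom_iota: "banach_hom iota"
  unfolding iota_def by (rule banach_hom_lext) (simp_all add: basis_mult basis_0 flip: zero_prod_def)

lemma phi_avg: "phi I z (avg fst f) = avg id (phi I z f)" if "\<And>i. i \<in> I \<Longrightarrow> \<bar>z i\<bar> \<le> 1"
proof -
  interpret phi: banach_hom "phi I z" by (rule banach_hom_phi[OF that])
  interpret av: bounded_linear "avg (id :: nat \<Rightarrow> nat)" by (rule bounded_linear_avg)
  show ?thesis
    by (rule bounded_linear_eqI[where F = "\<lambda>f. phi I z (avg fst f)",
          OF bounded_linear_compose[OF phi.bounded_linear_axioms bounded_linear_avg]
          bounded_linear_compose[OF bounded_linear_avg phi.bounded_linear_axioms]])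
       (auto simp: phi.scaleR, simp add: phi_def av.scaleR)
qed

lemma phi_iota: "phi I z (iota f) = of_real (evm I z f)" if "\<And>i. i \<in> I \<Longrightarrow> \<bar>z i\<bar> \<le> 1"
proof -
  interpret phi: banach_hom "phi I z" by (rule banach_hom_phi[OF that])
  interpret iota: banach_hom "iota :: _ \<Rightarrow> 'a series2" by (rule banach_hom_iota)
  interpret evm: banach_hom "evm I z" by (rule banach_hom_evm[OF that])
  show ?thesis
    by (rule bounded_linear_eqI[where F = "\<lambda>f. phi I z (iota f)",
          OF bounded_linear_compose[OF phi.bounded_linear_axioms iota.bounded_linear_axioms]
          bounded_linear_compose[OF bounded_linear_of_real evm.bounded_linear_axioms]])
       (simp add: phi_def iota_def evm_def of_real_def basis_0)
qed

text \<open>Fixing the radius and fixing the parameters commute; both sides are homomorphic and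
  agree on monomials. This turns a value of the solution for given parameters into a value of one
  series in the parameters.\<close>

lemma evm_psi:
  assumes z: "\<And>i. i \<in> I \<Longrightarrow> \<bar>z i\<bar> \<le> 1" and Y: "norm Y \<le> 1"
  shows "evm I z (psi Y f) = subs (evm I z Y) (phi I z f)"
proof -
  interpret phi: banach_hom "phi I z" by (rule banach_hom_phi[OF z])
  interpret psi: banach_hom "psi Y" by (rule banach_hom_psi[OF Y])
  interpret evm: banach_hom "evm I z" by (rule banach_hom_evm[OF z])
  interpret subs: banach_hom "subs (evm I z Y)"
    by (rule banach_hom_subs) (use evm.contractive[of Y] Y in simp)
  show ?thesis
  proof (rule bounded_linear_eqI[where F = "\<lambda>f. evm I z (psi Y f)",
        OF bounded_linear_compose[OF evm.bounded_linear_axioms psi.bounded_linear_axioms]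
        bounded_linear_compose[OF subs.bounded_linear_axioms phi.bounded_linear_axioms]])
    fix i :: "nat \<times> ('a \<Rightarrow> nat)"
    have e: "evm I z (basis \<alpha>) = chr I z \<alpha>" for \<alpha> by (simp add: evm_def)
    have s: "subs (evm I z Y) (basis n) = evm I z Y ^ n" for n by (simp add: subs_def)
    have "psi Y (basis i) = Y ^ fst i * basis (snd i)" by (simp add: psi_def split_beta)
    moreover have "phi I z (basis i) = chr I z (snd i) *\<^sub>R basis (fst i)" by (simp add: phi_def split_beta)
    ultimately show "evm I z (psi Y (basis i)) = subs (evm I z Y) (phi I z (basis i))"
      by (simp add: evm.mult evm.power subs.scaleR e s)
  qed
qed

definition tB :: "'i series2" where "tB = basis (1, 0)"

lemma phi_tB: "phi I z tB = tt"
  by (simp add: phi_def tB_def tt_def)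

text \<open>The iterates are mapped to one another by every algebra homomorphism that respects the data,
  so taking the limit of this particular sequence makes the solution natural in the algebra.\<close>

definition sol :: "nat l1 \<Rightarrow> real \<Rightarrow> nat \<Rightarrow> real \<Rightarrow> (nat \<Rightarrow> real) \<Rightarrow> nat \<Rightarrow> nat l1" where
  "sol g0 l N \<kappa> a i = lim (\<lambda>n. (pT (avg id) tt g0 l N (of_real \<kappa>) (of_real \<circ> a) ^^ n)
     (\<lambda>i. if i = N then g0 else 0) i)"

lemma sol:
  assumes "l > 0" "N \<ge> 2" "small l N \<delta>" "norm g0 \<le> 2 / l" "\<bar>\<kappa>\<bar> \<le> \<delta>\<^sup>2"
    and "\<And>j. 1 \<le> j \<Longrightarrow> j < N \<Longrightarrow> \<bar>a j\<bar> \<le> 2 * \<delta>"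
  shows "sol g0 l N \<kappa> a \<in> pball l N \<delta>"
    "pT (avg id) tt g0 l N (of_real \<kappa>) (of_real \<circ> a) (sol g0 l N \<kappa> a) = sol g0 l N \<kappa> a"
    "(\<lambda>n. (pT (avg id) tt g0 l N (of_real \<kappa>) (of_real \<circ> a) ^^ n) (\<lambda>i. if i = N then g0 else 0) i)
       \<longlonglongrightarrow> sol g0 l N \<kappa> a i"
proof -
  obtain X where X: "X \<in> pball l N \<delta>" "pT (avg id) tt g0 l N (of_real \<kappa>) (of_real \<circ> a) X = X"
    "\<And>i. (\<lambda>n. (pT (avg id) tt g0 l N (of_real \<kappa>) (of_real \<circ> a) ^^ n) (\<lambda>i. if i = N then g0 else 0) i) \<longlonglongrightarrow> X i"
  proof (rule pT_fixed_point[where av = "avg id" and y = tt and l = l and N = N and \<delta> = \<delta> and ?g0.0 = g0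
        and \<kappa> = "of_real \<kappa>" and a = "of_real \<circ> a"])
  qed (use assms in \<open>auto simp: bounded_linear_avg norm_avg_le tt_def\<close>)
  have "sol g0 l N \<kappa> a = X" using X(3) by (simp add: fun_eq_iff sol_def limI)
  with X show "sol g0 l N \<kappa> a \<in> pball l N \<delta>"
    "pT (avg id) tt g0 l N (of_real \<kappa>) (of_real \<circ> a) (sol g0 l N \<kappa> a) = sol g0 l N \<kappa> a"
    "(\<lambda>n. (pT (avg id) tt g0 l N (of_real \<kappa>) (of_real \<circ> a) ^^ n) (\<lambda>i. if i = N then g0 else 0) i)
       \<longlonglongrightarrow> sol g0 l N \<kappa> a i"
    by simp_all
qed

section \<open>The open set of horizon parameters and its solutions\<close>

locale parameter_region =
  fixes k \<Lambda> l \<delta> :: real and N :: nat and g0 :: "nat l1"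
  assumes k: "k \<in> {-1, 0}" and N: "N \<ge> 2" and \<Lambda>: "\<Lambda> < 0" and l_def: "l = - \<Lambda> / 3"
    and small: "small l N \<delta>" and g0: "g0 * (l *\<^sub>R (3 - 3 * tt + tt\<^sup>2)) = 1" and g0_le: "norm g0 \<le> 2 / l"
begin

definition K :: "(nat \<Rightarrow> real) \<Rightarrow> real" where "K p = k / (p 0)\<^sup>2"
text \<open>Cutting off at \<open>N\<close> makes the whole sequence depend only on the coordinates
  0 to \<open>N\<close>, in which the solution is expanded.\<close>

definition A :: "(nat \<Rightarrow> real) \<Rightarrow> nat \<Rightarrow> real" where "A p j = (if j \<le> N then p j / p 0 else 0)"
definition X :: "(nat \<Rightarrow> real) \<Rightarrow> nat \<Rightarrow> nat l1" where "X p = sol g0 l N (K p) (A p)"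

text \<open>In scaled variables: p_0 > 1 / \<delta> gives |\<kappa>| at most \<delta>^2 because |k|
  is at most 1, and the window for p_j says that a_j lies between \<delta> and 2 \<delta>.\<close>

definition Pset :: "(nat \<Rightarrow> real) set" where
  "Pset = horizon_parameters k N \<Lambda> \<inter> {p. p 0 > 1 / \<delta> \<and>
     (\<forall>j\<in>{1..N-1}. \<delta> * p 0 < p j \<and> p j < 2 * \<delta> * p 0) \<and> (N \<ge> 3 \<longrightarrow> p 1 > p 2)}"

definition mm :: "(nat \<Rightarrow> real) \<Rightarrow> real \<Rightarrow> real" where
  "mm p r = p 0 ^ 3 * ((K p + l) / 2 + subs (1 - p 0 / r)
     (tt * avg id (pE (avg id) tt l N (of_real (K p)) (of_real \<circ> A p) (X p))))"

definition eS :: "(nat \<Rightarrow> real) \<Rightarrow> nat l1" where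
  "eS p = tt * avg id (2 * (1 - tt) ^ 3 * pG N (X p))"

definition SS :: "(nat \<Rightarrow> real) \<Rightarrow> real \<Rightarrow> real" where
  "SS p r = exp (subs (1 - p 0 / r) (eS p) - subs 1 (eS p))"

definition ww :: "(nat \<Rightarrow> real) \<Rightarrow> nat \<Rightarrow> real \<Rightarrow> real" where
  "ww p j r = p 0 * subs (1 - p 0 / r) (pu (avg id) tt N (of_real \<circ> A p) (X p) j)"

lemma l: "l > 0" using \<Lambda> by (simp add: l_def)

lemma \<delta>: "\<delta> > 0" using small by (simp add: small_def)

lemma PsetD:
  assumes "p \<in> Pset"
  shows "p 0 > 1 / \<delta>" "p 0 > 0" "1 / p 0 < \<delta>" "\<And>j. 1 \<le> j \<Longrightarrow> j < N \<Longrightarrow> \<delta> * p 0 < p j"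
    "\<And>j. 1 \<le> j \<Longrightarrow> j < N \<Longrightarrow> p j < 2 * \<delta> * p 0" "N \<ge> 3 \<Longrightarrow> p 1 > p 2"
    "2 * p N = k * p 0 - \<Lambda> * p 0 ^ 3 / 3" "\<And>j. 1 \<le> j \<Longrightarrow> j < N \<Longrightarrow> 0 < p j"
proof -
  show p: "p 0 > 1 / \<delta>" and p0: "p 0 > 0" "2 * p N = k * p 0 - \<Lambda> * p 0 ^ 3 / 3"
    using assms by (auto simp: Pset_def horizon_parameters_def)
  show "1 / p 0 < \<delta>" using p p0 \<delta> by (simp add: field_simps)
  show 1: "\<delta> * p 0 < p j" "p j < 2 * \<delta> * p 0" if "1 \<le> j" "j < N" for j
    using assms that by (auto simp: Pset_def)
  show "N \<ge> 3 \<Longrightarrow> p 1 > p 2" using assms by (simp add: Pset_def)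
  show "0 < p j" if "1 \<le> j" "j < N" for j
    using 1(1)[OF that] \<delta> p0 by (smt (verit) mult_pos_pos)
qed

lemma k_abs: "\<bar>k\<bar> \<le> 1" using k by auto

lemma K_le: "\<bar>K p\<bar> \<le> \<delta>\<^sup>2" if "p \<in> Pset"
proof -
  have "\<bar>K p\<bar> = \<bar>k\<bar> * (1 / p 0)\<^sup>2" using PsetD[OF that] by (simp add: K_def power_divide)
  also have "\<dots> \<le> 1 * \<delta>\<^sup>2"
    using PsetD[OF that] k_abs by (intro mult_mono power_mono) auto
  finally show ?thesis by simp
qed

lemma A_bounds: "\<delta> < A p j" "\<bar>A p j\<bar> \<le> 2 * \<delta>" if "p \<in> Pset" "1 \<le> j" "j < N"
proof -
  have "A p j = p j / p 0" "\<bar>p j / p 0\<bar> = p j / p 0"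
    using that PsetD(2)[OF that(1)] PsetD(8)[OF that] by (simp_all add: A_def)
  thus "\<delta> < A p j" "\<bar>A p j\<bar> \<le> 2 * \<delta>"
    using PsetD(2)[OF that(1)] PsetD(4,5)[OF that]
    by (simp_all only:) (simp_all add: field_simps)
qed

lemma X_sol:
  assumes p: "p \<in> Pset"
  shows "X p \<in> pball l N \<delta>" "pT (avg id) tt g0 l N (of_real (K p)) (of_real \<circ> A p) (X p) = X p"
    "(\<lambda>n. (pT (avg id) tt g0 l N (of_real (K p)) (of_real \<circ> A p) ^^ n)
       (\<lambda>i. if i = N then g0 else 0) i) \<longlonglongrightarrow> X p i"
  using sol[where a = "A p", OF l N small g0_le K_le[OF p] A_bounds(2)[OF p]] by (simp_all add: X_def)

lemma black_hole:
  assumes p: "p \<in> Pset"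
  shows "eym_black_hole k N \<Lambda> (p 0) (mm p) (SS p) (ww p)"
    and "\<And>j. j \<in> {1..N-1} \<Longrightarrow> ww p j (p 0) = p j" and "mm p (p 0) = p N"
    and "nontrivial_gauge_field N (p 0) (ww p)" and "nodeless N (p 0) (ww p)"
proof -
  interpret black_hole_profile l "K p" \<delta> N "A p" g0 "X p" "p 0" k \<Lambda>
  proof
    show "A p 1 > A p 2" if "N \<ge> 3"
      using PsetD[OF p] that by (simp add: A_def divide_strict_right_mono)
    show "k \<le> 0" using k by auto
    show "K p = k / (p 0)\<^sup>2" by (simp add: K_def)
  qed (fact l N g0 X_sol(1,2)[OF p] PsetD(2)[OF p] l_def \<delta> | erule (1) A_bounds(1)[OF p])+
  have eq: "mm p = mB" "SS p = SB" "ww p = \<omega>B"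
    by (simp_all add: fun_eq_iff mm_def SS_def ww_def eS_def mB_def SB_def \<omega>B_def M_def q_def u_def eE_def eQ_def)
  show "eym_black_hole k N \<Lambda> (p 0) (mm p) (SS p) (ww p)" unfolding eq by (rule black_hole)
  show "nontrivial_gauge_field N (p 0) (ww p)" unfolding eq by (rule nontrivial)
  show "nodeless N (p 0) (ww p)" unfolding eq by (rule nodeless)
  show "ww p j (p 0) = p j" if "j \<in> {1..N-1}" for j
  proof -
    have "1 \<le> j" "j < N" using that N by auto
    thus ?thesis unfolding eq using \<omega>B_horizon[of j] PsetD[OF p] by (simp add: A_def)
  qed
  show "mm p (p 0) = p N" unfolding eq using mB_horizon PsetD(7)[OF p] by simp
qed

text \<open>The problem is solved once, for the generic parameters \<open>Q i\<close>, namely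
  \<open>p i\<close> plus \<open>e\<close> times a formal variable. Evaluating the formal variables
  at \<open>z\<close> specialises the data, and hence the limit of the iterates, to those of every
  \<open>q\<close> in the region with \<open>q i = p i + e * z i\<close>.\<close>

lemma analytic_point:
  assumes p: "p \<in> Pset"
  obtains e :: real and Q :: "nat \<Rightarrow> (nat \<Rightarrow> nat) l1" and KA :: "(nat \<Rightarrow> nat) l1"
    and aB XB :: "nat \<Rightarrow> nat series2"
  where "e > 0" "e \<le> p 0" "\<And>i. Q i = of_real (p i) + e *\<^sub>R basis (unit_index i)"
    "\<And>z. (\<And>i. i \<in> {0..N} \<Longrightarrow> \<bar>z i\<bar> \<le> 1) \<Longrightarrow> (\<And>q. q \<in> Pset \<Longrightarrow>
       (\<And>i. i \<in> {0..N} \<Longrightarrow> q i = p i + e * z i) \<Longrightarrow>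
       evm {0..N} z (Q 0) = q 0 \<and> evm {0..N} z KA = K q \<and> phi {0..N} z \<circ> aB = of_real \<circ> A q \<and> phi {0..N} z \<circ> XB = X q)"
proof -
  let ?I = "{0..N}"
  \<comment> \<open>The radius is such that the norm bounds survive for the generic parameters: 1 /
    (p_0 - e) is at most \<delta> and (p_j + e) / (p_0 - e) is at most 2 \<delta>.\<close>
  define e where "e = Min (insert (p 0 - 1 / \<delta>) ((\<lambda>j. (2 * \<delta> * p 0 - p j) / (1 + 2 * \<delta>)) ` {1..N-1}))"
  note D = PsetD[OF p]
  have e: "e > 0"
    unfolding e_def using D(1) D(5) \<delta> N by (subst Min_gr_iff) (auto intro!: divide_pos_pos)
  have e0: "e \<le> p 0 - 1 / \<delta>" unfolding e_def by (rule Min_le) auto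
  have ej: "e * (1 + 2 * \<delta>) \<le> 2 * \<delta> * p 0 - p j" if "1 \<le> j" "j < N" for j
  proof -
    have "e \<le> (2 * \<delta> * p 0 - p j) / (1 + 2 * \<delta>)"
      unfolding e_def by (rule Min_le) (use that in auto)
    thus ?thesis using \<delta> by (simp add: pos_le_divide_eq)
  qed
  have e1: "e < p 0" using e0 \<delta> by (smt (verit) divide_pos_pos)
  define Z :: "nat \<Rightarrow> (nat \<Rightarrow> nat) l1" where "Z i = basis (unit_index i)" for i
  define Q where "Q i = of_real (p i) + e *\<^sub>R Z i" for i
  have Qn: "norm (Q i) \<le> \<bar>p i\<bar> + e" for i
    unfolding Q_def by (rule norm_triangle_le) (use e in \<open>simp add: Z_def\<close>)
  have nx: "norm (- ((e / p 0) *\<^sub>R Z 0)) = e / p 0" using e D by (simp add: Z_def)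
  moreover have "e / p 0 < 1" using e1 D by simp
  ultimately obtain v where v: "(1 - (- ((e / p 0) *\<^sub>R Z 0))) * v = 1" "norm v \<le> 1 / (1 - e / p 0)"
    using neumann_inverse[of "- ((e / p 0) *\<^sub>R Z 0)"] by auto
  define V where "V = (1 / p 0) *\<^sub>R v"
  have Q0: "Q 0 = p 0 *\<^sub>R (1 - (- ((e / p 0) *\<^sub>R Z 0)))"
    using D by (simp add: Q_def of_real_def scaleR_add_right)
  have QV: "Q 0 * V = 1" unfolding Q0 V_def using D v(1) by simp
  have "norm V \<le> (1 / p 0) * (1 / (1 - e / p 0))"
    unfolding V_def norm_scaleR using v(2) D by (intro mult_mono) auto
  also have "\<dots> = 1 / (p 0 - e)" using D e1 by (simp add: field_simps)
  finally have V: "norm V \<le> 1 / (p 0 - e)" .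
  have "1 / (p 0 - e) \<le> \<delta>" using e0 e1 \<delta> by (simp add: field_simps)
  hence V': "norm V \<le> \<delta>" using V by simp
  define KA where "KA = k *\<^sub>R V\<^sup>2"
  define aA where "aA j = (if j \<le> N then Q j * V else 0)" for j
  have KA: "norm KA \<le> 1 * \<delta>\<^sup>2"
    unfolding KA_def norm_scaleR using k_abs V'
    by (intro mult_mono order_trans[OF norm_power_ineq] power_mono) auto
  have aA: "norm (aA j) \<le> 2 * \<delta>" if j: "1 \<le> j" "j < N" for j
  proof -
    have "norm (Q j * V) \<le> (p j + e) * (1 / (p 0 - e))"
      by (rule norm_mult_le_mult) (use Qn[of j] D(8)[OF j] V in auto)
    hence "norm (aA j) \<le> (p j + e) * (1 / (p 0 - e))" using j by (simp add: aA_def)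
    also have "\<dots> \<le> 2 * \<delta>" using ej[OF j] e1 by (simp add: field_simps)
    finally show ?thesis .
  qed
  interpret iota: banach_hom "iota :: _ \<Rightarrow> nat series2" by (rule banach_hom_iota)
  define KB where "KB = iota KA"
  define aB where "aB = (\<lambda>j. iota (aA j))"
  have tB: "norm (tB :: nat series2) \<le> 1" by (simp add: tB_def)
  obtain gB :: "nat series2" where gB: "gB * (l *\<^sub>R (3 - 3 * tB + tB\<^sup>2)) = 1" "norm gB \<le> 2 / l"
    using quadratic_inverse[OF tB l] by blast
  have KB_le: "norm KB \<le> \<delta>\<^sup>2" using iota.contractive[of KA] KA by (simp add: KB_def)
  have aB_le: "norm (aB j) \<le> 2 * \<delta>" if "1 \<le> j" "j < N" for j
    using iota.contractive[of "aA j"] aA[OF that] by (simp add: aB_def)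
  obtain XB where XB: "\<And>i. (\<lambda>n. (pT (avg fst) tB gB l N KB aB ^^ n) (\<lambda>i. if i = N then gB else 0) i) \<longlonglongrightarrow> XB i"
    using pT_fixed_point[where av = "avg fst" and a = aB, OF bounded_linear_avg norm_avg_le tB l N small gB(2) KB_le aB_le]
    by blast
  show thesis
  proof (rule that[OF e])
    show "e \<le> p 0" using e1 by simp
    show "Q i = of_real (p i) + e *\<^sub>R basis (unit_index i)" for i by (simp add: Q_def Z_def)
    fix z :: "nat \<Rightarrow> real" and q
    assume z: "\<And>i. i \<in> ?I \<Longrightarrow> \<bar>z i\<bar> \<le> 1" and q: "q \<in> Pset" and qz: "\<And>i. i \<in> ?I \<Longrightarrow> q i = p i + e * z i"
    interpret evm: banach_hom "evm ?I z" by (rule banach_hom_evm[OF z])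
    interpret phi: banach_hom "phi ?I z" by (rule banach_hom_phi[OF z])
    have phi: "banach_hom (phi ?I z)" ..
    have pi: "phi ?I z (iota f) = of_real (evm ?I z f)" for f by (rule phi_iota) (rule z)
    have pa: "phi ?I z (avg fst f) = avg id (phi ?I z f)" for f by (rule phi_avg) (rule z)
    have eQ: "evm ?I z (Q i) = q i" if "i \<in> ?I" for i
    proof -
      have "evm ?I z (Z i) = z i" using that by (simp add: evm_def Z_def chr_unit_index)
      thus ?thesis unfolding Q_def evm.add evm.of_real evm.scaleR using qz[OF that] by simp
    qed
    have q0: "q 0 > 0" by (rule PsetD[OF q])
    have "evm ?I z (Q 0) * evm ?I z V = 1" by (simp add: QV evm.one flip: evm.mult)
    hence eV: "evm ?I z V = 1 / q 0" using q0 by (simp add: eQ field_simps)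
    have eK: "evm ?I z KA = K q" by (simp add: KA_def evm.scaleR evm.power eV K_def power_divide)
    have phiK: "phi ?I z KB = of_real (K q)" by (simp add: KB_def pi eK)
    have phia: "phi ?I z \<circ> aB = of_real \<circ> A q"
    proof
      fix j
      have "evm ?I z (aA j) = A q j" by (simp add: aA_def A_def evm.mult eQ eV evm.zero)
      thus "(phi ?I z \<circ> aB) j = (of_real \<circ> A q) j" by (simp add: aB_def pi)
    qed
    have num: "phi ?I z 3 = 3" using phi.of_real[of 3] by simp
    have "phi ?I z (gB * (l *\<^sub>R (3 - 3 * tB + tB\<^sup>2))) = 1" by (simp only: gB phi.one)
    hence inv: "phi ?I z gB * (l *\<^sub>R (3 - 3 * tt + tt\<^sup>2)) = 1"
      by (simp add: phi.mult phi.scaleR phi.add phi.diff phi.power phi_tB num)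
    \<comment> \<open>Inverses in a commutative ring are unique, so the inverse chosen in the large
      algebra specialises to the fixed \<open>g0\<close>.\<close>
    have "phi ?I z gB = phi ?I z gB * (g0 * (l *\<^sub>R (3 - 3 * tt + tt\<^sup>2)))" by (simp only: g0 mult_1_right)
    also have "\<dots> = g0 * (phi ?I z gB * (l *\<^sub>R (3 - 3 * tt + tt\<^sup>2)))" by (simp only: mult_ac)
    finally have phig: "phi ?I z gB = g0" by (simp only: inv mult_1_right)
    have "phi ?I z (XB i) = X q i" for i
    proof (rule LIMSEQ_unique)
      let ?x = "\<lambda>n. (pT (avg fst) tB gB l N KB aB ^^ n) (\<lambda>i. if i = N then gB else 0)"
      show "(\<lambda>n. phi ?I z (?x n i)) \<longlonglongrightarrow> phi ?I z (XB i)" by (rule phi.tendsto[OF XB])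
      have "phi ?I z \<circ> (\<lambda>i. if i = N then gB else 0) = (\<lambda>i. if i = N then g0 else 0)"
        by (auto simp: fun_eq_iff phig phi.zero)
      hence "phi ?I z \<circ> ?x n = (pT (avg id) tt g0 l N (of_real (K q)) (of_real \<circ> A q) ^^ n)
          (\<lambda>i. if i = N then g0 else 0)" for n
        using pT_iterate_hom[where av = "avg fst" and av' = "avg id", OF phi pa, where y = tB and ?g0.0 = gB and l = l and N = N
            and \<kappa> = KB and a = aB and n = n and X = "\<lambda>i. if i = N then gB else 0"]
        by (simp only: phi_tB phiK phia phig)
      hence "(\<lambda>n. phi ?I z (?x n i)) = (\<lambda>n. (pT (avg id) tt g0 l N (of_real (K q)) (of_real \<circ> A q) ^^ n)
          (\<lambda>i. if i = N then g0 else 0) i)"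
        by (metis comp_apply)
      thus "(\<lambda>n. phi ?I z (?x n i)) \<longlonglongrightarrow> X q i" using X_sol(3)[OF q, of i] by simp
    qed
    with eK phia eQ show "evm ?I z (Q 0) = q 0 \<and> evm ?I z KA = K q \<and> phi ?I z \<circ> aB = of_real \<circ> A q \<and> phi ?I z \<circ> XB = X q"
      by (auto simp: fun_eq_iff)
  qed
qed

lemma analytic_at:
  assumes p: "p \<in> Pset" and r: "p 0 \<le> r"
  shows "\<exists>e>0. \<exists>Fm FS Fw. \<forall>q\<in>Pset. q 0 \<le> r \<longrightarrow> (\<forall>i\<in>{0..N}. \<bar>q i - p i\<bar> < e) \<longrightarrow>
     mm q r = evm {0..N} (\<lambda>i. (q i - p i) / e) Fm \<and>
     SS q r = evm {0..N} (\<lambda>i. (q i - p i) / e) FS \<and>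
     (\<forall>j. ww q j r = evm {0..N} (\<lambda>i. (q i - p i) / e) (Fw j))"
proof -
  let ?I = "{0..N}"
  obtain e :: real and Q :: "nat \<Rightarrow> (nat \<Rightarrow> nat) l1" and KA :: "(nat \<Rightarrow> nat) l1"
    and aB XB :: "nat \<Rightarrow> nat series2" where e: "e > 0" "e \<le> p 0"
    and Q: "\<And>i. Q i = of_real (p i) + e *\<^sub>R basis (unit_index i)"
    and nat: "\<And>z q. (\<And>i. i \<in> ?I \<Longrightarrow> \<bar>z i\<bar> \<le> 1) \<Longrightarrow> q \<in> Pset \<Longrightarrow>
       (\<And>i. i \<in> ?I \<Longrightarrow> q i = p i + e * z i) \<Longrightarrow>
       evm ?I z (Q 0) = q 0 \<and> evm ?I z KA = K q \<and> phi ?I z \<circ> aB = of_real \<circ> A q \<and> phi ?I z \<circ> XB = X q"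
    by (rule analytic_point[OF p]) blast
  have p0: "p 0 > 0" by (rule PsetD[OF p])
  define Y where "Y = 1 - (1 / r) *\<^sub>R Q 0"
  have Y: "norm Y \<le> 1"
  proof -
    have "Y = of_real (1 - p 0 / r) - (e / r) *\<^sub>R basis (unit_index 0)"
      by (simp add: Y_def Q scaleR_add_right of_real_def scaleR_diff_left)
    hence "norm Y \<le> \<bar>1 - p 0 / r\<bar> + \<bar>e / r\<bar>"
      using norm_triangle_ineq4[of "of_real (1 - p 0 / r)" "(e / r) *\<^sub>R basis (unit_index 0)"]
      by (simp only: norm_of_real norm_scaleR norm_basis mult_1_right)
    also have "\<dots> = 1 - p 0 / r + e / r"
      using r p0 e by (intro arg_cong2[where f = "(+)"] abs_of_nonneg) auto
    \<comment> \<open>Here \<open>e \<le> p 0\<close> enters: it makes substitution of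
      \<open>Y\<close> admissible up to and including the horizon r = p_0.\<close>
    also have "\<dots> \<le> 1" using divide_right_mono[OF e(2), of r] r p0 by simp
    finally show ?thesis .
  qed
  define EB where "EB = pE (avg fst) tB l N (iota KA) aB XB"
  define fS where "fS = tB * avg fst (2 * (1 - tB) ^ 3 * pG N XB)"
  define Fm where "Fm = Q 0 ^ 3 * ((1/2) *\<^sub>R (KA + of_real l) + psi Y (tB * avg fst EB))"
  \<comment> \<open>The term \<open>psi 1\<close> evaluates at t = 1 and reproduces the
    normalisation of the lapse function at infinity.\<close>
  define FS where "FS = exp (psi Y fS - psi 1 fS)"
  define Fw where "Fw j = Q 0 * psi Y (pu (avg fst) tB N aB XB j)" for j
  have "mm q r = evm ?I z Fm \<and> SS q r = evm ?I z FS \<and> (\<forall>j. ww q j r = evm ?I z (Fw j))"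
    if q: "q \<in> Pset" "\<forall>i\<in>?I. \<bar>q i - p i\<bar> < e" and z_def: "z = (\<lambda>i. (q i - p i) / e)" for q z
  proof -
    have z: "\<bar>z i\<bar> \<le> 1" if "i \<in> ?I" for i
      using q(2) e(1) that unfolding z_def abs_divide by (simp add: less_imp_le)
    have "q i = p i + e * z i" for i using e(1) by (simp add: z_def)
    from nat[OF z q(1) this] have n: "evm ?I z (Q 0) = q 0" "evm ?I z KA = K q"
      "phi ?I z \<circ> aB = of_real \<circ> A q" "phi ?I z \<circ> XB = X q" by auto
    interpret evm: banach_hom "evm ?I z" by (rule banach_hom_evm[OF z])
    have evm: "banach_hom (evm ?I z)" ..
    interpret phi: banach_hom "phi ?I z" by (rule banach_hom_phi[OF z])
    have phi: "banach_hom (phi ?I z)" ..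
    have pi: "phi ?I z (iota f) = of_real (evm ?I z f)" for f by (rule phi_iota) (rule z)
    have pa: "phi ?I z (avg fst f) = avg id (phi ?I z f)" for f by (rule phi_avg) (rule z)
    have ep: "evm ?I z (psi Y f) = subs (evm ?I z Y) (phi ?I z f)" for f
      by (rule evm_psi[OF _ Y]) (rule z)
    have ep1: "evm ?I z (psi 1 f) = subs (evm ?I z 1) (phi ?I z f)" for f
      by (rule evm_psi) (use z in auto)
    note hom = pT_hom(1)[where av = "avg fst" and av' = "avg id" and N = N and a = aB and X = XB,
        OF phi pa, unfolded n]
      pT_hom(2)[where av = "avg fst" and av' = "avg id" and N = N and X = XB, OF phi pa, unfolded n]
      pT_hom(3)[where av = "avg fst" and av' = "avg id" and N = N and a = aB and X = XB,
        OF phi pa, unfolded n]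
    have num: "phi ?I z (numeral m) = numeral m" for m using phi.of_real[of "numeral m"] by simp
    have EY: "evm ?I z Y = 1 - q 0 / r"
      by (simp add: Y_def evm.diff evm.one evm.scaleR n)
    have "phi ?I z (iota KA) = of_real (K q)" by (simp add: pi n)
    hence E: "phi ?I z EB = pE (avg id) tt l N (of_real (K q)) (of_real \<circ> A q) (X q)"
      using hom(3)[where l = l and \<kappa> = "iota KA"] by (simp add: EB_def phi_tB)
    have m: "mm q r = evm ?I z Fm"
      by (simp only: mm_def Fm_def evm.mult evm.power evm.add evm.scaleR evm.of_real n
          ep EY phi.mult phi_tB pa E) simp
    have S0: "phi ?I z fS = eS q"
      by (simp only: fS_def eS_def phi.mult phi.power phi.diff phi.one num pa phi_tB hom(2))
    have S: "SS q r = evm ?I z FS"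
      unfolding FS_def banach_hom_exp[OF evm] evm.diff
      using ep[of fS] ep1[of fS] by (simp add: EY S0 SS_def evm.one)
    have w: "ww q j r = evm ?I z (Fw j)" for j
      by (simp only: ww_def Fw_def evm.mult n ep EY hom(1) phi_tB)
    from m S w show ?thesis by blast
  qed
  thus ?thesis using e(1) by (intro exI[of _ e] conjI exI[of _ Fm] exI[of _ FS] exI[of _ Fw]) auto
qed

lemma analytic:
  "real_analytic_on {0..N} {p \<in> Pset. p 0 \<le> r} (\<lambda>p. mm p r)"
  "real_analytic_on {0..N} {p \<in> Pset. p 0 \<le> r} (\<lambda>p. SS p r)"
  "real_analytic_on {0..N} {p \<in> Pset. p 0 \<le> r} (\<lambda>p. ww p j r)"
proof -
  have "\<exists>e>0. \<exists>F. \<forall>q\<in>{p \<in> Pset. p 0 \<le> r}. (\<forall>i\<in>{0..N}. \<bar>q i - p i\<bar> < e) \<longrightarrow>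
      f q = evm {0..N} (\<lambda>i. (q i - p i) / e) F"
    if p: "p \<in> {p \<in> Pset. p 0 \<le> r}" and f: "f \<in> {\<lambda>p. mm p r, \<lambda>p. SS p r, \<lambda>p. ww p j r}" for p f
  proof -
    obtain e Fm FS Fw where e: "e > 0" and *: "\<forall>q\<in>Pset. q 0 \<le> r \<longrightarrow> (\<forall>i\<in>{0..N}. \<bar>q i - p i\<bar> < e) \<longrightarrow>
     mm q r = evm {0..N} (\<lambda>i. (q i - p i) / e) Fm \<and>
     SS q r = evm {0..N} (\<lambda>i. (q i - p i) / e) FS \<and>
     (\<forall>j. ww q j r = evm {0..N} (\<lambda>i. (q i - p i) / e) (Fw j))"
      using analytic_at[of p r] p by auto
    have "\<exists>F. \<forall>q\<in>{p \<in> Pset. p 0 \<le> r}. (\<forall>i\<in>{0..N}. \<bar>q i - p i\<bar> < e) \<longrightarrow>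
      f q = evm {0..N} (\<lambda>i. (q i - p i) / e) F"
      using f * by (elim insertE emptyE) (blast | simp; blast)+
    with e show ?thesis by blast
  qed
  thus "real_analytic_on {0..N} {p \<in> Pset. p 0 \<le> r} (\<lambda>p. mm p r)"
    "real_analytic_on {0..N} {p \<in> Pset. p 0 \<le> r} (\<lambda>p. SS p r)"
    "real_analytic_on {0..N} {p \<in> Pset. p 0 \<le> r} (\<lambda>p. ww p j r)"
    by (auto intro!: real_analytic_onI)
qed

lemma openin_Pset: "openin (top_of_set (horizon_parameters k N \<Lambda>)) Pset"
proof -
  have c: "continuous_on UNIV (\<lambda>p :: nat \<Rightarrow> real. p i)" for i
    by (rule continuous_on_product_coordinates)
  have "{p :: nat \<Rightarrow> real. \<forall>j\<in>{1..N-1}. \<delta> * p 0 < p j \<and> p j < 2 * \<delta> * p 0} =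
      (\<Inter>j\<in>{1..N-1}. {p. \<delta> * p 0 < p j \<and> p j < 2 * \<delta> * p 0})" by auto
  also have "open \<dots>"
    by (intro open_INT ballI open_Collect_conj open_Collect_less continuous_intros c) auto
  finally have "open {p :: nat \<Rightarrow> real. p 0 > 1 / \<delta> \<and>
     (\<forall>j\<in>{1..N-1}. \<delta> * p 0 < p j \<and> p j < 2 * \<delta> * p 0) \<and> (N \<ge> 3 \<longrightarrow> p 1 > p 2)}"
    by (intro open_Collect_conj open_Collect_imp open_Collect_less continuous_intros c) auto
  thus ?thesis unfolding Pset_def openin_open by blast
qed

lemma Pset_nonempty: "Pset \<noteq> {}"
proof -
  define s where "s = 1 / \<delta> + 1"
  \<comment> \<open>The factors 8/5 and 3/2 both lie in the window between 1 and 2, and their order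
    gives p_1 > p_2; coordinate \<open>N\<close> is determined by the horizon condition.\<close>
  define p where "p = restrict (\<lambda>j. if j = 0 then s else if j = N then (k * s - \<Lambda> * s ^ 3 / 3) / 2
     else if j = 1 then 8/5 * \<delta> * s else 3/2 * \<delta> * s) {0..N}"
  have s: "s > 1 / \<delta>" "\<delta> * s > 0" "s > 0" using \<delta> by (simp_all add: s_def add_pos_pos)
  have v: "p 0 = s" "p N = (k * s - \<Lambda> * s ^ 3 / 3) / 2" "p 1 = 8/5 * \<delta> * s"
    "1 < j \<Longrightarrow> j < N \<Longrightarrow> p j = 3/2 * \<delta> * s" for j
    using N by (simp_all add: p_def)
  have pj: "p j = 8/5 * \<delta> * s \<or> p j = 3/2 * \<delta> * s" if "j \<in> {1..N-1}" for j
  proof -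
    have "1 \<le> j" "j < N" using that N by auto
    thus ?thesis using v(3) v(4)[of j] by (cases "j = 1") auto
  qed
  have "\<forall>j\<in>{1..N-1}. \<delta> * p 0 < p j \<and> p j < 2 * \<delta> * p 0"
    using pj s(2) by (fastforce simp: v(1))
  moreover have "p 1 > p 2" if "N \<ge> 3" using v(3) v(4)[of 2] that s by simp
  moreover have "p \<in> horizon_parameters k N \<Lambda>"
    unfolding horizon_parameters_def using v(1,2) s by (auto simp: p_def)
  ultimately have "p \<in> Pset" unfolding Pset_def using v(1) s by simp
  thus ?thesis by blast
qed

end

theorem theorem8:
  fixes k \<Lambda> :: real and N :: nat
  assumes "k \<in> {-1, 0}" and "N \<ge> 2" and "\<Lambda> < 0"
  shows "\<exists>(P :: (nat \<Rightarrow> real) set)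
            (m :: (nat \<Rightarrow> real) \<Rightarrow> real \<Rightarrow> real)
            (S :: (nat \<Rightarrow> real) \<Rightarrow> real \<Rightarrow> real)
            (\<omega> :: (nat \<Rightarrow> real) \<Rightarrow> nat \<Rightarrow> real \<Rightarrow> real).
     P \<noteq> {} \<and>
     openin (top_of_set (horizon_parameters k N \<Lambda>)) P \<and>
     (\<forall>p\<in>P.
        eym_black_hole k N \<Lambda> (p 0) (m p) (S p) (\<omega> p) \<and>
        (\<forall>j\<in>{1..N - 1}. \<omega> p j (p 0) = p j) \<and>
        m p (p 0) = p N \<and>
        nontrivial_gauge_field N (p 0) (\<omega> p) \<and>
        nodeless N (p 0) (\<omega> p)) \<and>
     (\<forall>r.
        real_analytic_on {0..N} {p \<in> P. p 0 \<le> r} (\<lambda>p. m p r) \<and>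
        real_analytic_on {0..N} {p \<in> P. p 0 \<le> r} (\<lambda>p. S p r) \<and>
        (\<forall>j\<in>{1..N - 1}. real_analytic_on {0..N} {p \<in> P. p 0 \<le> r} (\<lambda>p. \<omega> p j r)))"
proof -
  have l: "- \<Lambda> / 3 > 0" using assms by simp
  obtain \<delta> where \<delta>: "small (- \<Lambda> / 3) N \<delta>" using small_exists[OF l] by blast
  have "norm tt \<le> 1" by (simp add: tt_def)
  from quadratic_inverse[OF this l] obtain g0 where
    g0: "g0 * ((- \<Lambda> / 3) *\<^sub>R (3 - 3 * tt + tt\<^sup>2)) = 1" "norm g0 \<le> 2 / (- \<Lambda> / 3)" by blast
  interpret parameter_region k \<Lambda> "- \<Lambda> / 3" \<delta> N g0
    by unfold_locales (fact assms \<delta> g0 refl)+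
  show ?thesis
    by (intro exI[of _ Pset] exI[of _ mm] exI[of _ SS] exI[of _ ww] conjI ballI allI
        Pset_nonempty openin_Pset black_hole analytic)
qed

end
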